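(* Let $R$ be a commutative ring with unit, let $n$ be a natural number, let $\delta,\varepsilon\in R$, and let $\mathcal{R}\mathrm{Br}_n(\delta,\varepsilon)$ be the rook-Brauer algebra. Let $0\le \ell\le m\le n-1$. Let $A$ be a subalgebra of $\mathcal{R}\mathrm{Br}_n(\delta,\varepsilon)$ such that (i) as an $R$-module, $A$ is free on a subset of the rook-Brauer $n$-diagrams, and (ii) for $i$ in the range $\ell\le i\le m$ and for each link state $p\in P_i$, if $A$ contains at least one diagram with right link state $p$, then $A$ contains an idempotent $e_p$ such that in $A$ we have equality of left ideals $A\cdot e_p=A\cap J_p$. Then there is a chain of isomorphisms $$\mathrm{Tor}^{A/(A\cap I_{\ell-1})}_*(\mathbf{1},\mathbf{1})\cong \mathrm{Tor}^{A/(A\cap I_{\ell})}_*(\mathbf{1},\mathbf{1})\cong\cdots\cong \mathrm{Tor}^{A/(A\cap I_{m})}_*(\mathbf{1},\mathbf{1}).$$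
   Context: Algebras are associative and unital; a subalgebra contains the identity. A rook-Brauer $n$-diagram is a graph on two columns (left and right) of $n$ nodes each, in which each node is connected to at most one other node by an edge; a node with no edge is called a missing edge. An edge joining a left node to a right node is a left-to-right connection. The rook-Brauer algebra $\mathcal{R}\mathrm{Br}_n(\delta,\varepsilon)$ is the free $R$-module on the rook-Brauer $n$-diagrams, with the bilinear multiplication given on diagrams $x,y$ as follows: identify the right nodes of $x$ with the left nodes of $y$; the product $xy$ is $\delta^a\varepsilon^b$ times the diagram in which two outer nodes are joined exactly when they are connected by a path in the concatenated graph (an outer node whose path ends at a middle node becomes a node with no edge). Here $a$ is the number of closed loops, and $b$ the number of contractible components (paths, including isolated nodes), among the components of the concatenated graph consisting entirely of middle nodes. The trivial module $\mathbf{1}$ for $\mathcal{R}\mathrm{Br}_n(\delta,\varepsilon)$ (both left and right) is a copy of $R$ on which diagrams with no missing edges and no left-to-left or right-to-right edges act as multiplication by $1$ and all other diagrams act as multiplication by $0$. Subalgebras act on $\mathbf{1}$ by restriction, and quotients of a subalgebra by an ideal acting as zero act in the induced way. For $0\le i\le n$, $I_i$ is the two-sided ideal of $\mathcal{R}\mathrm{Br}_n(\delta,\varepsilon)$ that is the $R$-span of diagrams with at most $i$ left-to-right connections, and $I_{-1}=0$. A link state consists of $n$ nodes arranged vertically, where each node may be connected by an edge to at most one other, and a node not connected to any other may or may not have a hanging edge attached (whose other end is attached to nothing). A hanging edge, or its node, is called a defect; a node with neither an edge nor a hanging edge is a missing edge. Slicing a rook-Brauer diagram vertically down the middle gives its left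 and right link states: the right link state has the right-to-right edges as its edges and has a defect at each right node belonging to a left-to-right connection (similarly for the left). $P_i$ denotes the set of link states with precisely $i$ defects. A splice is the operation on link states connecting two defects to form an edge; a deletion is the operation deleting a defect, leaving a missing edge. For $p\in P_i$, $J_p$ is the $R$-submodule of $\mathcal{R}\mathrm{Br}_n(\delta,\varepsilon)$ with basis the diagrams whose right link state is obtained from $p$ by a (possibly empty) sequence of splices and deletions; it is a left ideal. *)

theory Defs
  imports "HOL-Algebra.Module" "HOL-Algebra.QuotRing" "HOL-Algebra.Subrings"
begin

section \<open>Modules over a not necessarily commutative ring\<close>

text \<open>
  The locale \<^locale>\<open>module\<close> of the library requires a commutative base ring.  Its record is
  reused here; as there, the fields \<^const>\<open>mult\<close> and \<^const>\<open>one\<close> of a module carry no meaning.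
  A right module is stored in the same record, the value of \<^const>\<open>smult\<close> at \<open>b\<close> and \<open>x\<close> being
  \<open>x \<cdot> b\<close>.  An algebra over a commutative ring is a record of the same type in which all fields
  are meaningful.
\<close>

locale left_module = R?: ring R + M?: abelian_group M
  for R :: "('b, 'x) ring_scheme" (structure) and M :: "('b, 'm, 'y) module_scheme" (structure) +
  assumes smult_closed:
      "\<lbrakk>a \<in> carrier R; x \<in> carrier M\<rbrakk> \<Longrightarrow> a \<odot>\<^bsub>M\<^esub> x \<in> carrier M"
    and smult_l_distr:
      "\<lbrakk>a \<in> carrier R; b \<in> carrier R; x \<in> carrier M\<rbrakk> \<Longrightarrow>
        (a \<oplus> b) \<odot>\<^bsub>M\<^esub> x = a \<odot>\<^bsub>M\<^esub> x \<oplus>\<^bsub>M\<^esub> b \<odot>\<^bsub>M\<^esub> x"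
    and smult_r_distr:
      "\<lbrakk>a \<in> carrier R; x \<in> carrier M; y \<in> carrier M\<rbrakk> \<Longrightarrow>
        a \<odot>\<^bsub>M\<^esub> (x \<oplus>\<^bsub>M\<^esub> y) = a \<odot>\<^bsub>M\<^esub> x \<oplus>\<^bsub>M\<^esub> a \<odot>\<^bsub>M\<^esub> y"
    and smult_assoc:
      "\<lbrakk>a \<in> carrier R; b \<in> carrier R; x \<in> carrier M\<rbrakk> \<Longrightarrow>
        (a \<otimes> b) \<odot>\<^bsub>M\<^esub> x = a \<odot>\<^bsub>M\<^esub> (b \<odot>\<^bsub>M\<^esub> x)"
    and smult_one: "x \<in> carrier M \<Longrightarrow> \<one> \<odot>\<^bsub>M\<^esub> x = x"

definition mod_hom ::
  "('b, 'x) ring_scheme \<Rightarrow> ('b, 'm, 'y) module_scheme \<Rightarrow> ('b, 'n, 'z) module_scheme \<Rightarrow> ('m \<Rightarrow> 'n) set"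
  where "mod_hom B M N =
    {f \<in> carrier M \<rightarrow> carrier N.
       (\<forall>x\<in>carrier M. \<forall>y\<in>carrier M. f (x \<oplus>\<^bsub>M\<^esub> y) = f x \<oplus>\<^bsub>N\<^esub> f y) \<and>
       (\<forall>b\<in>carrier B. \<forall>x\<in>carrier M. f (b \<odot>\<^bsub>M\<^esub> x) = b \<odot>\<^bsub>N\<^esub> f x)}"

definition mod_isomorphic ::
  "('b, 'x) ring_scheme \<Rightarrow> ('b, 'm, 'y) module_scheme \<Rightarrow> ('b, 'n, 'z) module_scheme \<Rightarrow> bool"
  where "mod_isomorphic B M N \<longleftrightarrow> (\<exists>f\<in>mod_hom B M N. bij_betw f (carrier M) (carrier N))"

text \<open>
  The lifting property, with the test modules \<open>M\<close> and \<open>N\<close> drawn from fixed types.  These types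
  lose nothing: the choice \<open>N = P\<close>, \<open>f = id\<close> and \<open>M\<close> the free module on the set \<open>carrier P\<close>
  (finitely supported functions of type \<^typ>\<open>'p \<Rightarrow> 'b\<close>) already makes \<open>P\<close> a direct summand of a
  free module, hence gives the lifting property against all modules.
\<close>

definition projective :: "('b, 'x) ring_scheme \<Rightarrow> ('b, 'p) module \<Rightarrow> bool"
  where "projective B P \<longleftrightarrow> left_module B P \<and>
    (\<forall>(M :: ('b, 'p \<Rightarrow> 'b) module) (N :: ('b, 'p) module) g f.
       left_module B M \<and> left_module B N \<and>
       g \<in> mod_hom B M N \<and> g ` carrier M = carrier N \<and> f \<in> mod_hom B P N \<longrightarrow>
       (\<exists>h\<in>mod_hom B P M. \<forall>x\<in>carrier P. g (h x) = f x))"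

text \<open>
  The differential \<open>d k\<close> goes from \<open>P (Suc k)\<close> to \<open>P k\<close>, and \<open>\<eta>\<close> is the augmentation.  That all
  \<open>P k\<close> have their carriers in one type is no restriction, as countably many modules can be
  transported into a common type.
\<close>

definition projective_resolution ::
  "('b, 'x) ring_scheme \<Rightarrow> ('b, 'n) module \<Rightarrow> (nat \<Rightarrow> ('b, 'p) module) \<Rightarrow> (nat \<Rightarrow> 'p \<Rightarrow> 'p) \<Rightarrow>
    ('p \<Rightarrow> 'n) \<Rightarrow> bool"
  where "projective_resolution B N P d \<eta> \<longleftrightarrow>
    left_module B N \<and>
    (\<forall>k. projective B (P k)) \<and>
    (\<forall>k. d k \<in> mod_hom B (P (Suc k)) (P k)) \<and>
    \<eta> \<in> mod_hom B (P 0) N \<and>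
    \<eta> ` carrier (P 0) = carrier N \<and>
    d 0 ` carrier (P 1) = {x \<in> carrier (P 0). \<eta> x = \<zero>\<^bsub>N\<^esub>} \<and>
    (\<forall>k. d (Suc k) ` carrier (P (Suc (Suc k))) = {x \<in> carrier (P (Suc k)). d k x = \<zero>\<^bsub>P k\<^esub>})"


section \<open>Free modules, quotients, tensor products and Tor\<close>

definition free_module :: "('r, 'x) ring_scheme \<Rightarrow> 's set \<Rightarrow> ('r, 's \<Rightarrow> 'r) module"
  where "free_module R S =
    \<lparr>carrier = {x. (\<forall>s. x s \<in> carrier R) \<and> (\<forall>s. s \<notin> S \<longrightarrow> x s = \<zero>\<^bsub>R\<^esub>) \<and> finite {s. x s \<noteq> \<zero>\<^bsub>R\<^esub>}},
     mult = undefined, one = undefined,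
     zero = (\<lambda>s. \<zero>\<^bsub>R\<^esub>), add = (\<lambda>x y s. x s \<oplus>\<^bsub>R\<^esub> y s),
     smult = (\<lambda>r x s. r \<otimes>\<^bsub>R\<^esub> x s)\<rparr>"

definition basis_elem :: "('r, 'x) ring_scheme \<Rightarrow> 's \<Rightarrow> 's \<Rightarrow> 'r"
  where "basis_elem R s = (\<lambda>t. if t = s then \<one>\<^bsub>R\<^esub> else \<zero>\<^bsub>R\<^esub>)"

definition submodule_span :: "('r, 'x) ring_scheme \<Rightarrow> ('r, 'm) module \<Rightarrow> 'm set \<Rightarrow> 'm set"
  where "submodule_span R V S = \<Inter>{U. submodule U R V \<and> S \<subseteq> U}"

text \<open>
  The quotient of an algebra by a two-sided ideal, or of a module by a submodule: the quotient
  \<^const>\<open>FactRing\<close> of the library together with the induced action of the scalars.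
\<close>

definition quot :: "('r, 'm) module \<Rightarrow> 'm set \<Rightarrow> ('r, 'm set) module"
  where "quot V U =
    ring.extend (V Quot U) (module.fields (\<lambda>r X. \<Union>x\<in>X. U +>\<^bsub>V\<^esub> (r \<odot>\<^bsub>V\<^esub> x)))"

definition subalgebra :: "('r, 'x) ring_scheme \<Rightarrow> 'a set \<Rightarrow> ('r, 'a) module \<Rightarrow> bool"
  where "subalgebra R A V \<longleftrightarrow> subring A V \<and> submodule A R V"

text \<open>
  Let \<open>B\<close> be an \<open>R\<close>-algebra, \<open>M\<close> a right and \<open>N\<close> a left \<open>B\<close>-module.  Then \<open>tensor R B M N\<close> is
  \<open>M \<otimes>\<^sub>B N\<close> as an \<open>R\<close>-module: the free \<open>R\<close>-module on the set \<open>M \<times> N\<close> modulo additivity in both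
  arguments, \<open>(x b, y) = (x, b y)\<close>, and \<open>r (x, y) = (x (r 1\<^sub>B), y)\<close>.
\<close>

definition tensor_relators ::
  "('r, 'x) ring_scheme \<Rightarrow> ('r, 'b) module \<Rightarrow> ('b, 'm) module \<Rightarrow> ('b, 'n) module \<Rightarrow>
    ('m \<times> 'n \<Rightarrow> 'r) set"
  where "tensor_relators R B M N =
    (let F = free_module R (carrier M \<times> carrier N); e = basis_elem R in
      {e (x \<oplus>\<^bsub>M\<^esub> x', y) \<ominus>\<^bsub>F\<^esub> (e (x, y) \<oplus>\<^bsub>F\<^esub> e (x', y)) | x x' y.
         x \<in> carrier M \<and> x' \<in> carrier M \<and> y \<in> carrier N} \<union>
      {e (x, y \<oplus>\<^bsub>N\<^esub> y') \<ominus>\<^bsub>F\<^esub> (e (x, y) \<oplus>\<^bsub>F\<^esub> e (x, y')) | x y y'.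
         x \<in> carrier M \<and> y \<in> carrier N \<and> y' \<in> carrier N} \<union>
      {e (b \<odot>\<^bsub>M\<^esub> x, y) \<ominus>\<^bsub>F\<^esub> e (x, b \<odot>\<^bsub>N\<^esub> y) | b x y.
         b \<in> carrier B \<and> x \<in> carrier M \<and> y \<in> carrier N} \<union>
      {(r \<odot>\<^bsub>F\<^esub> e (x, y)) \<ominus>\<^bsub>F\<^esub> e ((r \<odot>\<^bsub>B\<^esub> \<one>\<^bsub>B\<^esub>) \<odot>\<^bsub>M\<^esub> x, y) | r x y.
         r \<in> carrier R \<and> x \<in> carrier M \<and> y \<in> carrier N})"

definition tensor_kernel ::
  "('r, 'x) ring_scheme \<Rightarrow> ('r, 'b) module \<Rightarrow> ('b, 'm) module \<Rightarrow> ('b, 'n) module \<Rightarrow>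
    ('m \<times> 'n \<Rightarrow> 'r) set"
  where "tensor_kernel R B M N =
    submodule_span R (free_module R (carrier M \<times> carrier N)) (tensor_relators R B M N)"

definition tensor ::
  "('r, 'x) ring_scheme \<Rightarrow> ('r, 'b) module \<Rightarrow> ('b, 'm) module \<Rightarrow> ('b, 'n) module \<Rightarrow>
    ('r, ('m \<times> 'n \<Rightarrow> 'r) set) module"
  where "tensor R B M N =
    quot (free_module R (carrier M \<times> carrier N)) (tensor_kernel R B M N)"

text \<open>
  The map \<open>id \<otimes> f\<close> from \<open>M \<otimes>\<^sub>B N\<close> to \<open>M \<otimes>\<^sub>B N'\<close> is induced by the map of free modules sending the
  basis element \<open>(x, y)\<close> to \<open>(x, f y)\<close>.
\<close>

definition push_snd :: "('r, 'x) ring_scheme \<Rightarrow> ('n \<Rightarrow> 'n') \<Rightarrow> ('m \<times> 'n \<Rightarrow> 'r) \<Rightarrow> 'm \<times> 'n' \<Rightarrow> 'r"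
  where "push_snd R f z =
    (\<lambda>(x, y'). \<Oplus>\<^bsub>R\<^esub>y\<in>{y. z (x, y) \<noteq> \<zero>\<^bsub>R\<^esub> \<and> f y = y'}. z (x, y))"

definition tensor_map ::
  "('r, 'x) ring_scheme \<Rightarrow> ('r, 'b) module \<Rightarrow> ('b, 'm) module \<Rightarrow> ('b, 'n') module \<Rightarrow> ('n \<Rightarrow> 'n') \<Rightarrow>
    ('m \<times> 'n \<Rightarrow> 'r) set \<Rightarrow> ('m \<times> 'n' \<Rightarrow> 'r) set"
  where "tensor_map R B M N' f X =
    (\<Union>z\<in>X. tensor_kernel R B M N' +>\<^bsub>free_module R (carrier M \<times> carrier N')\<^esub> push_snd R f z)"

fun cycles :: "(nat \<Rightarrow> ('r, 'c) module) \<Rightarrow> (nat \<Rightarrow> 'c \<Rightarrow> 'c) \<Rightarrow> nat \<Rightarrow> 'c set"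
  where
    "cycles C d 0 = carrier (C 0)"
  | "cycles C d (Suc k) = {x \<in> carrier (C (Suc k)). d k x = \<zero>\<^bsub>C k\<^esub>}"

definition homology ::
  "(nat \<Rightarrow> ('r, 'c) module) \<Rightarrow> (nat \<Rightarrow> 'c \<Rightarrow> 'c) \<Rightarrow> nat \<Rightarrow> ('r, 'c set) module"
  where "homology C d k =
    quot ((C k)\<lparr>carrier := cycles C d k\<rparr>) (d k ` carrier (C (Suc k)))"

text \<open>
  For a right \<open>B\<close>-module \<open>M\<close> and a projective resolution \<open>P\<close>, \<open>d\<close> of a left \<open>B\<close>-module \<open>N\<close>, this
  is the \<open>R\<close>-module \<open>Tor\<^sub>k\<close> of \<open>M\<close> and \<open>N\<close> over \<open>B\<close>, computed from that resolution.  As Tor is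
  determined by \<open>M\<close> and \<open>N\<close> only up to isomorphism, statements about it should quantify over all
  projective resolutions.
\<close>

definition Tor ::
  "('r, 'x) ring_scheme \<Rightarrow> ('r, 'b) module \<Rightarrow> ('b, 'm) module \<Rightarrow>
    (nat \<Rightarrow> ('b, 'p) module) \<Rightarrow> (nat \<Rightarrow> 'p \<Rightarrow> 'p) \<Rightarrow> nat \<Rightarrow> ('r, ('m \<times> 'p \<Rightarrow> 'r) set set) module"
  where "Tor R B M P d =
    homology (\<lambda>k. tensor R B M (P k)) (\<lambda>k. tensor_map R B M (P k) (d k))"


section \<open>Rook-Brauer diagrams\<close>

datatype node = Lft nat | Rgt nat

text \<open>A graph is given by its adjacency relation.\<close>

type_synonym diagram = "(node \<times> node) set"

definition nodes :: "nat \<Rightarrow> node set"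
  where "nodes n = Lft ` {..<n} \<union> Rgt ` {..<n}"

definition rb_diagrams :: "nat \<Rightarrow> diagram set"
  where "rb_diagrams n = {d. d \<subseteq> nodes n \<times> nodes n \<and> sym d \<and> irrefl d \<and> single_valued d}"

definition id_diagram :: "nat \<Rightarrow> diagram"
  where "id_diagram n = (\<Union>i<n. {(Lft i, Rgt i), (Rgt i, Lft i)})"

definition lr_connections :: "diagram \<Rightarrow> nat"
  where "lr_connections d = card {(i, j). (Lft i, Rgt j) \<in> d}"

text \<open>The nodes of the concatenated graph: the outer nodes and the middle column.\<close>

datatype cnode = Outer node | Mid nat

fun glue_right :: "node \<Rightarrow> cnode"
  where
    "glue_right (Lft i) = Outer (Lft i)"
  | "glue_right (Rgt i) = Mid i"

fun glue_left :: "node \<Rightarrow> cnode"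
  where
    "glue_left (Lft i) = Mid i"
  | "glue_left (Rgt i) = Outer (Rgt i)"

definition concat_graph :: "diagram \<Rightarrow> diagram \<Rightarrow> (cnode \<times> cnode) set"
  where "concat_graph x y =
    map_prod glue_right glue_right ` x \<union> map_prod glue_left glue_left ` y"

definition diagram_comp :: "diagram \<Rightarrow> diagram \<Rightarrow> diagram"
  where "diagram_comp x y = {(u, v). u \<noteq> v \<and> (Outer u, Outer v) \<in> (concat_graph x y)\<^sup>+}"

definition middle_components :: "nat \<Rightarrow> diagram \<Rightarrow> diagram \<Rightarrow> cnode set set"
  where "middle_components n x y =
    {C. \<exists>i<n. C = (concat_graph x y)\<^sup>* `` {Mid i} \<and> C \<subseteq> range Mid}"

text \<open>
  Every middle node meets at most one edge of \<open>x\<close> and at most one edge of \<open>y\<close>, and these count as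
  two edges even if they have the same ends.  So a component is a closed loop if each of its nodes
  meets an edge of both, and a path or an isolated node otherwise.
\<close>

definition closed_loop :: "diagram \<Rightarrow> diagram \<Rightarrow> cnode set \<Rightarrow> bool"
  where "closed_loop x y C \<longleftrightarrow> (\<forall>i. Mid i \<in> C \<longrightarrow> Rgt i \<in> Domain x \<and> Lft i \<in> Domain y)"

definition loop_count :: "nat \<Rightarrow> diagram \<Rightarrow> diagram \<Rightarrow> nat"
  where "loop_count n x y = card {C \<in> middle_components n x y. closed_loop x y C}"

definition contractible_count :: "nat \<Rightarrow> diagram \<Rightarrow> diagram \<Rightarrow> nat"
  where "contractible_count n x y = card {C \<in> middle_components n x y. \<not> closed_loop x y C}"


section \<open>The rook-Brauer algebra and its trivial module\<close>

definition rook_brauer ::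
  "('r, 'x) ring_scheme \<Rightarrow> nat \<Rightarrow> 'r \<Rightarrow> 'r \<Rightarrow> ('r, diagram \<Rightarrow> 'r) module"
  where "rook_brauer R n \<delta> \<epsilon> = (free_module R (rb_diagrams n))
    \<lparr>mult := (\<lambda>x y d. finsum R
       (\<lambda>(a, b). x a \<otimes>\<^bsub>R\<^esub> y b \<otimes>\<^bsub>R\<^esub>
         (\<delta> [^]\<^bsub>R\<^esub> loop_count n a b \<otimes>\<^bsub>R\<^esub> \<epsilon> [^]\<^bsub>R\<^esub> contractible_count n a b))
       {(a, b). a \<in> rb_diagrams n \<and> b \<in> rb_diagrams n \<and> diagram_comp a b = d}),
     one := basis_elem R (id_diagram n)\<rparr>"

text \<open>The index is an integer so that \<open>-1\<close> is allowed, where this is the zero ideal.\<close>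

definition conn_ideal :: "('r, 'x) ring_scheme \<Rightarrow> nat \<Rightarrow> int \<Rightarrow> (diagram \<Rightarrow> 'r) set"
  where "conn_ideal R n i =
    carrier (free_module R {d \<in> rb_diagrams n. int (lr_connections d) \<le> i})"

text \<open>The diagrams without missing edges, left-to-left edges and right-to-right edges.\<close>

definition perm_diagrams :: "nat \<Rightarrow> diagram set"
  where "perm_diagrams n = {d \<in> rb_diagrams n. Domain d = nodes n \<and>
    (\<forall>i j. (Lft i, Lft j) \<notin> d \<and> (Rgt i, Rgt j) \<notin> d)}"

definition trivial_act :: "('r, 'x) ring_scheme \<Rightarrow> nat \<Rightarrow> (diagram \<Rightarrow> 'r) \<Rightarrow> 'r \<Rightarrow> 'r"
  where "trivial_act R n x s = (\<Oplus>\<^bsub>R\<^esub>d\<in>perm_diagrams n. x d) \<otimes>\<^bsub>R\<^esub> s"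

text \<open>
  The trivial module, both left and right, over a quotient of a subalgebra of the rook-Brauer
  algebra.  The elements of the quotient are cosets, which act through any of their members.
\<close>

definition trivial_module :: "('r, 'x) ring_scheme \<Rightarrow> nat \<Rightarrow> ((diagram \<Rightarrow> 'r) set, 'r) module"
  where "trivial_module R n =
    \<lparr>carrier = carrier R, mult = undefined, one = undefined,
     zero = \<zero>\<^bsub>R\<^esub>, add = (\<lambda>r s. r \<oplus>\<^bsub>R\<^esub> s),
     smult = (\<lambda>X s. the_elem ((\<lambda>x. trivial_act R n x s) ` X))\<rparr>"

definition conn_quotient ::
  "('r, 'x) ring_scheme \<Rightarrow> nat \<Rightarrow> 'r \<Rightarrow> 'r \<Rightarrow> (diagram \<Rightarrow> 'r) set \<Rightarrow> int \<Rightarrow>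
    ('r, (diagram \<Rightarrow> 'r) set) module"
  where "conn_quotient R n \<delta> \<epsilon> A i =
    quot ((rook_brauer R n \<delta> \<epsilon>)\<lparr>carrier := A\<rparr>) (A \<inter> conn_ideal R n i)"


section \<open>Link states\<close>

text \<open>A link state is given by the adjacency relation of its edges and the set of its defects.\<close>

type_synonym link_state = "(nat \<times> nat) set \<times> nat set"

definition link_states :: "nat \<Rightarrow> nat \<Rightarrow> link_state set"
  where "link_states n i = {(E, D).
    E \<subseteq> {..<n} \<times> {..<n} \<and> sym E \<and> irrefl E \<and> single_valued E \<and>
    D \<subseteq> {..<n} \<and> D \<inter> Domain E = {} \<and> card D = i}"

definition right_link_state :: "diagram \<Rightarrow> link_state"
  where "right_link_state d =
    ({(i, j). (Rgt i, Rgt j) \<in> d}, {j. \<exists>i. (Lft i, Rgt j) \<in> d})"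

inductive splice_or_delete :: "link_state \<Rightarrow> link_state \<Rightarrow> bool"
  where
    splice: "\<lbrakk>i \<in> D; j \<in> D; i \<noteq> j\<rbrakk> \<Longrightarrow>
      splice_or_delete (E, D) (E \<union> {(i, j), (j, i)}, D - {i, j})"
  | deletion: "i \<in> D \<Longrightarrow> splice_or_delete (E, D) (E, D - {i})"

definition link_ideal :: "('r, 'x) ring_scheme \<Rightarrow> nat \<Rightarrow> link_state \<Rightarrow> (diagram \<Rightarrow> 'r) set"
  where "link_ideal R n p =
    carrier (free_module R {d \<in> rb_diagrams n. splice_or_delete\<^sup>*\<^sup>* p (right_link_state d)})"

end

theory Submission
  imports Defs
begin

text \<open>
  Write \<open>B = A/(A \<inter> I\<^bsub>i-1\<^esub>)\<close>, \<open>B' = A/(A \<inter> I\<^sub>i)\<close> and let \<open>I\<close> be the kernel of \<open>B \<rightarrow> B'\<close>.  Sorting the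
  diagrams with exactly \<open>i\<close> left-to-right connections by their right link states shows that, as a left
  ideal, \<open>I\<close> is the direct sum of the \<open>B e\<^sub>p\<close>, so \<open>I\<close> is projective and \<open>I = I\<^sup>2\<close>.  For a projective
  resolution \<open>P\<close> of \<open>\<one>\<close> over \<open>B\<close> the complex \<open>I P\<close> therefore consists of projective modules and its
  cycles stay in the image of \<open>I P\<close>, which makes it contractible.  Hence \<open>P / I P\<close> is a resolution of \<open>\<one>\<close> by
  projective \<open>B'\<close>-modules, to be compared with a given one in the usual way.  Finally \<open>\<one> \<otimes>\<^sub>B M\<close> is
  \<open>M / a M\<close> for the augmentation ideal \<open>a\<close> of \<open>B\<close>, and \<open>I \<subseteq> a\<close>.

  Instead of passing to the quotients \<open>M / I M\<close>, maps are considered modulo \<open>I M\<close>.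
\<close>

text \<open>The reduction of P and the given \<open>B'\<close>-resolution live over different rings.
  Both are treated over B: a \<open>B'\<close>-module is pulled back along the projection, so that I
  acts on it as zero, while P is kept and identities in it are read modulo I P. Projectivity appears
  as a dual basis whose coordinates are linear modulo I. This notion covers projective B-modules
  (with the zero ideal) and pulled back projective \<open>B'\<close>-modules alike, so one lifting
  lemma and one comparison argument serve both.

  The reduction of P is exact because a cycle modulo I P can be corrected by an element of I P. This
  requires I P to be exact down to degree 0, where it matters that I acts as zero on the trivial
  module: diagrams with at most m < n left-to-right connections are never permutation diagrams.

  The coordinates on I come from the shape of \<open>J_p\<close>: splices and deletions lower the
  number of defects, so modulo \<open>I_(i-1)\<close> only diagrams with right link state exactly p
  survive in \<open>J_p\<close>. The ring laws of the quotients are taken from the given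
  resolutions, whose modules presuppose them.\<close>

context left_module
begin

lemma smult_l_zero:
  assumes "x \<in> carrier M" shows "\<zero> \<odot>\<^bsub>M\<^esub> x = \<zero>\<^bsub>M\<^esub>"
proof -
  have "\<zero> \<odot>\<^bsub>M\<^esub> x \<oplus>\<^bsub>M\<^esub> \<zero> \<odot>\<^bsub>M\<^esub> x = \<zero> \<odot>\<^bsub>M\<^esub> x"
    using smult_l_distr[of \<zero> \<zero> x] assms by simp
  then show ?thesis
    using assms by (simp add: smult_closed)
qed

lemma smult_r_zero:
  assumes "a \<in> carrier R" shows "a \<odot>\<^bsub>M\<^esub> \<zero>\<^bsub>M\<^esub> = \<zero>\<^bsub>M\<^esub>"
proof -
  have "a \<odot>\<^bsub>M\<^esub> \<zero>\<^bsub>M\<^esub> \<oplus>\<^bsub>M\<^esub> a \<odot>\<^bsub>M\<^esub> \<zero>\<^bsub>M\<^esub> = a \<odot>\<^bsub>M\<^esub> \<zero>\<^bsub>M\<^esub>"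
    using smult_r_distr[of a "\<zero>\<^bsub>M\<^esub>" "\<zero>\<^bsub>M\<^esub>"] assms by simp
  then show ?thesis
    using assms by (simp add: smult_closed)
qed

lemma smult_l_minus:
  assumes "a \<in> carrier R" "x \<in> carrier M"
  shows "(\<ominus> a) \<odot>\<^bsub>M\<^esub> x = \<ominus>\<^bsub>M\<^esub> (a \<odot>\<^bsub>M\<^esub> x)"
proof -
  have "(\<ominus> a) \<odot>\<^bsub>M\<^esub> x \<oplus>\<^bsub>M\<^esub> a \<odot>\<^bsub>M\<^esub> x = \<zero>\<^bsub>M\<^esub>"
    using assms by (simp flip: smult_l_distr add: R.l_neg smult_l_zero)
  then show ?thesis
    using assms M.minus_equality[of "(\<ominus> a) \<odot>\<^bsub>M\<^esub> x" "a \<odot>\<^bsub>M\<^esub> x"] by (simp add: smult_closed)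
qed

lemma smult_r_minus:
  assumes "a \<in> carrier R" "x \<in> carrier M"
  shows "a \<odot>\<^bsub>M\<^esub> (\<ominus>\<^bsub>M\<^esub> x) = \<ominus>\<^bsub>M\<^esub> (a \<odot>\<^bsub>M\<^esub> x)"
proof -
  have "a \<odot>\<^bsub>M\<^esub> (\<ominus>\<^bsub>M\<^esub> x) \<oplus>\<^bsub>M\<^esub> a \<odot>\<^bsub>M\<^esub> x = \<zero>\<^bsub>M\<^esub>"
    using assms by (simp flip: smult_r_distr add: M.l_neg smult_r_zero)
  then show ?thesis
    using assms M.minus_equality[of "a \<odot>\<^bsub>M\<^esub> (\<ominus>\<^bsub>M\<^esub> x)" "a \<odot>\<^bsub>M\<^esub> x"] by (simp add: smult_closed)
qed

lemma smult_r_diff: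
  "\<lbrakk>a \<in> carrier R; x \<in> carrier M; y \<in> carrier M\<rbrakk> \<Longrightarrow>
    a \<odot>\<^bsub>M\<^esub> (x \<ominus>\<^bsub>M\<^esub> y) = a \<odot>\<^bsub>M\<^esub> x \<ominus>\<^bsub>M\<^esub> a \<odot>\<^bsub>M\<^esub> y"
  by (simp add: M.minus_eq smult_r_distr smult_r_minus)

lemma smult_l_diff:
  "\<lbrakk>a \<in> carrier R; b \<in> carrier R; x \<in> carrier M\<rbrakk> \<Longrightarrow>
    (a \<ominus> b) \<odot>\<^bsub>M\<^esub> x = a \<odot>\<^bsub>M\<^esub> x \<ominus>\<^bsub>M\<^esub> b \<odot>\<^bsub>M\<^esub> x"
  by (simp add: M.minus_eq R.minus_eq smult_l_distr smult_l_minus)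

end

section \<open>Differences in abelian groups\<close>

lemma (in abelian_group) add_diff_add:
  assumes "x \<in> carrier G" "x' \<in> carrier G" "y \<in> carrier G" "y' \<in> carrier G"
  shows "(x \<oplus> y) \<ominus> (x' \<oplus> y') = (x \<ominus> x') \<oplus> (y \<ominus> y')"
proof -
  have "(x \<oplus> y) \<ominus> (x' \<oplus> y') = x \<oplus> (y \<oplus> (\<ominus> x' \<oplus> \<ominus> y'))"
    using assms by (simp add: minus_eq minus_add a_assoc)
  also have "\<dots> = x \<oplus> (\<ominus> x' \<oplus> (y \<oplus> \<ominus> y'))"
    using assms by (simp add: a_lcomm)
  finally show ?thesis
    using assms by (simp add: minus_eq a_assoc)
qed

lemma (in abelian_group) diff_add_diff:
  assumes "x \<in> carrier G" "y \<in> carrier G" "z \<in> carrier G"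
  shows "(x \<ominus> y) \<oplus> (y \<ominus> z) = x \<ominus> z"
proof -
  have "(x \<ominus> y) \<oplus> (y \<ominus> z) = x \<oplus> (\<ominus> y \<oplus> (y \<oplus> \<ominus> z))"
    using assms by (simp add: minus_eq a_assoc)
  then show ?thesis
    using assms by (simp add: minus_eq r_neg1)
qed

lemma (in abelian_group) minus_diff:
  "\<lbrakk>x \<in> carrier G; y \<in> carrier G\<rbrakk> \<Longrightarrow> \<ominus> (x \<ominus> y) = y \<ominus> x"
  by (simp add: minus_eq minus_add a_comm)

lemma (in abelian_group) diff_add_cancel:
  "\<lbrakk>x \<in> carrier G; y \<in> carrier G\<rbrakk> \<Longrightarrow> (x \<ominus> y) \<oplus> y = x"
  by (simp add: minus_eq a_assoc l_neg)

lemma (in abelian_group) diff_zero: "x \<in> carrier G \<Longrightarrow> x \<ominus> \<zero> = x"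
  by (simp add: minus_eq)

lemma (in abelian_group) diff_self: "x \<in> carrier G \<Longrightarrow> x \<ominus> x = \<zero>"
  by (simp add: minus_eq r_neg)

lemma (in abelian_group) diff_eq_zero_iff:
  "\<lbrakk>x \<in> carrier G; y \<in> carrier G\<rbrakk> \<Longrightarrow> x \<ominus> y = \<zero> \<longleftrightarrow> x = y"
  using diff_add_cancel[of x y] diff_self[of x] by auto

section \<open>Submodules\<close>

lemma (in left_module) submodule_criterion:
  assumes "U \<subseteq> carrier M" "\<zero>\<^bsub>M\<^esub> \<in> U"
    and "\<And>x y. \<lbrakk>x \<in> U; y \<in> U\<rbrakk> \<Longrightarrow> x \<oplus>\<^bsub>M\<^esub> y \<in> U"
    and sm: "\<And>a x. \<lbrakk>a \<in> carrier R; x \<in> U\<rbrakk> \<Longrightarrow> a \<odot>\<^bsub>M\<^esub> x \<in> U"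
  shows "submodule U R M"
proof -
  have "\<ominus>\<^bsub>M\<^esub> x \<in> U" if "x \<in> U" for x
    using sm[of "\<ominus> \<one>" x] that assms(1) by (auto simp: smult_l_minus smult_one subset_iff)
  then have "subgroup U (add_monoid M)"
    using assms by (intro subgroup.intro) (auto simp: a_inv_def)
  then show ?thesis
    using sm by (simp add: submodule_def submodule_axioms_def)
qed

lemma submoduleD:
  assumes "submodule U R M"
  shows "x \<in> U \<Longrightarrow> x \<in> carrier M" "\<zero>\<^bsub>M\<^esub> \<in> U"
    "\<lbrakk>x \<in> U; y \<in> U\<rbrakk> \<Longrightarrow> x \<oplus>\<^bsub>M\<^esub> y \<in> U"
    "\<lbrakk>a \<in> carrier R; x \<in> U\<rbrakk> \<Longrightarrow> a \<odot>\<^bsub>M\<^esub> x \<in> U"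
    "x \<in> U \<Longrightarrow> \<ominus>\<^bsub>M\<^esub> x \<in> U"
proof -
  have s: "subgroup U (add_monoid M)" using assms by (simp add: submodule_def)
  show "x \<in> U \<Longrightarrow> x \<in> carrier M" "\<zero>\<^bsub>M\<^esub> \<in> U" "\<lbrakk>x \<in> U; y \<in> U\<rbrakk> \<Longrightarrow> x \<oplus>\<^bsub>M\<^esub> y \<in> U"
    "x \<in> U \<Longrightarrow> \<ominus>\<^bsub>M\<^esub> x \<in> U"
    using subgroup.mem_carrier[OF s] subgroup.one_closed[OF s] subgroup.m_closed[OF s]
      subgroup.m_inv_closed[OF s] by (simp_all add: a_inv_def)
  show "\<lbrakk>a \<in> carrier R; x \<in> U\<rbrakk> \<Longrightarrow> a \<odot>\<^bsub>M\<^esub> x \<in> U"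
    using submodule.smult_closed[OF assms] .
qed

lemma left_module_restrict:
  fixes M :: "('b, 'm, 'y) module_scheme"
  assumes "left_module R M" "submodule U R M"
  shows "left_module R (M\<lparr>carrier := U\<rparr>)"
proof -
  interpret left_module R M by fact
  note s = submoduleD[OF assms(2)]
  have "abelian_group (M\<lparr>carrier := U\<rparr>)"
  proof (rule abelian_groupI)
    fix x assume "x \<in> carrier (M\<lparr>carrier := U\<rparr>)"
    then show "\<exists>y\<in>carrier (M\<lparr>carrier := U\<rparr>). y \<oplus>\<^bsub>M\<lparr>carrier := U\<rparr>\<^esub> x = \<zero>\<^bsub>M\<lparr>carrier := U\<rparr>\<^esub>"
      using M.l_neg[OF s(1)] s(5) by auto
  qed (auto simp: s M.a_ac)
  moreover have "left_module_axioms R (M\<lparr>carrier := U\<rparr>)"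
    by standard (auto simp: s smult_l_distr smult_r_distr smult_assoc smult_one)
  ultimately show ?thesis by (simp add: left_module_def R.ring_axioms)
qed

section \<open>Congruence modulo an ideal\<close>

text \<open>The submodule I M, generated one summand at a time, so that statements about it are
  inductions over finite sums. Closure under scalars is not built in; it follows because I absorbs
  left multiplication.\<close>

inductive_set ispan :: "'b set \<Rightarrow> ('b, 'm, 'y) module_scheme \<Rightarrow> 'm set"
  for I M where
    zero: "\<zero>\<^bsub>M\<^esub> \<in> ispan I M"
  | step: "\<lbrakk>a \<in> I; y \<in> carrier M; x \<in> ispan I M\<rbrakk> \<Longrightarrow> a \<odot>\<^bsub>M\<^esub> y \<oplus>\<^bsub>M\<^esub> x \<in> ispan I M"

text \<open>Equality in M / I M, expressed on representatives. Membership of both sides in the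
  carrier is included, so that chains of congruences carry their own closure facts.\<close>

definition mcong :: "'b set \<Rightarrow> ('b, 'm, 'y) module_scheme \<Rightarrow> 'm \<Rightarrow> 'm \<Rightarrow> bool"
  where "mcong I M x y \<longleftrightarrow> x \<in> carrier M \<and> y \<in> carrier M \<and> x \<ominus>\<^bsub>M\<^esub> y \<in> ispan I M"

lemma ispan_mono:
  assumes "x \<in> ispan I M" "I \<subseteq> J" shows "x \<in> ispan J M"
  using assms(1) by induction (use assms(2) in \<open>auto intro: ispan.intros\<close>)

lemma mcong_mono: "I \<subseteq> J \<Longrightarrow> mcong I M x y \<Longrightarrow> mcong J M x y"
  unfolding mcong_def by (auto intro: ispan_mono)

locale mod_ideal = left_module R M + I: ideal I R
  for I and R :: "('b, 'x) ring_scheme" (structure) and M :: "('b, 'm, 'y) module_scheme" (structure)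
begin

lemma ispan_carrier: "x \<in> ispan I M \<Longrightarrow> x \<in> carrier M"
  by (induction rule: ispan.induct) (auto simp: smult_closed)

lemma ispan_add: "x \<in> ispan I M \<Longrightarrow> y \<in> ispan I M \<Longrightarrow> x \<oplus>\<^bsub>M\<^esub> y \<in> ispan I M"
proof (induction rule: ispan.induct)
  case zero
  then show ?case by (simp add: ispan_carrier)
next
  case (step a z x)
  then have "(a \<odot>\<^bsub>M\<^esub> z \<oplus>\<^bsub>M\<^esub> x) \<oplus>\<^bsub>M\<^esub> y = a \<odot>\<^bsub>M\<^esub> z \<oplus>\<^bsub>M\<^esub> (x \<oplus>\<^bsub>M\<^esub> y)"
    by (simp add: M.a_assoc smult_closed ispan_carrier)
  then show ?case using step by (simp add: ispan.step)
qed

lemma ispan_smult: "x \<in> ispan I M \<Longrightarrow> b \<in> carrier R \<Longrightarrow> b \<odot>\<^bsub>M\<^esub> x \<in> ispan I M"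
proof (induction rule: ispan.induct)
  case zero
  then show ?case by (simp add: smult_r_zero ispan.zero)
next
  case (step a z x)
  then have "b \<odot>\<^bsub>M\<^esub> (a \<odot>\<^bsub>M\<^esub> z \<oplus>\<^bsub>M\<^esub> x) = (b \<otimes> a) \<odot>\<^bsub>M\<^esub> z \<oplus>\<^bsub>M\<^esub> b \<odot>\<^bsub>M\<^esub> x"
    by (simp add: smult_r_distr smult_closed smult_assoc ispan_carrier)
  then show ?case using step by (simp add: ispan.step I.I_l_closed)
qed

lemma ispan_neg:
  assumes "x \<in> ispan I M" shows "\<ominus>\<^bsub>M\<^esub> x \<in> ispan I M"
proof -
  have "\<ominus>\<^bsub>M\<^esub> x = (\<ominus> \<one>) \<odot>\<^bsub>M\<^esub> x"
    using assms by (simp add: smult_l_minus ispan_carrier smult_one)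
  then show ?thesis using assms by (simp add: ispan_smult)
qed

lemma ispan_elem: "a \<in> I \<Longrightarrow> y \<in> carrier M \<Longrightarrow> a \<odot>\<^bsub>M\<^esub> y \<in> ispan I M"
  using ispan.step[OF _ _ ispan.zero, of a I y M] by (simp add: smult_closed)

lemma ispan_diff: "x \<in> ispan I M \<Longrightarrow> y \<in> ispan I M \<Longrightarrow> x \<ominus>\<^bsub>M\<^esub> y \<in> ispan I M"
  by (simp add: M.minus_eq ispan_add ispan_neg)

lemma ispan_finsum:
  "\<lbrakk>\<And>x. x \<in> F \<Longrightarrow> f x \<in> ispan I M\<rbrakk> \<Longrightarrow> finsum M f F \<in> ispan I M"
proof (induction F rule: infinite_finite_induct)
  case (insert x F)
  then have "finsum M f (insert x F) = f x \<oplus>\<^bsub>M\<^esub> finsum M f F"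
    by (intro M.finsum_insert) (auto simp: ispan_carrier)
  then show ?case using insert by (simp add: ispan_add)
qed (auto simp: ispan.zero)

lemma mcong_carrier: "mcong I M x y \<Longrightarrow> x \<in> carrier M" "mcong I M x y \<Longrightarrow> y \<in> carrier M"
  by (auto simp: mcong_def)

lemma mcong_refl: "x \<in> carrier M \<Longrightarrow> mcong I M x x"
  by (simp add: mcong_def M.diff_self ispan.zero)

lemma mcong_sym: "mcong I M x y \<Longrightarrow> mcong I M y x"
  unfolding mcong_def using ispan_neg[of "x \<ominus>\<^bsub>M\<^esub> y"] by (simp add: M.minus_diff)

lemma mcong_trans [trans]: "mcong I M x y \<Longrightarrow> mcong I M y z \<Longrightarrow> mcong I M x z"
  unfolding mcong_def using ispan_add[of "x \<ominus>\<^bsub>M\<^esub> y" "y \<ominus>\<^bsub>M\<^esub> z"] by (simp add: M.diff_add_diff)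

lemma mcong_add: "mcong I M x x' \<Longrightarrow> mcong I M y y' \<Longrightarrow> mcong I M (x \<oplus>\<^bsub>M\<^esub> y) (x' \<oplus>\<^bsub>M\<^esub> y')"
  unfolding mcong_def by (simp add: M.add_diff_add ispan_add)

lemma mcong_smult: "mcong I M x x' \<Longrightarrow> b \<in> carrier R \<Longrightarrow> mcong I M (b \<odot>\<^bsub>M\<^esub> x) (b \<odot>\<^bsub>M\<^esub> x')"
  unfolding mcong_def by (simp add: smult_closed ispan_smult flip: smult_r_diff)

lemma mcong_neg: "mcong I M x x' \<Longrightarrow> mcong I M (\<ominus>\<^bsub>M\<^esub> x) (\<ominus>\<^bsub>M\<^esub> x')"
  using mcong_smult[of x x' "\<ominus> \<one>"]
  by (simp add: smult_l_minus mcong_carrier smult_one)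

lemma mcong_diff: "mcong I M x x' \<Longrightarrow> mcong I M y y' \<Longrightarrow> mcong I M (x \<ominus>\<^bsub>M\<^esub> y) (x' \<ominus>\<^bsub>M\<^esub> y')"
  by (simp add: M.minus_eq mcong_add mcong_neg)

lemma mcong_zero_iff: "mcong I M x \<zero>\<^bsub>M\<^esub> \<longleftrightarrow> x \<in> ispan I M"
  using ispan_carrier by (auto simp: mcong_def M.diff_zero)

lemma mcong_smult_left:
  assumes "b \<in> carrier R" "b' \<in> carrier R" "b \<ominus> b' \<in> I" "x \<in> carrier M"
  shows "mcong I M (b \<odot>\<^bsub>M\<^esub> x) (b' \<odot>\<^bsub>M\<^esub> x)"
  using assms by (simp add: mcong_def smult_closed ispan_elem flip: smult_l_diff)

lemma mcong_finsum:
  "\<lbrakk>\<And>j. j \<in> F \<Longrightarrow> mcong I M (f j) (g j)\<rbrakk> \<Longrightarrow> mcong I M (finsum M f F) (finsum M g F)"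
proof (induction F rule: infinite_finite_induct)
  case (insert x F)
  then have "finsum M f (insert x F) = f x \<oplus>\<^bsub>M\<^esub> finsum M f F"
    "finsum M g (insert x F) = g x \<oplus>\<^bsub>M\<^esub> finsum M g F"
    using mcong_carrier[OF insert.prems] by (auto intro!: M.finsum_insert)
  then show ?case using insert by (simp add: mcong_add)
qed (auto simp: mcong_refl)

end

lemma mod_idealI: "left_module B M \<Longrightarrow> ideal I B \<Longrightarrow> mod_ideal I B M"
  by (simp add: mod_ideal_def)

lemma (in left_module) ispan_zero: "ispan {\<zero>} M = {\<zero>\<^bsub>M\<^esub>}"
proof -
  have "x = \<zero>\<^bsub>M\<^esub>" if "x \<in> ispan {\<zero>} M" for x
    using that by (induction rule: ispan.induct) (auto simp: smult_l_zero)
  then show ?thesis by (auto intro: ispan.zero)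
qed

text \<open>For the zero ideal the relative notions become the absolute ones, so ordinary lifting
  problems are instances of the relative lifting lemma.\<close>

lemma (in left_module) mcong_zero: "mcong {\<zero>} M x y \<longleftrightarrow> x \<in> carrier M \<and> x = y"
  by (auto simp: mcong_def ispan_zero M.diff_eq_zero_iff M.diff_self)

section \<open>Homomorphisms modulo an ideal\<close>

text \<open>Functions on representatives that induce linear maps M -> N / I N. They need not be
  additive themselves: a map built from lifted coefficients becomes linear only after
  reduction.\<close>

definition relhom ::
  "('b, 'x) ring_scheme \<Rightarrow> 'b set \<Rightarrow> ('b, 'm, 'y) module_scheme \<Rightarrow> ('b, 'n, 'z) module_scheme \<Rightarrow>
    ('m \<Rightarrow> 'n) set"
  where "relhom B I M N =
    {f \<in> carrier M \<rightarrow> carrier N.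
       (\<forall>x\<in>carrier M. \<forall>y\<in>carrier M. mcong I N (f (x \<oplus>\<^bsub>M\<^esub> y)) (f x \<oplus>\<^bsub>N\<^esub> f y)) \<and>
       (\<forall>b\<in>carrier B. \<forall>x\<in>carrier M. mcong I N (f (b \<odot>\<^bsub>M\<^esub> x)) (b \<odot>\<^bsub>N\<^esub> f x))}"

lemma relhomD:
  assumes "f \<in> relhom B I M N"
  shows "x \<in> carrier M \<Longrightarrow> f x \<in> carrier N"
    "\<lbrakk>x \<in> carrier M; y \<in> carrier M\<rbrakk> \<Longrightarrow> mcong I N (f (x \<oplus>\<^bsub>M\<^esub> y)) (f x \<oplus>\<^bsub>N\<^esub> f y)"
    "\<lbrakk>b \<in> carrier B; x \<in> carrier M\<rbrakk> \<Longrightarrow> mcong I N (f (b \<odot>\<^bsub>M\<^esub> x)) (b \<odot>\<^bsub>N\<^esub> f x)"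
  using assms by (auto simp: relhom_def)

lemma relhom_mono: "I \<subseteq> J \<Longrightarrow> relhom B I M N \<subseteq> relhom B J M N"
  unfolding relhom_def by (auto intro: mcong_mono)

lemma mod_homD:
  assumes "f \<in> mod_hom B M N"
  shows "x \<in> carrier M \<Longrightarrow> f x \<in> carrier N"
    "\<lbrakk>x \<in> carrier M; y \<in> carrier M\<rbrakk> \<Longrightarrow> f (x \<oplus>\<^bsub>M\<^esub> y) = f x \<oplus>\<^bsub>N\<^esub> f y"
    "\<lbrakk>b \<in> carrier B; x \<in> carrier M\<rbrakk> \<Longrightarrow> f (b \<odot>\<^bsub>M\<^esub> x) = b \<odot>\<^bsub>N\<^esub> f x"
  using assms by (auto simp: mod_hom_def)

lemma relhom_zero_iff:
  assumes "left_module B M" "left_module B N"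
  shows "f \<in> relhom B {\<zero>\<^bsub>B\<^esub>} M N \<longleftrightarrow> f \<in> mod_hom B M N"
proof -
  interpret M: left_module B M by fact
  interpret N: left_module B N by fact
  show ?thesis
    by (auto simp: relhom_def mod_hom_def N.mcong_zero Pi_iff M.smult_closed)
qed

lemma mod_hom_relhom:
  assumes "left_module B M" "left_module B N" "ideal I B" "f \<in> mod_hom B M N"
  shows "f \<in> relhom B I M N"
proof -
  interpret ideal I B by fact
  show ?thesis
    using assms relhom_zero_iff[OF assms(1,2)] relhom_mono[of "{\<zero>\<^bsub>B\<^esub>}" I B M N] by auto
qed

locale relhom_setup = M: mod_ideal I B M + N: mod_ideal I B N
  for I and B :: "('b, 'x) ring_scheme" and M :: "('b, 'm, 'y) module_scheme"
    and N :: "('b, 'n, 'z) module_scheme" +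
  fixes f
  assumes f: "f \<in> relhom B I M N"
begin

lemma hom_zero: "mcong I N (f \<zero>\<^bsub>M\<^esub>) \<zero>\<^bsub>N\<^esub>"
  using relhomD(3)[OF f, of "\<zero>\<^bsub>B\<^esub>" "\<zero>\<^bsub>M\<^esub>"] relhomD(1)[OF f]
  by (simp add: M.smult_l_zero N.smult_l_zero)

lemma add: "\<lbrakk>x \<in> carrier M; y \<in> carrier M\<rbrakk> \<Longrightarrow> mcong I N (f (x \<oplus>\<^bsub>M\<^esub> y)) (f x \<oplus>\<^bsub>N\<^esub> f y)"
  by (rule relhomD(2)[OF f])

lemma smult: "\<lbrakk>b \<in> carrier B; x \<in> carrier M\<rbrakk> \<Longrightarrow> mcong I N (f (b \<odot>\<^bsub>M\<^esub> x)) (b \<odot>\<^bsub>N\<^esub> f x)"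
  by (rule relhomD(3)[OF f])

lemma closed: "x \<in> carrier M \<Longrightarrow> f x \<in> carrier N"
  by (rule relhomD(1)[OF f])

lemma neg: "x \<in> carrier M \<Longrightarrow> mcong I N (f (\<ominus>\<^bsub>M\<^esub> x)) (\<ominus>\<^bsub>N\<^esub> f x)"
  using smult[of "\<ominus>\<^bsub>B\<^esub> \<one>\<^bsub>B\<^esub>" x] by (simp add: M.smult_l_minus N.smult_l_minus M.smult_one N.smult_one closed)

lemma diff:
  assumes "x \<in> carrier M" "y \<in> carrier M"
  shows "mcong I N (f (x \<ominus>\<^bsub>M\<^esub> y)) (f x \<ominus>\<^bsub>N\<^esub> f y)"
  unfolding M.M.minus_eq N.M.minus_eq using assms
  by (intro N.mcong_trans[OF add] N.mcong_add N.mcong_refl neg) (auto simp: closed)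

text \<open>Since f (a y) is congruent to a (f y), the submodule I M is sent into I N. Hence f
  descends to a map M / I M -> N / I N.\<close>

lemma ispan:
  assumes "x \<in> ispan I M" shows "f x \<in> ispan I N"
proof -
  have "x \<in> carrier M \<and> mcong I N (f x) \<zero>\<^bsub>N\<^esub>"
    using assms
  proof (induct x)
    case zero
    show ?case using hom_zero by simp
  next
    case (step a y x)
    have a: "a \<in> carrier B" using step(1) by (rule M.I.a_Hcarr)
    have x: "x \<in> carrier M" "mcong I N (f x) \<zero>\<^bsub>N\<^esub>" using step(4) by auto
    have 1: "mcong I N (f (a \<odot>\<^bsub>M\<^esub> y \<oplus>\<^bsub>M\<^esub> x)) (f (a \<odot>\<^bsub>M\<^esub> y) \<oplus>\<^bsub>N\<^esub> f x)"
      using step(2) a x by (intro add M.smult_closed)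
    have 2: "mcong I N (f (a \<odot>\<^bsub>M\<^esub> y) \<oplus>\<^bsub>N\<^esub> f x) (a \<odot>\<^bsub>N\<^esub> f y \<oplus>\<^bsub>N\<^esub> \<zero>\<^bsub>N\<^esub>)"
      by (rule N.mcong_add[OF smult[OF a step(2)] x(2)])
    have 3: "mcong I N (a \<odot>\<^bsub>N\<^esub> f y \<oplus>\<^bsub>N\<^esub> \<zero>\<^bsub>N\<^esub>) \<zero>\<^bsub>N\<^esub>"
      using ispan.step[OF step(1) closed[OF step(2)] ispan.zero] by (rule N.mcong_zero_iff[THEN iffD2])
    have 4: "a \<odot>\<^bsub>M\<^esub> y \<oplus>\<^bsub>M\<^esub> x \<in> carrier M"
      using M.smult_closed[OF a step(2)] x(1) by (rule M.M.a_closed)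
    show ?case
      using 4 N.mcong_trans[OF 1 N.mcong_trans[OF 2 3]] by (rule conjI)
  qed
  then show ?thesis
    by (rule conjunct2[THEN N.mcong_zero_iff[THEN iffD1]])
qed

lemma cong: "mcong I M x y \<Longrightarrow> mcong I N (f x) (f y)"
proof -
  assume *: "mcong I M x y"
  then have xy: "x \<in> carrier M" "y \<in> carrier M" "x \<ominus>\<^bsub>M\<^esub> y \<in> ispan I M" by (auto simp: mcong_def)
  have "mcong I N (f x \<ominus>\<^bsub>N\<^esub> f y) \<zero>\<^bsub>N\<^esub>"
    using ispan[OF xy(3)] by (intro N.mcong_trans[OF N.mcong_sym[OF diff[OF xy(1,2)]]] N.mcong_zero_iff[THEN iffD2])
  then have "f x \<ominus>\<^bsub>N\<^esub> f y \<in> ispan I N"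
    by (rule N.mcong_zero_iff[THEN iffD1])
  then show ?thesis using xy(1,2) closed by (simp add: mcong_def)
qed

lemma finsum:
  "\<lbrakk>\<And>j. j \<in> F \<Longrightarrow> v j \<in> carrier M; finite F\<rbrakk> \<Longrightarrow>
    mcong I N (f (finsum M v F)) (finsum N (\<lambda>j. f (v j)) F)"
proof (induction F rule: infinite_finite_induct)
  case empty
  then show ?case by (simp add: hom_zero)
next
  case (insert x F)
  have 1: "finsum M v (insert x F) = v x \<oplus>\<^bsub>M\<^esub> finsum M v F"
    "finsum N (\<lambda>j. f (v j)) (insert x F) = f (v x) \<oplus>\<^bsub>N\<^esub> finsum N (\<lambda>j. f (v j)) F"
    using insert by (auto intro!: M.M.finsum_insert N.M.finsum_insert simp: closed)
  have "finsum M v F \<in> carrier M" using insert by (intro M.M.finsum_closed) auto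
  then show ?case unfolding 1
    using insert by (intro N.mcong_trans[OF add] N.mcong_add N.mcong_refl) (auto simp: closed)
qed auto

end

lemma relhom_comp:
  assumes "left_module B M" "left_module B N" "left_module B L" "ideal I B"
    and f: "f \<in> relhom B I M N" and g: "g \<in> relhom B I N L"
  shows "(\<lambda>x. g (f x)) \<in> relhom B I M L"
proof -
  interpret f: relhom_setup I B M N f using assms by (simp add: relhom_setup_def relhom_setup_axioms_def mod_idealI)
  interpret g: relhom_setup I B N L g using assms by (simp add: relhom_setup_def relhom_setup_axioms_def mod_idealI)
  show ?thesis
    unfolding relhom_def
    by (auto simp: f.closed g.closed intro!: g.N.mcong_trans[OF g.cong[OF f.add] g.add]
        g.N.mcong_trans[OF g.cong[OF f.smult] g.smult])
qed

lemma relhom_diff: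
  assumes "left_module B M" "left_module B N" "ideal I B"
    and f: "f \<in> relhom B I M N" and g: "g \<in> relhom B I M N"
  shows "(\<lambda>x. f x \<ominus>\<^bsub>N\<^esub> g x) \<in> relhom B I M N"
proof -
  interpret f: relhom_setup I B M N f using assms by (simp add: relhom_setup_def relhom_setup_axioms_def mod_idealI)
  interpret g: relhom_setup I B M N g using assms by (simp add: relhom_setup_def relhom_setup_axioms_def mod_idealI)
  have "mcong I N (f (x \<oplus>\<^bsub>M\<^esub> y) \<ominus>\<^bsub>N\<^esub> g (x \<oplus>\<^bsub>M\<^esub> y)) ((f x \<ominus>\<^bsub>N\<^esub> g x) \<oplus>\<^bsub>N\<^esub> (f y \<ominus>\<^bsub>N\<^esub> g y))"
    if "x \<in> carrier M" "y \<in> carrier M" for x y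
    using f.N.mcong_diff[OF f.add[OF that] g.add[OF that]] that
    by (simp add: f.N.M.add_diff_add f.closed g.closed)
  moreover have "mcong I N (f (b \<odot>\<^bsub>M\<^esub> x) \<ominus>\<^bsub>N\<^esub> g (b \<odot>\<^bsub>M\<^esub> x)) (b \<odot>\<^bsub>N\<^esub> (f x \<ominus>\<^bsub>N\<^esub> g x))"
    if "b \<in> carrier B" "x \<in> carrier M" for b x
    using f.N.mcong_diff[OF f.smult[OF that] g.smult[OF that]] that
    by (simp add: f.N.smult_r_diff f.closed g.closed)
  ultimately show ?thesis
    unfolding relhom_def by (auto simp: f.closed g.closed)
qed

section \<open>Dual bases and lifting\<close>

definition fin_coeff :: "('b, 'x) ring_scheme \<Rightarrow> ('j \<Rightarrow> 'b) \<Rightarrow> bool"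
  where "fin_coeff B c \<longleftrightarrow> (\<forall>j. c j \<in> carrier B) \<and> finite {j. c j \<noteq> \<zero>\<^bsub>B\<^esub>}"

definition lincomb ::
  "('b, 'x) ring_scheme \<Rightarrow> ('b, 'm, 'y) module_scheme \<Rightarrow> ('j \<Rightarrow> 'b) \<Rightarrow> ('j \<Rightarrow> 'm) \<Rightarrow> 'm"
  where "lincomb B M c v = (\<Oplus>\<^bsub>M\<^esub>j\<in>{j. c j \<noteq> \<zero>\<^bsub>B\<^esub>}. c j \<odot>\<^bsub>M\<^esub> v j)"

text \<open>The dual basis form of projectivity: generators \<open>u j\<close> and coordinate
  functions \<open>h _ j\<close> with y equal to the sum of the \<open>h y j\<close> times
  \<open>u j\<close>. The expansion is exact, but the coordinates are linear only modulo I. For I =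
  0 this is the usual notion; for the kernel of a surjection B -> B' it is what survives of a dual
  basis over B' when the coordinates are lifted to B.\<close>

definition dual_basis ::
  "('b, 'x) ring_scheme \<Rightarrow> 'b set \<Rightarrow> ('b, 'm, 'y) module_scheme \<Rightarrow> ('j \<Rightarrow> 'm) \<Rightarrow> ('m \<Rightarrow> 'j \<Rightarrow> 'b) \<Rightarrow> bool"
  where "dual_basis B I P u h \<longleftrightarrow>
    (\<forall>j. u j \<in> carrier P) \<and>
    (\<forall>y\<in>carrier P. fin_coeff B (h y) \<and> lincomb B P (h y) u = y) \<and>
    (\<forall>y\<in>carrier P. \<forall>z\<in>carrier P. \<forall>j. h (y \<oplus>\<^bsub>P\<^esub> z) j \<ominus>\<^bsub>B\<^esub> (h y j \<oplus>\<^bsub>B\<^esub> h z j) \<in> I) \<and>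
    (\<forall>b\<in>carrier B. \<forall>y\<in>carrier P. \<forall>j. h (b \<odot>\<^bsub>P\<^esub> y) j \<ominus>\<^bsub>B\<^esub> (b \<otimes>\<^bsub>B\<^esub> h y j) \<in> I)"

lemma dual_basisD:
  assumes "dual_basis B I P u h"
  shows "u j \<in> carrier P"
    "y \<in> carrier P \<Longrightarrow> fin_coeff B (h y)"
    "y \<in> carrier P \<Longrightarrow> lincomb B P (h y) u = y"
    "\<lbrakk>y \<in> carrier P; z \<in> carrier P\<rbrakk> \<Longrightarrow> h (y \<oplus>\<^bsub>P\<^esub> z) j \<ominus>\<^bsub>B\<^esub> (h y j \<oplus>\<^bsub>B\<^esub> h z j) \<in> I"
    "\<lbrakk>b \<in> carrier B; y \<in> carrier P\<rbrakk> \<Longrightarrow> h (b \<odot>\<^bsub>P\<^esub> y) j \<ominus>\<^bsub>B\<^esub> (b \<otimes>\<^bsub>B\<^esub> h y j) \<in> I"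
  using assms by (auto simp: dual_basis_def)

lemma dual_basis_mono: "dual_basis B I P u h \<Longrightarrow> I \<subseteq> J \<Longrightarrow> dual_basis B J P u h"
  unfolding dual_basis_def by blast

lemma (in ring) fin_coeff_add:
  assumes "fin_coeff R c" "fin_coeff R c'"
  shows "fin_coeff R (\<lambda>j. c j \<oplus> c' j)"
proof -
  have "{j. c j \<oplus> c' j \<noteq> \<zero>} \<subseteq> {j. c j \<noteq> \<zero>} \<union> {j. c' j \<noteq> \<zero>}" by auto
  then show ?thesis using assms unfolding fin_coeff_def by (auto intro: finite_subset)
qed

lemma (in ring) fin_coeff_smult:
  assumes "fin_coeff R c" "b \<in> carrier R"
  shows "fin_coeff R (\<lambda>j. b \<otimes> c j)"
proof -
  have "{j. b \<otimes> c j \<noteq> \<zero>} \<subseteq> {j. c j \<noteq> \<zero>}" using assms by auto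
  then show ?thesis using assms unfolding fin_coeff_def by (auto intro: finite_subset)
qed

context left_module
begin

lemma smult_finsum:
  assumes "b \<in> carrier R" "\<And>j. j \<in> F \<Longrightarrow> v j \<in> carrier M"
  shows "b \<odot>\<^bsub>M\<^esub> finsum M v F = (\<Oplus>\<^bsub>M\<^esub>j\<in>F. b \<odot>\<^bsub>M\<^esub> v j)"
  using assms(2)
proof (induction F rule: infinite_finite_induct)
  case (insert x F)
  then have "finsum M v (insert x F) = v x \<oplus>\<^bsub>M\<^esub> finsum M v F"
    "(\<Oplus>\<^bsub>M\<^esub>j\<in>insert x F. b \<odot>\<^bsub>M\<^esub> v j) = b \<odot>\<^bsub>M\<^esub> v x \<oplus>\<^bsub>M\<^esub> (\<Oplus>\<^bsub>M\<^esub>j\<in>F. b \<odot>\<^bsub>M\<^esub> v j)"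
    using assms(1) by (auto intro!: M.finsum_insert simp: smult_closed)
  moreover have "finsum M v F \<in> carrier M"
    using insert by (intro M.finsum_closed) auto
  ultimately show ?case
    using insert assms(1) by (simp add: smult_r_distr)
qed (auto simp: assms smult_r_zero)

lemma finsum_smult:
  assumes "x \<in> carrier M" "\<And>j. j \<in> F \<Longrightarrow> c j \<in> carrier R"
  shows "finsum R c F \<odot>\<^bsub>M\<^esub> x = (\<Oplus>\<^bsub>M\<^esub>j\<in>F. c j \<odot>\<^bsub>M\<^esub> x)"
  using assms(2)
proof (induction F rule: infinite_finite_induct)
  case (insert j F)
  then have "finsum R c (insert j F) = c j \<oplus> finsum R c F"
    "(\<Oplus>\<^bsub>M\<^esub>j\<in>insert j F. c j \<odot>\<^bsub>M\<^esub> x) = c j \<odot>\<^bsub>M\<^esub> x \<oplus>\<^bsub>M\<^esub> (\<Oplus>\<^bsub>M\<^esub>j\<in>F. c j \<odot>\<^bsub>M\<^esub> x)"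
    using assms(1) by (auto intro!: M.finsum_insert R.finsum_insert simp: smult_closed)
  moreover have "finsum R c F \<in> carrier R"
    using insert by (intro R.finsum_closed) auto
  ultimately show ?case
    using insert assms(1) by (simp add: smult_l_distr)
qed (auto simp: assms smult_l_zero)

text \<open>Indices outside the support contribute zero. This puts combinations with different
  supports on a common finite index set before they are added or compared.\<close>

lemma lincomb_eq:
  assumes c: "fin_coeff R c" and v: "\<And>j. v j \<in> carrier M"
    and F: "finite F" "{j. c j \<noteq> \<zero>} \<subseteq> F"
  shows "lincomb R M c v = (\<Oplus>\<^bsub>M\<^esub>j\<in>F. c j \<odot>\<^bsub>M\<^esub> v j)"
  unfolding lincomb_def
  using assms by (intro M.add.finprod_mono_neutral_cong_left)
    (auto simp: smult_closed smult_l_zero fin_coeff_def)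

lemma lincomb_closed:
  assumes "fin_coeff R c" "\<And>j. v j \<in> carrier M"
  shows "lincomb R M c v \<in> carrier M"
  unfolding lincomb_def using assms by (intro M.finsum_closed) (auto simp: fin_coeff_def smult_closed)

lemma lincomb_add:
  assumes c: "fin_coeff R c" "fin_coeff R c'" and v: "\<And>j. v j \<in> carrier M"
  shows "lincomb R M (\<lambda>j. c j \<oplus> c' j) v = lincomb R M c v \<oplus>\<^bsub>M\<^esub> lincomb R M c' v"
proof -
  let ?F = "{j. c j \<noteq> \<zero>} \<union> {j. c' j \<noteq> \<zero>}"
  have F: "finite ?F" using c by (auto simp: fin_coeff_def)
  have cc: "c j \<in> carrier R" "c' j \<in> carrier R" for j using c by (auto simp: fin_coeff_def)
  have "lincomb R M (\<lambda>j. c j \<oplus> c' j) v = (\<Oplus>\<^bsub>M\<^esub>j\<in>?F. (c j \<oplus> c' j) \<odot>\<^bsub>M\<^esub> v j)"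
    using c F v by (intro lincomb_eq R.fin_coeff_add) auto
  also have "\<dots> = (\<Oplus>\<^bsub>M\<^esub>j\<in>?F. c j \<odot>\<^bsub>M\<^esub> v j \<oplus>\<^bsub>M\<^esub> c' j \<odot>\<^bsub>M\<^esub> v j)"
    using cc v by (simp add: smult_l_distr)
  also have "\<dots> = (\<Oplus>\<^bsub>M\<^esub>j\<in>?F. c j \<odot>\<^bsub>M\<^esub> v j) \<oplus>\<^bsub>M\<^esub> (\<Oplus>\<^bsub>M\<^esub>j\<in>?F. c' j \<odot>\<^bsub>M\<^esub> v j)"
    using cc v by (intro M.finsum_addf) (auto simp: smult_closed)
  also have "\<dots> = lincomb R M c v \<oplus>\<^bsub>M\<^esub> lincomb R M c' v"
    using c v F by (subst (1 2) lincomb_eq[of _ v ?F]) auto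
  finally show ?thesis .
qed

lemma lincomb_smult:
  assumes c: "fin_coeff R c" and b: "b \<in> carrier R" and v: "\<And>j. v j \<in> carrier M"
  shows "lincomb R M (\<lambda>j. b \<otimes> c j) v = b \<odot>\<^bsub>M\<^esub> lincomb R M c v"
proof -
  let ?F = "{j. c j \<noteq> \<zero>}"
  have F: "finite ?F" and cc: "c j \<in> carrier R" for j using c by (auto simp: fin_coeff_def)
  have "lincomb R M (\<lambda>j. b \<otimes> c j) v = (\<Oplus>\<^bsub>M\<^esub>j\<in>?F. (b \<otimes> c j) \<odot>\<^bsub>M\<^esub> v j)"
    using c F v b by (intro lincomb_eq R.fin_coeff_smult) auto
  also have "\<dots> = (\<Oplus>\<^bsub>M\<^esub>j\<in>?F. b \<odot>\<^bsub>M\<^esub> (c j \<odot>\<^bsub>M\<^esub> v j))"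
    using cc v b by (simp add: smult_assoc)
  also have "\<dots> = b \<odot>\<^bsub>M\<^esub> lincomb R M c v"
    unfolding lincomb_def using b cc v by (simp add: smult_finsum smult_closed)
  finally show ?thesis .
qed

end

lemma (in mod_ideal) lincomb_cong_right:
  assumes "fin_coeff R c" "\<And>j. mcong I M (v j) (v' j)"
  shows "mcong I M (lincomb R M c v) (lincomb R M c v')"
  unfolding lincomb_def using assms
  by (intro mcong_finsum mcong_smult) (auto simp: fin_coeff_def)

lemma (in mod_ideal) lincomb_cong_left:
  assumes c: "fin_coeff R c" "fin_coeff R c'" and v: "\<And>j. v j \<in> carrier M"
    and cc: "\<And>j. c j \<ominus> c' j \<in> I"
  shows "mcong I M (lincomb R M c v) (lincomb R M c' v)"
proof -
  let ?F = "{j. c j \<noteq> \<zero>} \<union> {j. c' j \<noteq> \<zero>}"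
  have F: "finite ?F" using c by (auto simp: fin_coeff_def)
  have "mcong I M (\<Oplus>\<^bsub>M\<^esub>j\<in>?F. c j \<odot>\<^bsub>M\<^esub> v j) (\<Oplus>\<^bsub>M\<^esub>j\<in>?F. c' j \<odot>\<^bsub>M\<^esub> v j)"
    using assms by (intro mcong_finsum mcong_smult_left) (auto simp: fin_coeff_def)
  then show ?thesis
    using c v F by (subst (1 2) lincomb_eq[of _ v ?F]) auto
qed

lemma (in relhom_setup) lincomb:
  assumes "fin_coeff B c" "\<And>j. v j \<in> carrier M"
  shows "mcong I N (f (lincomb B M c v)) (lincomb B N c (\<lambda>j. f (v j)))"
  unfolding lincomb_def using assms
  by (intro N.mcong_trans[OF finsum N.mcong_finsum[OF smult]] M.smult_closed) (auto simp: fin_coeff_def)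

lemma relhom_setupI:
  "\<lbrakk>left_module B M; left_module B N; ideal I B; f \<in> relhom B I M N\<rbrakk> \<Longrightarrow> relhom_setup I B M N f"
  by (simp add: relhom_setup_def relhom_setup_axioms_def mod_idealI)

text \<open>Choose a preimage \<open>m j\<close> of the image of each generator \<open>u j\<close>
  and send y to the combination of the \<open>m j\<close> with the coordinates of y. The coordinates
  are linear modulo I, so this map is linear modulo I M.\<close>

lemma relhom_lift:
  assumes lm: "left_module B P" "left_module B M" "left_module B N" and I: "ideal I B"
    and db: "dual_basis B I P u h"
    and D: "D \<in> relhom B I M N" and \<phi>: "\<phi> \<in> relhom B I P N"
    and ex: "\<And>x. x \<in> carrier P \<Longrightarrow> \<exists>m\<in>carrier M. mcong I N (D m) (\<phi> x)"
  obtains \<psi> where "\<psi> \<in> relhom B I P M" "\<And>x. x \<in> carrier P \<Longrightarrow> mcong I N (D (\<psi> x)) (\<phi> x)"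
proof -
  interpret D: relhom_setup I B M N D by (rule relhom_setupI) fact+
  interpret \<phi>: relhom_setup I B P N \<phi> by (rule relhom_setupI) fact+
  note db = dual_basisD[OF db]
  have "\<forall>j. \<exists>m\<in>carrier M. mcong I N (D m) (\<phi> (u j))"
    using ex db(1) by blast
  then obtain m where m: "m j \<in> carrier M" "mcong I N (D (m j)) (\<phi> (u j))" for j
    by metis
  define \<psi> where "\<psi> = (\<lambda>y. lincomb B M (h y) m)"
  have "\<psi> \<in> relhom B I P M"
  proof -
    have "mcong I M (\<psi> (x \<oplus>\<^bsub>P\<^esub> y)) (\<psi> x \<oplus>\<^bsub>M\<^esub> \<psi> y)" if "x \<in> carrier P" "y \<in> carrier P" for x y
      unfolding \<psi>_def using that m(1) db
      by (subst D.M.lincomb_add[symmetric])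
         (auto intro!: D.M.lincomb_cong_left D.M.R.fin_coeff_add)
    moreover have "mcong I M (\<psi> (b \<odot>\<^bsub>P\<^esub> y)) (b \<odot>\<^bsub>M\<^esub> \<psi> y)" if "b \<in> carrier B" "y \<in> carrier P" for b y
      unfolding \<psi>_def using that m(1) db
      by (subst D.M.lincomb_smult[symmetric])
         (auto intro!: D.M.lincomb_cong_left D.M.R.fin_coeff_smult \<phi>.M.smult_closed)
    moreover have "\<psi> x \<in> carrier M" if "x \<in> carrier P" for x
      unfolding \<psi>_def using that m(1) db(2) by (intro D.M.lincomb_closed) auto
    ultimately show ?thesis by (auto simp: relhom_def)
  qed
  moreover have "mcong I N (D (\<psi> y)) (\<phi> y)" if y: "y \<in> carrier P" for y
  proof -
    have "mcong I N (D (\<psi> y)) (lincomb B N (h y) (\<lambda>j. D (m j)))"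
      unfolding \<psi>_def using db(2)[OF y] m(1) by (rule D.lincomb)
    moreover have "mcong I N (lincomb B N (h y) (\<lambda>j. D (m j))) (lincomb B N (h y) (\<lambda>j. \<phi> (u j)))"
      using db(2)[OF y] m(2) by (rule D.N.lincomb_cong_right)
    moreover have "mcong I N (lincomb B N (h y) (\<lambda>j. \<phi> (u j))) (\<phi> y)"
      using \<phi>.lincomb[where v = u, OF db(2)[OF y] db(1)] unfolding db(3)[OF y] by (rule D.N.mcong_sym)
    ultimately show ?thesis by (blast intro: D.N.mcong_trans)
  qed
  ultimately show ?thesis using that by blast
qed

section \<open>Projective modules have dual bases\<close>

lemma (in ring) left_module_free: "left_module R (free_module R S)"
proof -
  let ?F = "free_module R S"
  \<comment> \<open>One finiteness fact serves addition, negation and scaling: an operation with f 0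
    0 = 0 has its support inside the union of the two supports. Unary operations use x in both
    places.\<close>
  have sub: "finite {s. f (x s) (y s) \<noteq> \<zero>}" if "f \<zero> \<zero> = \<zero>" "finite {s. x s \<noteq> \<zero>}" "finite {s. y s \<noteq> \<zero>}"
    for f and x y :: "'c \<Rightarrow> 'a"
    by (rule finite_subset[of _ "{s. x s \<noteq> \<zero>} \<union> {s. y s \<noteq> \<zero>}"]) (use that in auto)
  have "abelian_group ?F"
  proof (rule abelian_groupI)
    fix x y assume "x \<in> carrier ?F" "y \<in> carrier ?F"
    then show "x \<oplus>\<^bsub>?F\<^esub> y \<in> carrier ?F"
      by (auto simp: free_module_def sub[of "\<lambda>a b. a \<oplus> b"])
  next
    fix x assume x: "x \<in> carrier ?F"
    then have "(\<lambda>s. \<ominus> x s) \<in> carrier ?F"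
      by (auto simp: free_module_def sub[of "\<lambda>a b. \<ominus> a" x x])
    then show "\<exists>y\<in>carrier ?F. y \<oplus>\<^bsub>?F\<^esub> x = \<zero>\<^bsub>?F\<^esub>"
      by (rule bexI[rotated]) (use x in \<open>auto simp: free_module_def l_neg\<close>)
  qed (auto simp: free_module_def a_ac)
  moreover have "left_module_axioms R ?F"
  proof
    fix a x assume "a \<in> carrier R" "x \<in> carrier ?F"
    then show "a \<odot>\<^bsub>?F\<^esub> x \<in> carrier ?F"
      by (auto simp: free_module_def sub[of "\<lambda>b c. a \<otimes> b" x x])
  qed (auto simp: free_module_def l_distr r_distr m_assoc)
  ultimately show ?thesis
    by (simp add: left_module_def ring_axioms)
qed

lemma free_module_simps:
  "x \<in> carrier (free_module R S) \<longleftrightarrow>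
    (\<forall>s. x s \<in> carrier R) \<and> (\<forall>s. s \<notin> S \<longrightarrow> x s = \<zero>\<^bsub>R\<^esub>) \<and> finite {s. x s \<noteq> \<zero>\<^bsub>R\<^esub>}"
  "x \<oplus>\<^bsub>free_module R S\<^esub> y = (\<lambda>s. x s \<oplus>\<^bsub>R\<^esub> y s)"
  "r \<odot>\<^bsub>free_module R S\<^esub> x = (\<lambda>s. r \<otimes>\<^bsub>R\<^esub> x s)"
  "\<zero>\<^bsub>free_module R S\<^esub> = (\<lambda>s. \<zero>\<^bsub>R\<^esub>)"
  by (auto simp: free_module_def)

lemma (in ring) basis_elem_closed: "s \<in> S \<Longrightarrow> basis_elem R s \<in> carrier (free_module R S)"
  by (auto simp: free_module_simps basis_elem_def)

text \<open>The free module on the carrier of P maps onto P. Lifting the identity of P along this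
  map gives a section, whose components are the coordinate functions.\<close>

lemma projective_dual_basis:
  fixes P :: "('b, 'p) module"
  assumes "projective B P"
  obtains u :: "'p \<Rightarrow> 'p" and h where "dual_basis B {\<zero>\<^bsub>B\<^esub>} P u h"
proof -
  interpret P: left_module B P using assms by (simp add: projective_def)
  let ?F = "free_module B (carrier P)"
  \<comment> \<open>The index set of a dual basis is a whole type, here the one containing P;
    indices outside the carrier get the generator 0.\<close>
  define u where "u = (\<lambda>x. if x \<in> carrier P then x else \<zero>\<^bsub>P\<^esub>)"
  define g where "g = (\<lambda>z. lincomb B P z u)"
  have u: "u x \<in> carrier P" for x by (simp add: u_def)
  have fc: "fin_coeff B z" if "z \<in> carrier ?F" for z
    using that by (simp add: fin_coeff_def free_module_simps)
  have g: "g \<in> mod_hom B ?F P"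
    using u by (auto simp: mod_hom_def g_def free_module_simps(2,3) fc
        intro!: P.lincomb_closed P.lincomb_add P.lincomb_smult)
  moreover have "g ` carrier ?F = carrier P"
  proof (intro antisym subsetI)
    fix x assume x: "x \<in> carrier P"
    have b: "basis_elem B x \<in> carrier ?F" by (rule P.R.basis_elem_closed[OF x])
    have "g (basis_elem B x) = (\<Oplus>\<^bsub>P\<^esub>y\<in>{x}. basis_elem B x y \<odot>\<^bsub>P\<^esub> u y)"
      unfolding g_def using fc[OF b] u by (rule P.lincomb_eq) (auto simp: basis_elem_def)
    also have "\<dots> = x" using x by (simp add: basis_elem_def u_def P.smult_one P.smult_closed)
    finally show "x \<in> g ` carrier ?F" using b by force
  qed (use g in \<open>auto simp: mod_hom_def\<close>)
  moreover have "(\<lambda>x. x) \<in> mod_hom B P P" by (auto simp: mod_hom_def)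
  moreover note P.R.left_module_free[of "carrier P"] P.left_module_axioms
  ultimately obtain h where h: "h \<in> mod_hom B P ?F" "\<And>x. x \<in> carrier P \<Longrightarrow> g (h x) = x"
    using assms unfolding projective_def by metis
  have "dual_basis B {\<zero>\<^bsub>B\<^esub>} P u h"
    unfolding dual_basis_def
    using h u fc mod_homD(1)[OF h(1)] mod_homD(2,3)[OF h(1)] fc[unfolded fin_coeff_def]
    by (auto simp: g_def free_module_simps(2,3) P.R.diff_self)
  then show ?thesis using that by blast
qed

section \<open>Ideals generated by idempotents\<close>

text \<open>The \<open>e t\<close> and the left linear maps \<open>\<sigma> t\<close> form a finite
  dual basis of I as a left module, so I is projective as a left ideal. Idempotency of the
  generators supplies \<open>I = I\<^sup>2\<close>. For I the direct sum of the left ideals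
  generated by the \<open>e t\<close>, the maps \<open>\<sigma> t\<close> are the projections onto
  the summands.\<close>

locale idempotent_ideal = ideal I B for I and B :: "('b, 'x) ring_scheme" (structure) +
  fixes T :: "'t set" and e :: "'t \<Rightarrow> 'b" and \<sigma> :: "'t \<Rightarrow> 'b \<Rightarrow> 'b"
  assumes finite_T: "finite T"
    and e_mem: "t \<in> T \<Longrightarrow> e t \<in> I"
    and e_idem: "t \<in> T \<Longrightarrow> e t \<otimes> e t = e t"
    and \<sigma>_closed: "\<lbrakk>t \<in> T; x \<in> I\<rbrakk> \<Longrightarrow> \<sigma> t x \<in> carrier B"
    and \<sigma>_add: "\<lbrakk>t \<in> T; x \<in> I; y \<in> I\<rbrakk> \<Longrightarrow> \<sigma> t (x \<oplus> y) = \<sigma> t x \<oplus> \<sigma> t y"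
    and \<sigma>_mult: "\<lbrakk>t \<in> T; b \<in> carrier B; x \<in> I\<rbrakk> \<Longrightarrow> \<sigma> t (b \<otimes> x) = b \<otimes> \<sigma> t x"
    and \<sigma>_sum: "x \<in> I \<Longrightarrow> x = (\<Oplus>t\<in>T. \<sigma> t x \<otimes> e t)"
begin

lemma \<sigma>_zero: "t \<in> T \<Longrightarrow> \<sigma> t \<zero> = \<zero>"
  using \<sigma>_mult[of t \<zero> \<zero>] \<sigma>_closed[of t \<zero>] by simp

end

definition span_mod :: "'b set \<Rightarrow> ('b, 'm, 'y) module_scheme \<Rightarrow> ('b, 'm, 'y) module_scheme"
  where "span_mod I M = M\<lparr>carrier := ispan I M\<rparr>"

lemma span_mod_simps [simp]:
  "carrier (span_mod I M) = ispan I M" "x \<oplus>\<^bsub>span_mod I M\<^esub> y = x \<oplus>\<^bsub>M\<^esub> y"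
  "a \<odot>\<^bsub>span_mod I M\<^esub> x = a \<odot>\<^bsub>M\<^esub> x" "\<zero>\<^bsub>span_mod I M\<^esub> = \<zero>\<^bsub>M\<^esub>"
  by (simp_all add: span_mod_def)

lemma left_module_span_mod:
  assumes "mod_ideal I R M" shows "left_module R (span_mod I M)"
proof -
  interpret mod_ideal I R M by fact
  have "submodule (ispan I M) R M"
    by (rule submodule_criterion) (auto simp: ispan_carrier ispan_add ispan_smult ispan.zero)
  then show ?thesis
    unfolding span_mod_def by (rule left_module_restrict[OF left_module_axioms])
qed

text \<open>The definition of \<open>finsum\<close> refers to the carrier, so shrinking the carrier
  could change it; summands that lie in I M rule this out.\<close>

lemma (in mod_ideal) finsum_span_mod:
  assumes "\<And>j. j \<in> F \<Longrightarrow> v j \<in> ispan I M"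
  shows "finsum (span_mod I M) v F = finsum M v F"
proof -
  interpret S: left_module R "span_mod I M"
    by (rule left_module_span_mod) (rule mod_ideal_axioms)
  show ?thesis using assms
  proof (induction F rule: infinite_finite_induct)
    case (insert x F)
    then have "finsum (span_mod I M) v (insert x F) = v x \<oplus>\<^bsub>M\<^esub> finsum (span_mod I M) v F"
      using S.M.finsum_insert[of F x v] by auto
    moreover have "finsum M v (insert x F) = v x \<oplus>\<^bsub>M\<^esub> finsum M v F"
      using insert by (intro M.finsum_insert) (auto simp: ispan_carrier)
    ultimately show ?case using insert by simp
  qed auto
qed

lemma (in abelian_monoid) finsum_Times:
  assumes "finite A" "finite C" "\<And>x y. x \<in> A \<Longrightarrow> y \<in> C \<Longrightarrow> f (x, y) \<in> carrier G"
  shows "finsum G f (A \<times> C) = (\<Oplus>y\<in>C. \<Oplus>x\<in>A. f (x, y))"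
  using assms(2,3)
proof (induction C rule: finite_induct)
  case (insert y C)
  have "A \<times> insert y C = (\<lambda>x. (x, y)) ` A \<union> A \<times> C" by auto
  then have "finsum G f (A \<times> insert y C) = finsum G f ((\<lambda>x. (x, y)) ` A) \<oplus> finsum G f (A \<times> C)"
    using insert assms(1) by (simp only:) (intro finsum_Un_disjoint; auto)
  also have "finsum G f ((\<lambda>x. (x, y)) ` A) = (\<Oplus>x\<in>A. f (x, y))"
    using insert by (intro finsum_reindex) (auto simp: inj_on_def)
  also have "\<dots> \<oplus> finsum G f (A \<times> C) = (\<Oplus>y\<in>insert y C. \<Oplus>x\<in>A. f (x, y))"
    using insert by (subst finsum_insert) auto
  finally show ?case .
qed auto

context idempotent_ideal
begin

text \<open>This is I M = I (I M). Write a in I as the sum of the (\<open>\<sigma> t a\<close>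
  \<open>e t\<close>) \<open>e t\<close>, using that \<open>e t\<close> is idempotent; in a y the
  left factor of each term lies in I and \<open>e t\<close> y lies in I M.\<close>

lemma ispan_idem:
  assumes "left_module B M" "x \<in> ispan I M"
  shows "x \<in> ispan I (span_mod I M)"
proof -
  interpret M: mod_ideal I B M using assms by (simp add: mod_idealI is_ideal)
  interpret S: left_module B "span_mod I M"
    by (rule left_module_span_mod) (rule M.mod_ideal_axioms)
  interpret S: mod_ideal I B "span_mod I M"
    by (simp add: mod_idealI is_ideal S.left_module_axioms)
  show ?thesis using assms(2)
  proof (induction rule: ispan.induct)
    case zero
    then show ?case using ispan.zero[of "span_mod I M" I] by simp
  next
    case (step a y x)
    have a: "a = (\<Oplus>t\<in>T. (\<sigma> t a \<otimes> e t) \<otimes> e t)"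
      using \<sigma>_sum[OF step(1)] \<sigma>_closed[OF _ step(1)] e_mem e_idem
      by (simp add: m_assoc Icarr cong: finsum_cong)
    have t: "\<sigma> t a \<otimes> e t \<in> I" if "t \<in> T" for t
      using that step e_mem \<sigma>_closed by (simp add: I_l_closed)
    have "a \<odot>\<^bsub>M\<^esub> y = (\<Oplus>\<^bsub>M\<^esub>t\<in>T. ((\<sigma> t a \<otimes> e t) \<otimes> e t) \<odot>\<^bsub>M\<^esub> y)"
      using t e_mem step by (subst a, subst M.finsum_smult) (auto simp: Icarr)
    also have "\<dots> = (\<Oplus>\<^bsub>M\<^esub>t\<in>T. (\<sigma> t a \<otimes> e t) \<odot>\<^bsub>M\<^esub> (e t \<odot>\<^bsub>M\<^esub> y))"
      using t e_mem step by (intro M.M.finsum_cong') (auto simp: Icarr M.smult_assoc M.smult_closed)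
    also have "\<dots> = (\<Oplus>\<^bsub>span_mod I M\<^esub>t\<in>T. (\<sigma> t a \<otimes> e t) \<odot>\<^bsub>M\<^esub> (e t \<odot>\<^bsub>M\<^esub> y))"
      using t e_mem step by (intro M.finsum_span_mod[symmetric] M.ispan_smult M.ispan_elem) (auto simp: Icarr)
    also have "\<dots> \<in> ispan I (span_mod I M)"
      using t e_mem step S.ispan_elem by (intro S.ispan_finsum) (auto simp: M.ispan_elem)
    finally show ?case using S.ispan_add step by simp
  qed
qed

text \<open>I P is projective when P is: the coordinates of an element of I P lie in I, and there
  each one splits as the sum of \<open>\<sigma> t (h y x)\<close> times \<open>e t\<close>. So the
  products of \<open>e t\<close> with \<open>u x\<close> generate, and the composites of \<sigma>
  with h are the new coordinates.\<close>

lemma dual_basis_span_mod: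
  assumes "left_module B P" and db: "dual_basis B {\<zero>} P u h"
  defines "u' \<equiv> \<lambda>(t, x). if t \<in> T then e t \<odot>\<^bsub>P\<^esub> u x else \<zero>\<^bsub>P\<^esub>"
    and "h' \<equiv> \<lambda>y (t, x). if t \<in> T then \<sigma> t (h y x) else \<zero>"
  shows "dual_basis B {\<zero>} (span_mod I P) u' h'"
proof -
  interpret P: mod_ideal I B P using assms by (simp add: mod_idealI is_ideal)
  interpret S: left_module B "span_mod I P"
    by (rule left_module_span_mod) (rule P.mod_ideal_axioms)
  note d = dual_basisD[OF db]
  have hc: "h y x \<in> carrier B" if "y \<in> carrier P" for y x
    using d(2)[OF that] by (simp add: fin_coeff_def)
  have h_add: "h (y \<oplus>\<^bsub>P\<^esub> z) x = h y x \<oplus> h z x" if "y \<in> carrier P" "z \<in> carrier P" for y z x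
    using d(4)[OF that, of x] that by (simp add: hc diff_eq_zero_iff)
  have h_mult: "h (b \<odot>\<^bsub>P\<^esub> y) x = b \<otimes> h y x" if "b \<in> carrier B" "y \<in> carrier P" for b y x
    using d(5)[OF that, of x] that by (simp add: hc diff_eq_zero_iff P.smult_closed)
  \<comment> \<open>By linearity \<open>h (a y)\<close> is a times \<open>h y\<close>, which lies in
    I because I also absorbs multiplication from the right.\<close>
  have hI: "h y x \<in> I" if "y \<in> ispan I P" for y x
    using that
  proof (induction rule: ispan.induct)
    case zero
    then show ?case using h_mult[of \<zero> "\<zero>\<^bsub>P\<^esub>" x] by (simp add: P.smult_l_zero hc)
  next
    case (step a y z)
    then show ?case
      using P.ispan_carrier by (simp add: h_add h_mult Icarr P.smult_closed I_r_closed hc)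
  qed
  have u': "u' j \<in> ispan I P" for j
    using e_mem d(1) by (auto simp: u'_def split_beta P.ispan_elem ispan.zero)
  have h'c: "h' y j \<in> carrier B" if "y \<in> ispan I P" for y j
    using hI[OF that] \<sigma>_closed by (auto simp: h'_def split_beta)
  have supp: "{j. h' y j \<noteq> \<zero>} \<subseteq> T \<times> {x. h y x \<noteq> \<zero>}" if "y \<in> ispan I P" for y
    using \<sigma>_zero by (auto simp: h'_def split: if_splits)
  have fin: "fin_coeff B (h' y)" if "y \<in> ispan I P" for y
    using h'c[OF that] supp[OF that] d(2)[OF P.ispan_carrier[OF that]] finite_T
    by (auto simp: fin_coeff_def intro: finite_subset)
  have "lincomb B (span_mod I P) (h' y) u' = y" if y: "y \<in> ispan I P" for y
  proof -
    let ?F = "{x. h y x \<noteq> \<zero>}"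
    have F: "finite ?F" using d(2)[OF P.ispan_carrier[OF y]] by (simp add: fin_coeff_def)
    have "lincomb B (span_mod I P) (h' y) u' = (\<Oplus>\<^bsub>span_mod I P\<^esub>j\<in>T \<times> ?F. h' y j \<odot>\<^bsub>P\<^esub> u' j)"
      using S.lincomb_eq[OF fin[OF y] _ _ supp[OF y], of u'] u' F finite_T by simp
    also have "\<dots> = (\<Oplus>\<^bsub>P\<^esub>j\<in>T \<times> ?F. h' y j \<odot>\<^bsub>P\<^esub> u' j)"
      using u' h'c[OF y] by (intro P.finsum_span_mod P.ispan_smult)
    also have "\<dots> = (\<Oplus>\<^bsub>P\<^esub>x\<in>?F. \<Oplus>\<^bsub>P\<^esub>t\<in>T. h' y (t, x) \<odot>\<^bsub>P\<^esub> u' (t, x))"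
      using F finite_T u' h'c[OF y] by (intro P.M.finsum_Times P.smult_closed P.ispan_carrier)
    also have "\<dots> = (\<Oplus>\<^bsub>P\<^esub>x\<in>?F. h y x \<odot>\<^bsub>P\<^esub> u x)"
    proof (intro P.M.finsum_cong' refl funcsetI P.smult_closed hc P.ispan_carrier[OF y] d(1))
      fix x
      have "(\<Oplus>\<^bsub>P\<^esub>t\<in>T. h' y (t, x) \<odot>\<^bsub>P\<^esub> u' (t, x)) = (\<Oplus>\<^bsub>P\<^esub>t\<in>T. (\<sigma> t (h y x) \<otimes> e t) \<odot>\<^bsub>P\<^esub> u x)"
        using e_mem \<sigma>_closed hI[OF y] d(1)
        by (intro P.M.finsum_cong') (auto simp: h'_def u'_def Icarr P.smult_assoc P.smult_closed)
      also have "\<dots> = (\<Oplus>t\<in>T. \<sigma> t (h y x) \<otimes> e t) \<odot>\<^bsub>P\<^esub> u x"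
        using e_mem \<sigma>_closed hI[OF y] d(1) by (intro P.finsum_smult[symmetric]) (auto simp: Icarr)
      also have "\<dots> = h y x \<odot>\<^bsub>P\<^esub> u x"
        using \<sigma>_sum[OF hI[OF y]] by metis
      finally show "(\<Oplus>\<^bsub>P\<^esub>t\<in>T. h' y (t, x) \<odot>\<^bsub>P\<^esub> u' (t, x)) = h y x \<odot>\<^bsub>P\<^esub> u x" .
    qed
    also have "\<dots> = y"
      using d(3)[OF P.ispan_carrier[OF y]] by (simp add: lincomb_def)
    finally show ?thesis .
  qed
  moreover have "h' (y \<oplus>\<^bsub>P\<^esub> z) j = h' y j \<oplus> h' z j" if "y \<in> ispan I P" "z \<in> ispan I P" for y z j
    using that hI \<sigma>_add by (auto simp: h'_def split_beta h_add P.ispan_carrier)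
  moreover have "h' (b \<odot>\<^bsub>P\<^esub> y) j = b \<otimes> h' y j" if "b \<in> carrier B" "y \<in> ispan I P" for b y j
    using that hI \<sigma>_mult by (auto simp: h'_def split_beta h_mult P.ispan_carrier)
  ultimately show ?thesis
    using u' fin h'c by (auto simp: dual_basis_def diff_self)
qed

end

section \<open>Reduction of a projective resolution\<close>

locale resolution =
  fixes B :: "('b, 'x) ring_scheme" and N :: "('b, 'n) module"
    and P :: "nat \<Rightarrow> ('b, 'p) module" and d :: "nat \<Rightarrow> 'p \<Rightarrow> 'p" and \<eta> :: "'p \<Rightarrow> 'n"
  assumes N: "left_module B N"
    and P: "left_module B (P k)"
    and d: "d k \<in> mod_hom B (P (Suc k)) (P k)"
    and \<eta>: "\<eta> \<in> mod_hom B (P 0) N"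
    and \<eta>_surj: "s \<in> carrier N \<Longrightarrow> \<exists>x\<in>carrier (P 0). \<eta> x = s"
    and dd: "x \<in> carrier (P (Suc (Suc k))) \<Longrightarrow> d k (d (Suc k) x) = \<zero>\<^bsub>P k\<^esub>"
    and \<eta>d: "x \<in> carrier (P 1) \<Longrightarrow> \<eta> (d 0 x) = \<zero>\<^bsub>N\<^esub>"
    and exact0: "\<lbrakk>x \<in> carrier (P 0); \<eta> x = \<zero>\<^bsub>N\<^esub>\<rbrakk> \<Longrightarrow> \<exists>w\<in>carrier (P 1). d 0 w = x"
    and exactS: "\<lbrakk>x \<in> carrier (P (Suc k)); d k x = \<zero>\<^bsub>P k\<^esub>\<rbrakk> \<Longrightarrow>
      \<exists>w\<in>carrier (P (Suc (Suc k))). d (Suc k) w = x"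

lemma projective_resolution_resolution:
  assumes "projective_resolution B N P d \<eta>"
  shows "resolution B N P d \<eta>"
proof -
  have 1: "left_module B N" "\<And>k. left_module B (P k)" "\<And>k. d k \<in> mod_hom B (P (Suc k)) (P k)"
    "\<eta> \<in> mod_hom B (P 0) N" "carrier N = \<eta> ` carrier (P 0)"
    and 2: "{x \<in> carrier (P 0). \<eta> x = \<zero>\<^bsub>N\<^esub>} = d 0 ` carrier (P 1)"
    and 3: "\<And>k. {x \<in> carrier (P (Suc k)). d k x = \<zero>\<^bsub>P k\<^esub>} = d (Suc k) ` carrier (P (Suc (Suc k)))"
    using assms unfolding projective_resolution_def projective_def by simp_all
  show ?thesis
  proof (rule resolution.intro; (fact 1)?)
    show "\<exists>x\<in>carrier (P 0). \<eta> x = s" if "s \<in> carrier N" for s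
      using that 1(5) by auto
    show "d k (d (Suc k) x) = \<zero>\<^bsub>P k\<^esub>" if "x \<in> carrier (P (Suc (Suc k)))" for x k
      using imageI[OF that, of "d (Suc k)"] unfolding 3[symmetric] by simp
    show "\<eta> (d 0 x) = \<zero>\<^bsub>N\<^esub>" if "x \<in> carrier (P 1)" for x
      using imageI[OF that, of "d 0"] unfolding 2[symmetric] by simp
    show "\<exists>w\<in>carrier (P 1). d 0 w = x" if "x \<in> carrier (P 0)" "\<eta> x = \<zero>\<^bsub>N\<^esub>" for x
      using that equalityD1[OF 2] by blast
    show "\<exists>w\<in>carrier (P (Suc (Suc k))). d (Suc k) w = x"
      if "x \<in> carrier (P (Suc k))" "d k x = \<zero>\<^bsub>P k\<^esub>" for x k
      using that equalityD1[OF 3[of k]] by blast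
  qed
qed

lemma mod_hom_span_mod:
  assumes "left_module B M" "left_module B N" "ideal I B" "f \<in> mod_hom B M N"
  shows "f \<in> mod_hom B (span_mod I M) (span_mod I N)"
proof -
  interpret f: relhom_setup I B M N f
    by (rule relhom_setupI) (use assms mod_hom_relhom[OF assms] in auto)
  show ?thesis
    using assms(4) f.M.ispan_carrier f.ispan by (auto simp: mod_hom_def)
qed

text \<open>By idempotency x is a sum of terms a y with a in I and y again in I P. A preimage v of
  the image of y need only lie in \<open>Q'\<close>; the term a v then lies in I
  \<open>Q'\<close>.\<close>

lemma (in idempotent_ideal) lift_into_span:
  assumes lm: "left_module B P" "left_module B Q" "left_module B Q'"
    and D: "D \<in> mod_hom B Q' Q" and \<phi>: "\<phi> \<in> mod_hom B (span_mod I P) Q"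
    and ex: "\<And>x. x \<in> ispan I P \<Longrightarrow> \<exists>w\<in>carrier Q'. D w = \<phi> x"
    and x: "x \<in> ispan I P"
  shows "\<exists>w\<in>ispan I Q'. D w = \<phi> x"
proof -
  interpret P: mod_ideal I B P using lm by (simp add: mod_idealI is_ideal)
  interpret Q': mod_ideal I B Q' using lm by (simp add: mod_idealI is_ideal)
  interpret SP: left_module B "span_mod I P"
    by (rule left_module_span_mod) (rule P.mod_ideal_axioms)
  interpret SP: mod_ideal I B "span_mod I P"
    by (simp add: mod_idealI is_ideal SP.left_module_axioms)
  note D = mod_homD[OF D] and \<phi> = mod_homD[OF \<phi>]
  have "x \<in> ispan I (span_mod I P)" using lm(1) x by (rule ispan_idem)
  then show ?thesis
  proof (induction rule: ispan.induct)
    case zero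
    have "D \<zero>\<^bsub>Q'\<^esub> = \<phi> \<zero>\<^bsub>P\<^esub>"
    proof -
      interpret Q: left_module B Q by fact
      show ?thesis
        using D(3)[of \<zero> "\<zero>\<^bsub>Q'\<^esub>"] \<phi>(3)[of \<zero> "\<zero>\<^bsub>P\<^esub>"] \<phi>(1)[of "\<zero>\<^bsub>P\<^esub>"] D(1)[of "\<zero>\<^bsub>Q'\<^esub>"]
        by (simp add: P.smult_l_zero Q'.smult_l_zero Q.smult_l_zero ispan.zero)
    qed
    then show ?case by (auto intro: ispan.zero)
  next
    case (step a y x)
    then obtain w where w: "w \<in> ispan I Q'" "D w = \<phi> x" by auto
    obtain v where v: "v \<in> carrier Q'" "D v = \<phi> y" using ex step by auto
    have "x \<in> ispan I P" using SP.ispan_carrier step(3) by simp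
    then have "D (a \<odot>\<^bsub>Q'\<^esub> v \<oplus>\<^bsub>Q'\<^esub> w) = \<phi> (a \<odot>\<^bsub>span_mod I P\<^esub> y \<oplus>\<^bsub>span_mod I P\<^esub> x)"
      using step v w Q'.ispan_carrier \<phi>(2)[of "a \<odot>\<^bsub>P\<^esub> y" x] \<phi>(3)[of a y]
      by (simp add: D Icarr Q'.smult_closed P.ispan_smult)
    then show ?case
      using step(1) v w by (intro bexI[of _ "a \<odot>\<^bsub>Q'\<^esub> v \<oplus>\<^bsub>Q'\<^esub> w"]) (auto intro: ispan.step)
  qed
qed

text \<open>Preimages in I \<open>Q'\<close> exist pointwise by idempotency; projectivity of I P
  turns them into a linear map. The relative lifting lemma is used here with the zero ideal.\<close>

lemma (in idempotent_ideal) span_mod_lift: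
  fixes u :: "'j \<Rightarrow> 'p"
  assumes lm: "left_module B P" "left_module B Q" "left_module B Q'"
    and db: "dual_basis B {\<zero>} P u h"
    and D: "D \<in> mod_hom B Q' Q" and \<phi>: "\<phi> \<in> mod_hom B (span_mod I P) (span_mod I Q)"
    and ex: "\<And>x. x \<in> ispan I P \<Longrightarrow> \<exists>w\<in>carrier Q'. D w = \<phi> x"
  obtains \<psi> where "\<psi> \<in> mod_hom B (span_mod I P) (span_mod I Q')"
    "\<And>x. x \<in> ispan I P \<Longrightarrow> D (\<psi> x) = \<phi> x"
proof -
  have sm': "left_module B (span_mod I P)" "left_module B (span_mod I Q)" "left_module B (span_mod I Q')"
    using left_module_span_mod[OF mod_idealI[OF _ is_ideal]] lm by blast+
  interpret SQ: left_module B "span_mod I Q" by fact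
  interpret Q: mod_ideal I B Q using lm by (simp add: mod_idealI is_ideal)
  have \<phi>': "\<phi> \<in> mod_hom B (span_mod I P) Q"
    using \<phi> Q.ispan_carrier by (auto simp: mod_hom_def)
  have ex': "\<exists>w\<in>carrier (span_mod I Q'). mcong {\<zero>} (span_mod I Q) (D w) (\<phi> x)"
    if "x \<in> carrier (span_mod I P)" for x
  proof -
    have "\<exists>w\<in>ispan I Q'. D w = \<phi> x"
      using that by (intro lift_into_span[OF lm D \<phi>' ex]) simp_all
    then obtain w where "w \<in> ispan I Q'" "D w = \<phi> x" by blast
    then show ?thesis
      using mod_homD(1)[OF \<phi> that] by (intro bexI[of _ w]) (simp_all add: SQ.mcong_zero)
  qed
  have DS: "D \<in> relhom B {\<zero>} (span_mod I Q') (span_mod I Q)"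
    using mod_hom_span_mod[OF lm(3,2) is_ideal D] sm' by (simp add: relhom_zero_iff)
  have \<phi>S: "\<phi> \<in> relhom B {\<zero>} (span_mod I P) (span_mod I Q)"
    using \<phi> sm' by (simp add: relhom_zero_iff)
  obtain \<psi> where \<psi>: "\<psi> \<in> relhom B {\<zero>} (span_mod I P) (span_mod I Q')"
    "\<And>x. x \<in> carrier (span_mod I P) \<Longrightarrow> mcong {\<zero>} (span_mod I Q) (D (\<psi> x)) (\<phi> x)"
    using relhom_lift[OF sm'(1,3,2) zeroideal dual_basis_span_mod[OF lm(1) db] DS \<phi>S ex'] by blast
  show ?thesis
    using that[of \<psi>] \<psi> sm' by (simp add: relhom_zero_iff SQ.mcong_zero)
qed

locale reduction = idempotent_ideal I B T e \<sigma> + resolution B N P d \<eta>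
  for I and B :: "('b, 'x) ring_scheme" (structure) and T :: "'t set" and e \<sigma>
    and N :: "('b, 'n) module" and P :: "nat \<Rightarrow> ('b, 'p) module" and d \<eta> +
  fixes u :: "nat \<Rightarrow> 'j \<Rightarrow> 'p" and h
  assumes db: "dual_basis B {\<zero>} (P k) (u k) (h k)"
    and I_N: "\<lbrakk>b \<in> I; s \<in> carrier N\<rbrakk> \<Longrightarrow> b \<odot>\<^bsub>N\<^esub> s = \<zero>\<^bsub>N\<^esub>"
begin

lemma span_P: "x \<in> ispan I (P k) \<Longrightarrow> x \<in> carrier (P k)"
  using mod_ideal.ispan_carrier[OF mod_idealI[OF P is_ideal]] .

lemma span_d: "x \<in> ispan I (P (Suc k)) \<Longrightarrow> d k x \<in> ispan I (P k)"
  using mod_homD(1)[OF mod_hom_span_mod[OF P P is_ideal d], of x] by simp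

text \<open>The image lies in I N, which is zero. Therefore all of I P in degree 0 consists of
  boundaries of P, and the contraction can start there.\<close>

lemma \<eta>_span:
  assumes "x \<in> ispan I (P 0)" shows "\<eta> x = \<zero>\<^bsub>N\<^esub>"
proof -
  interpret N: left_module B N by (rule N)
  have "\<eta> x \<in> ispan I N"
    using mod_homD(1)[OF mod_hom_span_mod[OF P N is_ideal \<eta>], of x] assms by simp
  then show ?thesis
    by (induction rule: ispan.induct) (auto simp: I_N)
qed

text \<open>
  The complex \<open>I P\<close> is contractible: its terms are projective, and as \<open>I = I\<^sup>2\<close> any map from
  \<open>I P\<^sub>k\<close> into the cycles of \<open>P\<close> takes values in the boundaries of \<open>I P\<close>.
\<close>

lemma span_contraction:
  "\<exists>s. (\<forall>x\<in>ispan I (P 0). d 0 (s 0 x) = x) \<and>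
    (\<forall>k. s k \<in> mod_hom B (span_mod I (P k)) (span_mod I (P (Suc k)))) \<and>
    (\<forall>k. \<forall>x\<in>ispan I (P (Suc k)). d (Suc k) (s (Suc k) x) \<oplus>\<^bsub>P (Suc k)\<^esub> s k (d k x) = x)"
proof -
  \<comment> \<open>The second clause says that x - s (d x) is a cycle for every x in I P. This is
    exactly what allows the next map of the contraction to be constructed as a lift.\<close>
  let ?S = "\<lambda>k s. s \<in> mod_hom B (span_mod I (P k)) (span_mod I (P (Suc k))) \<and>
    (\<forall>y\<in>ispan I (P (Suc k)). d k (s (d k y)) = d k y)"
  let ?Q = "\<lambda>k s s'. \<forall>x\<in>ispan I (P (Suc k)). d (Suc k) (s' x) \<oplus>\<^bsub>P (Suc k)\<^esub> s (d k x) = x"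
  \<comment> \<open>In degree 0 the contraction identity has no second summand, so s is required to
    be a right inverse of d on I P.\<close>
  let ?S0 = "\<lambda>k s. ?S k s \<and> (k = 0 \<longrightarrow> (\<forall>x\<in>ispan I (P 0). d 0 (s x) = x))"
  have "\<exists>s. \<forall>k. ?S0 k (s k) \<and> ?Q k (s k) (s (Suc k))"
  proof (rule dependent_nat_choice)
    have id: "(\<lambda>x. x) \<in> mod_hom B (span_mod I (P 0)) (span_mod I (P 0))"
      by (auto simp: mod_hom_def)
    have "\<exists>w\<in>carrier (P (Suc 0)). d 0 w = x" if "x \<in> ispan I (P 0)" for x
      using exact0[of x] \<eta>_span[OF that] span_P[OF that] by simp
    from span_mod_lift[OF P P P db d id this]
    obtain s where "s \<in> mod_hom B (span_mod I (P 0)) (span_mod I (P (Suc 0)))"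
      "\<And>x. x \<in> ispan I (P 0) \<Longrightarrow> d 0 (s x) = x" by blast
    then show "\<exists>s. ?S0 0 s" using span_d by blast
  next
    fix s k assume "?S0 k s"
    then have s: "s \<in> mod_hom B (span_mod I (P k)) (span_mod I (P (Suc k)))"
      and ds: "\<And>y. y \<in> ispan I (P (Suc k)) \<Longrightarrow> d k (s (d k y)) = d k y" by auto
    define \<phi> where "\<phi> = (\<lambda>x. x \<ominus>\<^bsub>P (Suc k)\<^esub> s (d k x))"
    interpret P1: left_module B "P (Suc k)" by (rule P)
    interpret P1: mod_ideal I B "P (Suc k)" by (rule mod_idealI[OF P is_ideal])
    interpret P0: left_module B "P k" by (rule P)
    have s': "s (d k x) \<in> ispan I (P (Suc k))" if "x \<in> ispan I (P (Suc k))" for x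
      using mod_homD(1)[OF s, of "d k x"] span_d[OF that] by simp
    have \<phi>: "\<phi> \<in> mod_hom B (span_mod I (P (Suc k))) (span_mod I (P (Suc k)))"
      using span_P span_d s' mod_homD[OF s] mod_homD[OF d]
      by (auto simp: mod_hom_def \<phi>_def P1.ispan_diff P1.M.add_diff_add P1.smult_r_diff)
    have d_diff: "d k (x \<ominus>\<^bsub>P (Suc k)\<^esub> y) = d k x \<ominus>\<^bsub>P k\<^esub> d k y"
      if "x \<in> carrier (P (Suc k))" "y \<in> carrier (P (Suc k))" for x y
    proof -
      interpret d: relhom_setup "{\<zero>}" B "P (Suc k)" "P k" "d k"
        using mod_hom_relhom[OF P P zeroideal d] by (intro relhom_setupI P zeroideal)
      show ?thesis using d.diff[OF that] by (simp add: P0.mcong_zero)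
    qed
    have "\<exists>w\<in>carrier (P (Suc (Suc k))). d (Suc k) w = \<phi> x" if x: "x \<in> ispan I (P (Suc k))" for x
    proof (rule exactS)
      show "\<phi> x \<in> carrier (P (Suc k))" using mod_homD(1)[OF \<phi>] x span_P by simp
      show "d k (\<phi> x) = \<zero>\<^bsub>P k\<^esub>"
        using x span_P s' ds mod_homD(1)[OF d] by (simp add: \<phi>_def d_diff P0.M.diff_self)
    qed
    from span_mod_lift[OF P P P db d \<phi> this]
    obtain t where t: "t \<in> mod_hom B (span_mod I (P (Suc k))) (span_mod I (P (Suc (Suc k))))"
      "\<And>x. x \<in> ispan I (P (Suc k)) \<Longrightarrow> d (Suc k) (t x) = \<phi> x" by blast
    have "?Q k s t"
      using t(2) span_P s' by (simp add: \<phi>_def P1.M.diff_add_cancel)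
    \<comment> \<open>At x = d y the correction s (d x) is s 0 = 0, so the invariant passes on to
      t.\<close>
    moreover have "d (Suc k) (t (d (Suc k) y)) = d (Suc k) y" if y: "y \<in> ispan I (P (Suc (Suc k)))" for y
    proof -
      have "s \<zero>\<^bsub>P k\<^esub> = \<zero>\<^bsub>P (Suc k)\<^esub>"
        using mod_homD(3)[OF s, of \<zero> "\<zero>\<^bsub>P k\<^esub>"] mod_homD(1)[OF s, of "\<zero>\<^bsub>P k\<^esub>"] span_P
        by (simp add: P0.smult_l_zero P1.smult_l_zero ispan.zero)
      then show ?thesis
        using t(2)[OF span_d[OF y]] dd[OF span_P[OF y]] span_P[OF span_d[OF y]]
        by (simp add: \<phi>_def P1.M.diff_zero)
    qed
    ultimately show "\<exists>t. ?S0 (Suc k) t \<and> ?Q k s t" using t(1) by blast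
  qed
  then obtain s where s: "\<forall>k. ?S0 k (s k) \<and> ?Q k (s k) (s (Suc k))" by (rule exE) (rule that)
  have "d 0 (s 0 x) = x" if "x \<in> ispan I (P 0)" for x
    using spec[OF s, of 0] that by simp
  then show ?thesis
    using s by (intro exI[of _ s]) simp
qed

text \<open>In degree 0 every element of I P is a boundary of I P, since the contraction is there a
  right inverse of the differential.\<close>

lemma span_exact0:
  assumes x: "x \<in> ispan I (P 0)" shows "\<exists>w\<in>ispan I (P 1). d 0 w = x"
proof -
  obtain s where s: "\<And>k. s k \<in> mod_hom B (span_mod I (P k)) (span_mod I (P (Suc k)))"
    "d 0 (s 0 x) = x"
    using span_contraction x by metis
  then show ?thesis using mod_homD(1)[OF s(1), of x 0] x by auto
qed

text \<open>On a cycle the contraction identity loses its term s (d x) and exhibits x as the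
  boundary of s x.\<close>

lemma span_exactS:
  assumes x: "x \<in> ispan I (P (Suc k))" "d k x = \<zero>\<^bsub>P k\<^esub>"
  shows "\<exists>w\<in>ispan I (P (Suc (Suc k))). d (Suc k) w = x"
proof -
  obtain s where s: "\<And>k. s k \<in> mod_hom B (span_mod I (P k)) (span_mod I (P (Suc k)))"
    "\<And>k x. x \<in> ispan I (P (Suc k)) \<Longrightarrow> d (Suc k) (s (Suc k) x) \<oplus>\<^bsub>P (Suc k)\<^esub> s k (d k x) = x"
    using span_contraction by metis
  interpret P1: left_module B "P (Suc k)" by (rule P)
  interpret P0: left_module B "P k" by (rule P)
  have "s k \<zero>\<^bsub>P k\<^esub> = \<zero>\<^bsub>P (Suc k)\<^esub>"
    using mod_homD(3)[OF s(1), of \<zero> "\<zero>\<^bsub>P k\<^esub>" k] mod_homD(1)[OF s(1), of "\<zero>\<^bsub>P k\<^esub>" k] span_P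
    by (simp add: P0.smult_l_zero P1.smult_l_zero ispan.zero)
  moreover have w: "s (Suc k) x \<in> ispan I (P (Suc (Suc k)))"
    using mod_homD(1)[OF s(1), of x "Suc k"] x by simp
  ultimately have "d (Suc k) (s (Suc k) x) = x"
    using s(2)[OF x(1)] x mod_homD(1)[OF d span_P[OF w]] by simp
  then show ?thesis using w by blast
qed

end

section \<open>Comparison of resolutions\<close>

text \<open>The differentials are genuine homomorphisms with exact relations d d = 0 and \<eta> d =
  0, whereas exactness and the dual bases are required only modulo I. A resolution over B and a
  pulled back resolution over B / I both have this form, so that each can play either role in a
  comparison.\<close>

locale rel_resolution = I: ideal I B for I and B :: "('b, 'x) ring_scheme" +
  fixes N :: "('b, 'n) module" and P :: "nat \<Rightarrow> ('b, 'p) module" and d :: "nat \<Rightarrow> 'p \<Rightarrow> 'p"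
    and \<eta> :: "'p \<Rightarrow> 'n" and u :: "nat \<Rightarrow> 'j \<Rightarrow> 'p" and h
  assumes N: "left_module B N"
    and P: "left_module B (P k)"
    and d: "d k \<in> mod_hom B (P (Suc k)) (P k)"
    and \<eta>: "\<eta> \<in> mod_hom B (P 0) N"
    and \<eta>_surj: "s \<in> carrier N \<Longrightarrow> \<exists>x\<in>carrier (P 0). \<eta> x = s"
    and dd: "x \<in> carrier (P (Suc (Suc k))) \<Longrightarrow> d k (d (Suc k) x) = \<zero>\<^bsub>P k\<^esub>"
    and \<eta>d: "x \<in> carrier (P 1) \<Longrightarrow> \<eta> (d 0 x) = \<zero>\<^bsub>N\<^esub>"
    and exact0: "\<lbrakk>x \<in> carrier (P 0); \<eta> x \<in> ispan I N\<rbrakk> \<Longrightarrow>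
      \<exists>w\<in>carrier (P 1). mcong I (P 0) (d 0 w) x"
    and exactS: "\<lbrakk>x \<in> carrier (P (Suc k)); d k x \<in> ispan I (P k)\<rbrakk> \<Longrightarrow>
      \<exists>w\<in>carrier (P (Suc (Suc k))). mcong I (P (Suc k)) (d (Suc k) w) x"
    and db: "dual_basis B I (P k) (u k) (h k)"
begin

sublocale N: mod_ideal I B N
  by (intro mod_idealI N I.is_ideal)

sublocale M: mod_ideal I B "P k" for k
  by (intro mod_idealI P I.is_ideal)

sublocale D: relhom_setup I B "P (Suc k)" "P k" "d k" for k
  by (intro relhom_setupI P I.is_ideal mod_hom_relhom d)

sublocale E: relhom_setup I B "P 0" N \<eta>
  by (intro relhom_setupI P N I.is_ideal mod_hom_relhom \<eta>)

text \<open>Cycles of the augmented complex modulo I: \<eta> acts as the differential leaving degree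
  0, so that one exactness statement covers all degrees.\<close>

definition cyc :: "nat \<Rightarrow> 'p \<Rightarrow> bool"
  where "cyc k x \<longleftrightarrow> (case k of 0 \<Rightarrow> mcong I N (\<eta> x) \<zero>\<^bsub>N\<^esub> | Suc j \<Rightarrow> mcong I (P j) (d j x) \<zero>\<^bsub>P j\<^esub>)"

lemma cyc_exact:
  assumes "x \<in> carrier (P k)" "cyc k x"
  shows "\<exists>w\<in>carrier (P (Suc k)). mcong I (P k) (d k w) x"
proof (cases k)
  case 0
  then show ?thesis
    using exact0[of x] assms by (simp add: cyc_def N.mcong_zero_iff)
next
  case (Suc j)
  then show ?thesis
    using exactS[of x j] assms by (simp add: cyc_def M.mcong_zero_iff)
qed

end

text \<open>Exactness turns the condition that all values are cycles into the pointwise preimages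
  demanded by the lifting lemma.\<close>

lemma relhom_lift_cyc:
  assumes "rel_resolution I B N Q d' \<eta>' u' h'" and P: "left_module B P" and db: "dual_basis B I P u h"
    and \<phi>: "\<phi> \<in> relhom B I P (Q k)"
    and cyc: "\<And>x. x \<in> carrier P \<Longrightarrow> rel_resolution.cyc I N Q d' \<eta>' k (\<phi> x)"
  obtains \<psi> where "\<psi> \<in> relhom B I P (Q (Suc k))"
    "\<And>x. x \<in> carrier P \<Longrightarrow> mcong I (Q k) (d' k (\<psi> x)) (\<phi> x)"
proof -
  interpret Q: rel_resolution I B N Q d' \<eta>' u' h' by fact
  show ?thesis
    using relhom_lift[OF P Q.P Q.P Q.I.is_ideal db Q.D.f \<phi>] Q.cyc_exact[OF relhomD(1)[OF \<phi>] cyc] that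
    by blast
qed

locale rel_resolution_pair =
  P: rel_resolution I B N P d \<eta> u h + Q: rel_resolution I B N Q d' \<eta>' u' h'
  for I and B :: "('b, 'x) ring_scheme" and N :: "('b, 'n) module"
    and P :: "nat \<Rightarrow> ('b, 'p) module" and d \<eta> and u :: "nat \<Rightarrow> 'i \<Rightarrow> 'p" and h
    and Q :: "nat \<Rightarrow> ('b, 'q) module" and d' \<eta>' and u' :: "nat \<Rightarrow> 'j \<Rightarrow> 'q" and h'
begin

text \<open>The identity of N is lifted degree by degree to a chain map modulo I.\<close>

lemma comparison_map:
  "\<exists>f. (\<forall>x\<in>carrier (P 0). mcong I N (\<eta>' (f 0 x)) (\<eta> x)) \<and>
    (\<forall>k. f k \<in> relhom B I (P k) (Q k)) \<and>
    (\<forall>k. \<forall>x\<in>carrier (P (Suc k)). mcong I (Q k) (d' k (f (Suc k) x)) (f k (d k x)))"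
proof -
  \<comment> \<open>Besides linearity, the invariant says that f d takes values in cycles of Q, the
    condition for lifting it to the next degree.\<close>
  let ?S = "\<lambda>k f. f \<in> relhom B I (P k) (Q k) \<and> (\<forall>x\<in>carrier (P (Suc k)). Q.cyc k (f (d k x))) \<and>
    (k = 0 \<longrightarrow> (\<forall>x\<in>carrier (P 0). mcong I N (\<eta>' (f x)) (\<eta> x)))"
  let ?T = "\<lambda>k f f'. \<forall>x\<in>carrier (P (Suc k)). mcong I (Q k) (d' k (f' x)) (f (d k x))"
  have "\<exists>f. \<forall>k. ?S k (f k) \<and> ?T k (f k) (f (Suc k))"
  proof (rule dependent_nat_choice)
    have "\<exists>m\<in>carrier (Q 0). mcong I N (\<eta>' m) (\<eta> x)" if "x \<in> carrier (P 0)" for x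
      using Q.\<eta>_surj[OF P.E.closed[OF that]] P.N.mcong_refl[OF P.E.closed[OF that]] by metis
    from relhom_lift[OF P.P Q.P P.N P.I.is_ideal P.db Q.E.f P.E.f this]
    obtain f where f: "f \<in> relhom B I (P 0) (Q 0)"
      "\<And>x. x \<in> carrier (P 0) \<Longrightarrow> mcong I N (\<eta>' (f x)) (\<eta> x)" by blast
    have "Q.cyc 0 (f (d 0 x))" if "x \<in> carrier (P (Suc 0))" for x
      using f(2)[OF P.D.closed[OF that]] that P.\<eta>d by (simp add: Q.cyc_def)
    then show "\<exists>f. ?S 0 f" using f by blast
  next
    fix f k assume "?S k f"
    then have f: "f \<in> relhom B I (P k) (Q k)"
      and cyc: "\<And>x. x \<in> carrier (P (Suc k)) \<Longrightarrow> Q.cyc k (f (d k x))" by auto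
    interpret f: relhom_setup I B "P k" "Q k" f
      by (intro relhom_setupI P.P Q.P P.I.is_ideal f)
    have \<phi>: "(\<lambda>x. f (d k x)) \<in> relhom B I (P (Suc k)) (Q k)"
      by (rule relhom_comp[OF P.P P.P Q.P P.I.is_ideal P.D.f f])
    from relhom_lift_cyc[OF Q.rel_resolution_axioms P.P P.db \<phi> cyc]
    obtain g where g: "g \<in> relhom B I (P (Suc k)) (Q (Suc k))"
      "\<And>x. x \<in> carrier (P (Suc k)) \<Longrightarrow> mcong I (Q k) (d' k (g x)) (f (d k x))" by blast
    \<comment> \<open>Here d' g d x is congruent to f (d d x) = f 0, and f 0 is only congruent to 0
      because f is linear only modulo I.\<close>
    have "Q.cyc (Suc k) (g (d (Suc k) x))" if "x \<in> carrier (P (Suc (Suc k)))" for x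
      using Q.M.mcong_trans[OF g(2)[OF P.D.closed[OF that], unfolded P.dd[OF that]] f.hom_zero]
      by (simp add: Q.cyc_def)
    then show "\<exists>g. ?S (Suc k) g \<and> ?T k f g" using g by blast
  qed
  then obtain f where f: "\<forall>k. ?S k (f k) \<and> ?T k (f k) (f (Suc k))" by (rule exE) (rule that)
  have "\<forall>x\<in>carrier (P 0). mcong I N (\<eta>' (f 0 x)) (\<eta> x)"
    using spec[OF f, of 0] by simp
  then show ?thesis
    using f by (intro exI[of _ f]) simp
qed

text \<open>A chain map modulo I that induces zero on N is null homotopic modulo I; the next map of
  the homotopy is a lift of F - s d.\<close>

lemma null_homotopy:
  assumes F: "\<And>k. F k \<in> relhom B I (P k) (Q k)"
    and F0: "\<And>x. x \<in> carrier (P 0) \<Longrightarrow> mcong I N (\<eta>' (F 0 x)) \<zero>\<^bsub>N\<^esub>"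
    and Fd: "\<And>k x. x \<in> carrier (P (Suc k)) \<Longrightarrow> mcong I (Q k) (d' k (F (Suc k) x)) (F k (d k x))"
  shows "\<exists>s. (\<forall>x\<in>carrier (P 0). mcong I (Q 0) (d' 0 (s 0 x)) (F 0 x)) \<and>
    (\<forall>k. s k \<in> relhom B I (P k) (Q (Suc k))) \<and>
    (\<forall>k. \<forall>x\<in>carrier (P (Suc k)).
      mcong I (Q (Suc k)) (d' (Suc k) (s (Suc k) x)) (F (Suc k) x \<ominus>\<^bsub>Q (Suc k)\<^esub> s k (d k x)))"
proof -
  interpret F: relhom_setup I B "P i" "Q i" "F i" for i
    by (intro relhom_setupI P.P Q.P P.I.is_ideal F)
  let ?S = "\<lambda>k s. s \<in> relhom B I (P k) (Q (Suc k)) \<and>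
    (\<forall>x\<in>carrier (P (Suc k)). Q.cyc (Suc k) (F (Suc k) x \<ominus>\<^bsub>Q (Suc k)\<^esub> s (d k x))) \<and>
    (k = 0 \<longrightarrow> (\<forall>x\<in>carrier (P 0). mcong I (Q 0) (d' 0 (s x)) (F 0 x)))"
  let ?T = "\<lambda>k s s'. \<forall>x\<in>carrier (P (Suc k)).
    mcong I (Q (Suc k)) (d' (Suc k) (s' x)) (F (Suc k) x \<ominus>\<^bsub>Q (Suc k)\<^esub> s (d k x))"
  \<comment> \<open>Applying d' to F x - s (d x) gives F (d x) - d' s (d x), and the congruence
    assumed for s at d x makes the two terms cancel.\<close>
  have step: "Q.cyc (Suc k) (F (Suc k) x \<ominus>\<^bsub>Q (Suc k)\<^esub> s (d k x))"
    if s: "s \<in> relhom B I (P k) (Q (Suc k))"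
      and x: "x \<in> carrier (P (Suc k))" and ds: "mcong I (Q k) (d' k (s (d k x))) (F k (d k x))" for s k x
  proof -
    have sx: "s (d k x) \<in> carrier (Q (Suc k))"
      using relhomD(1)[OF s] P.D.closed x by blast
    have "mcong I (Q k) (d' k (F (Suc k) x \<ominus>\<^bsub>Q (Suc k)\<^esub> s (d k x)))
        (d' k (F (Suc k) x) \<ominus>\<^bsub>Q k\<^esub> d' k (s (d k x)))"
      by (rule Q.D.diff[OF F.closed[OF x] sx])
    also have "mcong I (Q k) \<dots> (F k (d k x) \<ominus>\<^bsub>Q k\<^esub> F k (d k x))"
      by (rule Q.M.mcong_diff[OF Fd[OF x] ds])
    also have "F k (d k x) \<ominus>\<^bsub>Q k\<^esub> F k (d k x) = \<zero>\<^bsub>Q k\<^esub>"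
      by (rule Q.M.M.diff_self[OF F.closed[OF P.D.closed[OF x]]])
    finally show ?thesis by (simp add: Q.cyc_def)
  qed
  have "\<exists>s. \<forall>k. ?S k (s k) \<and> ?T k (s k) (s (Suc k))"
  proof (rule dependent_nat_choice)
    have "Q.cyc 0 (F 0 x)" if "x \<in> carrier (P 0)" for x
      using F0[OF that] by (simp add: Q.cyc_def)
    from relhom_lift_cyc[OF Q.rel_resolution_axioms P.P P.db F this]
    obtain s where s: "s \<in> relhom B I (P 0) (Q (Suc 0))"
      "\<And>x. x \<in> carrier (P 0) \<Longrightarrow> mcong I (Q 0) (d' 0 (s x)) (F 0 x)" by blast
    then show "\<exists>s. ?S 0 s" using step[OF s(1)] P.D.closed by blast
  next
    fix s k assume "?S k s"
    then have s: "s \<in> relhom B I (P k) (Q (Suc k))"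
      and cyc: "\<And>x. x \<in> carrier (P (Suc k)) \<Longrightarrow> Q.cyc (Suc k) (F (Suc k) x \<ominus>\<^bsub>Q (Suc k)\<^esub> s (d k x))" by auto
    interpret s: relhom_setup I B "P k" "Q (Suc k)" s
      by (intro relhom_setupI P.P Q.P P.I.is_ideal s)
    have \<phi>: "(\<lambda>x. F (Suc k) x \<ominus>\<^bsub>Q (Suc k)\<^esub> s (d k x)) \<in> relhom B I (P (Suc k)) (Q (Suc k))"
      by (intro relhom_diff P.P Q.P P.I.is_ideal F relhom_comp[OF P.P P.P Q.P P.I.is_ideal P.D.f s])
    from relhom_lift_cyc[OF Q.rel_resolution_axioms P.P P.db \<phi> cyc]
    obtain t where t: "t \<in> relhom B I (P (Suc k)) (Q (Suc (Suc k)))"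
      "\<And>x. x \<in> carrier (P (Suc k)) \<Longrightarrow>
        mcong I (Q (Suc k)) (d' (Suc k) (t x)) (F (Suc k) x \<ominus>\<^bsub>Q (Suc k)\<^esub> s (d k x))" by blast
    have "mcong I (Q (Suc k)) (d' (Suc k) (t (d (Suc k) x))) (F (Suc k) (d (Suc k) x))"
      if x: "x \<in> carrier (P (Suc (Suc k)))" for x
    proof -
      have "mcong I (Q (Suc k)) (d' (Suc k) (t (d (Suc k) x)))
          (F (Suc k) (d (Suc k) x) \<ominus>\<^bsub>Q (Suc k)\<^esub> s \<zero>\<^bsub>P k\<^esub>)"
        using t(2)[OF P.D.closed[OF x]] unfolding P.dd[OF x] .
      also have "mcong I (Q (Suc k)) \<dots> (F (Suc k) (d (Suc k) x) \<ominus>\<^bsub>Q (Suc k)\<^esub> \<zero>\<^bsub>Q (Suc k)\<^esub>)"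
        by (intro Q.M.mcong_diff s.hom_zero Q.M.mcong_refl F.closed P.D.closed x)
      also have "\<dots> = F (Suc k) (d (Suc k) x)"
        by (intro Q.M.M.diff_zero F.closed P.D.closed x)
      finally show ?thesis .
    qed
    then show "\<exists>t. ?S (Suc k) t \<and> ?T k s t" using t step[OF t(1)] by blast
  qed
  then obtain s where s: "\<forall>k. ?S k (s k) \<and> ?T k (s k) (s (Suc k))" by (rule exE) (rule that)
  have "\<forall>x\<in>carrier (P 0). mcong I (Q 0) (d' 0 (s 0 x)) (F 0 x)"
    using spec[OF s, of 0] by simp
  then show ?thesis
    using s by (intro exI[of _ s]) simp
qed

end

text \<open>The preimages in \<open>P\<close> of the cycles and boundaries of the complex \<open>P / J P\<close>.\<close>

definition hcycles :: "'b set \<Rightarrow> (nat \<Rightarrow> ('b, 'p) module) \<Rightarrow> (nat \<Rightarrow> 'p \<Rightarrow> 'p) \<Rightarrow> nat \<Rightarrow> 'p set"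
  where "hcycles J P d k = {x \<in> carrier (P k). \<forall>j. k = Suc j \<longrightarrow> d j x \<in> ispan J (P j)}"

lemma hcyclesD:
  "x \<in> hcycles J P d k \<Longrightarrow> x \<in> carrier (P k)"
  "x \<in> hcycles J P d (Suc j) \<Longrightarrow> d j x \<in> ispan J (P j)"
  by (simp_all add: hcycles_def)

definition hbounds :: "'b set \<Rightarrow> (nat \<Rightarrow> ('b, 'p) module) \<Rightarrow> (nat \<Rightarrow> 'p \<Rightarrow> 'p) \<Rightarrow> nat \<Rightarrow> 'p set"
  where "hbounds J P d k = {x. \<exists>w\<in>carrier (P (Suc k)). mcong J (P k) (d k w) x}"

lemma hcycles_map:
  assumes J: "ideal J B" and P: "\<And>k. left_module B (P k)" and Q: "\<And>k. left_module B (Q k)"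
    and f: "\<And>k. f k \<in> relhom B J (P k) (Q k)"
    and fd: "\<And>k x. x \<in> carrier (P (Suc k)) \<Longrightarrow> mcong J (Q k) (d' k (f (Suc k) x)) (f k (d k x))"
    and x: "x \<in> hcycles J P d k"
  shows "f k x \<in> hcycles J Q d' k"
proof -
  interpret f: relhom_setup J B "P i" "Q i" "f i" for i
    by (intro relhom_setupI P Q J f)
  have "d' j (f (Suc j) x) \<in> ispan J (Q j)" if k: "k = Suc j" for j
  proof -
    have "mcong J (Q j) (f j (d j x)) \<zero>\<^bsub>Q j\<^esub>"
      using x k by (simp add: hcycles_def f.N.mcong_zero_iff f.ispan)
    then have "mcong J (Q j) (d' j (f (Suc j) x)) \<zero>\<^bsub>Q j\<^esub>"
      using x k by (intro f.N.mcong_trans[OF fd]) (auto simp: hcycles_def)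
    then show ?thesis by (simp add: f.N.mcong_zero_iff)
  qed
  then show ?thesis using x f.closed by (auto simp: hcycles_def)
qed

text \<open>F = id - g f induces zero on N and hence is null homotopic. The homotopy is built modulo
  I, where exactness is available, and is then read modulo the larger ideal J, whose reduction
  computes Tor.\<close>

lemma (in rel_resolution_pair) retract_hcycles:
  assumes f: "\<And>k. f k \<in> relhom B I (P k) (Q k)"
    and f0: "\<And>x. x \<in> carrier (P 0) \<Longrightarrow> mcong I N (\<eta>' (f 0 x)) (\<eta> x)"
    and fd: "\<And>k x. x \<in> carrier (P (Suc k)) \<Longrightarrow> mcong I (Q k) (d' k (f (Suc k) x)) (f k (d k x))"
    and g: "\<And>k. g k \<in> relhom B I (Q k) (P k)"
    and g0: "\<And>x. x \<in> carrier (Q 0) \<Longrightarrow> mcong I N (\<eta> (g 0 x)) (\<eta>' x)"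
    and gd: "\<And>k x. x \<in> carrier (Q (Suc k)) \<Longrightarrow> mcong I (P k) (d k (g (Suc k) x)) (g k (d' k x))"
    and J: "ideal J B" "I \<subseteq> J" and x: "x \<in> hcycles J P d k"
  shows "x \<ominus>\<^bsub>P k\<^esub> g k (f k x) \<in> hbounds J P d k"
proof -
  interpret PP: rel_resolution_pair I B N P d \<eta> u h P d \<eta> u h
    by (simp add: rel_resolution_pair_def P.rel_resolution_axioms)
  interpret f: relhom_setup I B "P i" "Q i" "f i" for i
    by (intro relhom_setupI P.P Q.P P.I.is_ideal f)
  interpret g: relhom_setup I B "Q i" "P i" "g i" for i
    by (intro relhom_setupI P.P Q.P P.I.is_ideal g)
  define F where "F = (\<lambda>k x. x \<ominus>\<^bsub>P k\<^esub> g k (f k x))"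
  have id: "(\<lambda>x. x) \<in> relhom B I (P k) (P k)" for k
    by (rule mod_hom_relhom[OF P.P P.P P.I.is_ideal]) (simp add: mod_hom_def)
  have F: "F k \<in> relhom B I (P k) (P k)" for k
    unfolding F_def by (intro relhom_diff id P.P Q.P P.I.is_ideal relhom_comp[OF P.P Q.P P.P P.I.is_ideal f g])
  have F0: "mcong I N (\<eta> (F 0 x)) \<zero>\<^bsub>N\<^esub>" if x: "x \<in> carrier (P 0)" for x
  proof -
    have "mcong I N (\<eta> (F 0 x)) (\<eta> x \<ominus>\<^bsub>N\<^esub> \<eta> (g 0 (f 0 x)))"
      unfolding F_def by (intro P.E.diff x g.closed f.closed)
    also have "mcong I N \<dots> (\<eta> x \<ominus>\<^bsub>N\<^esub> \<eta> x)"
      by (intro P.N.mcong_diff P.N.mcong_refl P.E.closed x P.N.mcong_trans[OF g0 f0] f.closed)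
    also have "\<eta> x \<ominus>\<^bsub>N\<^esub> \<eta> x = \<zero>\<^bsub>N\<^esub>"
      by (intro P.N.M.diff_self P.E.closed x)
    finally show ?thesis .
  qed
  have Fd: "mcong I (P k) (d k (F (Suc k) x)) (F k (d k x))" if x: "x \<in> carrier (P (Suc k))" for k x
  proof -
    have "mcong I (P k) (d k (F (Suc k) x)) (d k x \<ominus>\<^bsub>P k\<^esub> d k (g (Suc k) (f (Suc k) x)))"
      unfolding F_def by (intro P.D.diff x g.closed f.closed)
    also have "mcong I (P k) \<dots> (F k (d k x))"
      unfolding F_def
      by (intro P.M.mcong_diff P.M.mcong_refl P.D.closed x P.M.mcong_trans[OF gd g.cong[OF fd]] f.closed)
    finally show ?thesis .
  qed
  obtain s where s0: "\<And>x. x \<in> carrier (P 0) \<Longrightarrow> mcong I (P 0) (d 0 (s 0 x)) (F 0 x)"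
    and s: "\<And>k. s k \<in> relhom B I (P k) (P (Suc k))"
    and sd: "\<And>k x. x \<in> carrier (P (Suc k)) \<Longrightarrow>
      mcong I (P (Suc k)) (d (Suc k) (s (Suc k) x)) (F (Suc k) x \<ominus>\<^bsub>P (Suc k)\<^esub> s k (d k x))"
    using PP.null_homotopy[of F, OF F F0 Fd] by metis
  have xc: "x \<in> carrier (P k)" by (rule hcyclesD(1)[OF x])
  have sc: "s k x \<in> carrier (P (Suc k))"
    using relhomD(1)[OF s xc] .
  have "mcong J (P k) (d k (s k x)) (F k x)"
  proof (cases k)
    case 0
    show ?thesis using mcong_mono[OF J(2) s0, of x] xc unfolding 0 .
  next
    case (Suc j)
    interpret s: relhom_setup J B "P j" "P k" "s j"
      unfolding Suc by (intro relhom_setupI P.P J subsetD[OF relhom_mono[OF J(2)] s])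
    have 1: "mcong J (P k) (d k (s k x)) (F k x \<ominus>\<^bsub>P k\<^esub> s j (d j x))"
      using mcong_mono[OF J(2) sd] xc Suc by simp
    have dx: "d j x \<in> ispan J (P j)"
      using x Suc by (simp add: hcycles_def)
    \<comment> \<open>For a cycle of P / J P the boundary d x lies in J P, and s preserves J P; so
      the second term of the homotopy disappears.\<close>
    have "mcong J (P k) (s j (d j x)) \<zero>\<^bsub>P k\<^esub>"
      by (rule s.N.mcong_zero_iff[THEN iffD2, OF s.ispan[OF dx]])
    then have "mcong J (P k) (F k x \<ominus>\<^bsub>P k\<^esub> s j (d j x)) (F k x \<ominus>\<^bsub>P k\<^esub> \<zero>\<^bsub>P k\<^esub>)"
      using relhomD(1)[OF F xc] by (intro s.N.mcong_diff s.N.mcong_refl)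
    with 1 have "mcong J (P k) (d k (s k x)) (F k x \<ominus>\<^bsub>P k\<^esub> \<zero>\<^bsub>P k\<^esub>)"
      by (rule s.N.mcong_trans)
    then show ?thesis using relhomD(1)[OF F xc] by (simp add: P.M.M.diff_zero)
  qed
  then show ?thesis using sc by (auto simp: hbounds_def F_def)
qed

text \<open>The clauses say, on representatives, that f induces a bijection on the homology of P / J
  P and Q / J Q. Injectivity: if f x bounds v, then x = (x - g f x) + g f x, where the first part is
  a boundary by homotopy and the second is congruent to the boundary of g v. Surjectivity: y is
  homologous to f (g y).\<close>

lemma (in rel_resolution_pair) hcycles_comparison:
  assumes J: "ideal J B" "I \<subseteq> J"
  shows "\<exists>f. f \<in> relhom B J (P k) (Q k) \<and>
    (\<forall>x\<in>hcycles J P d k. f x \<in> hcycles J Q d' k) \<and>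
    (\<forall>x\<in>hcycles J P d k. f x \<in> hbounds J Q d' k \<longleftrightarrow> x \<in> hbounds J P d k) \<and>
    (\<forall>y\<in>hcycles J Q d' k. \<exists>x\<in>hcycles J P d k. y \<ominus>\<^bsub>Q k\<^esub> f x \<in> hbounds J Q d' k)"
proof -
  interpret QP: rel_resolution_pair I B N Q d' \<eta>' u' h' P d \<eta> u h
    by (simp add: rel_resolution_pair_def P.rel_resolution_axioms Q.rel_resolution_axioms)
  obtain f where f0: "\<And>x. x \<in> carrier (P 0) \<Longrightarrow> mcong I N (\<eta>' (f 0 x)) (\<eta> x)"
    and f: "\<And>k. f k \<in> relhom B I (P k) (Q k)"
    and fd: "\<And>k x. x \<in> carrier (P (Suc k)) \<Longrightarrow> mcong I (Q k) (d' k (f (Suc k) x)) (f k (d k x))"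
    using comparison_map by metis
  obtain g where g0: "\<And>x. x \<in> carrier (Q 0) \<Longrightarrow> mcong I N (\<eta> (g 0 x)) (\<eta>' x)"
    and g: "\<And>k. g k \<in> relhom B I (Q k) (P k)"
    and gd: "\<And>k x. x \<in> carrier (Q (Suc k)) \<Longrightarrow> mcong I (P k) (d k (g (Suc k) x)) (g k (d' k x))"
    using QP.comparison_map by metis
  interpret f: relhom_setup J B "P i" "Q i" "f i" for i
    by (intro relhom_setupI P.P Q.P J subsetD[OF relhom_mono[OF J(2)] f])
  interpret g: relhom_setup J B "Q i" "P i" "g i" for i
    by (intro relhom_setupI P.P Q.P J subsetD[OF relhom_mono[OF J(2)] g])
  interpret PD: relhom_setup J B "P (Suc i)" "P i" "d i" for i
    by (intro relhom_setupI P.P J mod_hom_relhom P.d)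
  interpret QD: relhom_setup J B "Q (Suc i)" "Q i" "d' i" for i
    by (intro relhom_setupI Q.P J mod_hom_relhom Q.d)
  note fJ = mcong_mono[OF J(2) fd] and gJ = mcong_mono[OF J(2) gd]
  have fcyc: "f k x \<in> hcycles J Q d' k" if x: "x \<in> hcycles J P d k" for x k
    by (rule hcycles_map[OF J(1) P.P Q.P f.f fJ x])
  have gcyc: "g k x \<in> hcycles J P d k" if x: "x \<in> hcycles J Q d' k" for x k
    by (rule hcycles_map[OF J(1) Q.P P.P g.f gJ x])
  have fbd: "f k x \<in> hbounds J Q d' k" if x: "x \<in> hbounds J P d k" for x
  proof -
    obtain w where w: "w \<in> carrier (P (Suc k))" "mcong J (P k) (d k w) x"
      using x by (auto simp: hbounds_def)
    show ?thesis
      using f.N.mcong_trans[OF fJ[OF w(1)] f.cong[OF w(2)]] f.closed[OF w(1)] by (auto simp: hbounds_def)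
  qed
  have bd: "x \<in> hbounds J P d k" if x: "x \<in> hcycles J P d k" and fx: "f k x \<in> hbounds J Q d' k" for x
  proof -
    have xc: "x \<in> carrier (P k)" by (rule hcyclesD(1)[OF x])
    obtain v where v: "v \<in> carrier (Q (Suc k))" "mcong J (Q k) (d' k v) (f k x)"
      using fx by (auto simp: hbounds_def)
    have 1: "mcong J (P k) (d k (g (Suc k) v)) (g k (f k x))"
      by (rule f.M.mcong_trans[OF gJ[OF v(1)] g.cong[OF v(2)]])
    obtain w where w: "w \<in> carrier (P (Suc k))" "mcong J (P k) (d k w) (x \<ominus>\<^bsub>P k\<^esub> g k (f k x))"
      using retract_hcycles[OF f f0 fd g g0 gd J x] by (auto simp: hbounds_def)
    have "mcong J (P k) (d k (w \<oplus>\<^bsub>P (Suc k)\<^esub> g (Suc k) v)) (d k w \<oplus>\<^bsub>P k\<^esub> d k (g (Suc k) v))"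
      by (intro PD.add w g.closed v)
    also have "mcong J (P k) \<dots> ((x \<ominus>\<^bsub>P k\<^esub> g k (f k x)) \<oplus>\<^bsub>P k\<^esub> g k (f k x))"
      by (intro f.M.mcong_add w 1)
    also have "(x \<ominus>\<^bsub>P k\<^esub> g k (f k x)) \<oplus>\<^bsub>P k\<^esub> g k (f k x) = x"
      by (intro P.M.M.diff_add_cancel xc g.closed f.closed)
    finally show ?thesis
      using w(1) g.closed[OF v(1)] by (auto simp: hbounds_def intro!: bexI[of _ "w \<oplus>\<^bsub>P (Suc k)\<^esub> g (Suc k) v"])
  qed
  have "\<exists>x\<in>hcycles J P d k. y \<ominus>\<^bsub>Q k\<^esub> f k x \<in> hbounds J Q d' k" if y: "y \<in> hcycles J Q d' k" for y
    using gcyc[OF y] QP.retract_hcycles[OF g g0 gd f f0 fd J y] by blast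
  then show ?thesis
    using f.f[of k] fcyc[of _ k] fbd bd by (intro exI[of _ "f k"] conjI ballI iffI) simp_all
qed

section \<open>Quotient modules\<close>

locale quotient_module = left_module R V + U: submodule U R V
  for R :: "('b, 'x) ring_scheme" (structure) and V :: "('b, 'm) module" and U
begin

sublocale abelian_subgroup U V
  by (intro abelian_subgroupI3 M.abelian_group_axioms)
    (use U.subgroup_axioms in \<open>simp add: additive_subgroup_def\<close>)

lemma quot_carrier: "carrier (quot V U) = (\<lambda>x. U +>\<^bsub>V\<^esub> x) ` carrier V"
  by (auto simp: quot_def ring.defs module.defs FactRing_def A_RCOSETS_def')

lemma quot_zero: "\<zero>\<^bsub>quot V U\<^esub> = U"
  by (simp add: quot_def ring.defs module.defs FactRing_def)

lemma quot_add:
  "\<lbrakk>x \<in> carrier V; y \<in> carrier V\<rbrakk> \<Longrightarrow>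
    (U +>\<^bsub>V\<^esub> x) \<oplus>\<^bsub>quot V U\<^esub> (U +>\<^bsub>V\<^esub> y) = U +>\<^bsub>V\<^esub> (x \<oplus>\<^bsub>V\<^esub> y)"
  by (simp add: quot_def ring.defs module.defs FactRing_def a_rcos_sum)

lemma coset_mem: "y \<in> U +>\<^bsub>V\<^esub> x \<longleftrightarrow> (\<exists>w\<in>U. y = w \<oplus>\<^bsub>V\<^esub> x)"
  by (auto simp: a_r_coset_def')

lemma coset_eqI:
  assumes "w \<in> U" "y \<in> carrier V"
  shows "U +>\<^bsub>V\<^esub> (w \<oplus>\<^bsub>V\<^esub> y) = U +>\<^bsub>V\<^esub> y"
  by (rule a_repr_independence'[symmetric]) (use assms in \<open>auto simp: coset_mem\<close>)

lemma coset_eq_iff: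
  assumes "x \<in> carrier V" "y \<in> carrier V"
  shows "U +>\<^bsub>V\<^esub> x = U +>\<^bsub>V\<^esub> y \<longleftrightarrow> (\<exists>w\<in>U. x = w \<oplus>\<^bsub>V\<^esub> y)"
proof
  assume "U +>\<^bsub>V\<^esub> x = U +>\<^bsub>V\<^esub> y"
  moreover have "x \<in> U +>\<^bsub>V\<^esub> x" by (rule a_rcos_self[OF assms(1)])
  ultimately show "\<exists>w\<in>U. x = w \<oplus>\<^bsub>V\<^esub> y" by (simp add: coset_mem)
next
  assume "\<exists>w\<in>U. x = w \<oplus>\<^bsub>V\<^esub> y"
  then show "U +>\<^bsub>V\<^esub> x = U +>\<^bsub>V\<^esub> y" using coset_eqI assms by auto
qed

lemma coset_eq_diff:
  assumes "x \<in> carrier V" "y \<in> carrier V"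
  shows "U +>\<^bsub>V\<^esub> x = U +>\<^bsub>V\<^esub> y \<longleftrightarrow> x \<ominus>\<^bsub>V\<^esub> y \<in> U"
proof
  assume "U +>\<^bsub>V\<^esub> x = U +>\<^bsub>V\<^esub> y"
  then obtain w where w: "w \<in> U" "x = w \<oplus>\<^bsub>V\<^esub> y" using coset_eq_iff assms by auto
  then have "x \<ominus>\<^bsub>V\<^esub> y = w"
    using assms by (simp add: M.minus_eq M.a_assoc M.r_neg)
  then show "x \<ominus>\<^bsub>V\<^esub> y \<in> U" using w by simp
next
  assume *: "x \<ominus>\<^bsub>V\<^esub> y \<in> U"
  show "U +>\<^bsub>V\<^esub> x = U +>\<^bsub>V\<^esub> y"
    using coset_eqI[OF * assms(2)] assms by (simp add: M.diff_add_cancel)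
qed

lemma coset_zero_iff: "x \<in> carrier V \<Longrightarrow> U +>\<^bsub>V\<^esub> x = U \<longleftrightarrow> x \<in> U"
  using coset_eq_diff[of x "\<zero>\<^bsub>V\<^esub>"] M.a_coset_add_zero[OF a_subset] by (simp add: M.diff_zero)

text \<open>All representatives of a coset give the same scaled coset, so the union in the
  definition of \<open>quot\<close> collapses.\<close>

lemma quot_smult:
  assumes "r \<in> carrier R" "x \<in> carrier V"
  shows "r \<odot>\<^bsub>quot V U\<^esub> (U +>\<^bsub>V\<^esub> x) = U +>\<^bsub>V\<^esub> (r \<odot>\<^bsub>V\<^esub> x)"
proof -
  have "U +>\<^bsub>V\<^esub> (r \<odot>\<^bsub>V\<^esub> (w \<oplus>\<^bsub>V\<^esub> x)) = U +>\<^bsub>V\<^esub> (r \<odot>\<^bsub>V\<^esub> x)" if "w \<in> U" for w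
    using that assms by (simp add: smult_r_distr coset_eqI smult_closed)
  moreover have "\<zero>\<^bsub>V\<^esub> \<in> U" by simp
  ultimately show ?thesis
    by (auto simp: quot_def ring.defs module.defs coset_mem a_r_coset_def')
qed

lemma left_module_quot: "left_module R (quot V U)"
proof -
  have "abelian_group (quot V U)"
  proof (rule abelian_groupI)
    fix X assume "X \<in> carrier (quot V U)"
    then obtain x where x: "x \<in> carrier V" "X = U +>\<^bsub>V\<^esub> x" by (auto simp: quot_carrier)
    have "(U +>\<^bsub>V\<^esub> (\<ominus>\<^bsub>V\<^esub> x)) \<oplus>\<^bsub>quot V U\<^esub> X = \<zero>\<^bsub>quot V U\<^esub>"
      using x by (simp add: quot_add M.l_neg quot_zero coset_zero_iff)
    then show "\<exists>Y\<in>carrier (quot V U). Y \<oplus>\<^bsub>quot V U\<^esub> X = \<zero>\<^bsub>quot V U\<^esub>"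
      using x by (intro bexI[of _ "U +>\<^bsub>V\<^esub> (\<ominus>\<^bsub>V\<^esub> x)"]) (auto simp: quot_carrier)
  next
    show "\<zero>\<^bsub>quot V U\<^esub> \<in> carrier (quot V U)"
      using M.a_coset_add_zero[OF a_subset] by (auto simp: quot_zero quot_carrier intro!: image_eqI[of _ _ "\<zero>\<^bsub>V\<^esub>"])
    fix X assume "X \<in> carrier (quot V U)"
    then obtain x where x: "x \<in> carrier V" "X = U +>\<^bsub>V\<^esub> x" by (auto simp: quot_carrier)
    show "\<zero>\<^bsub>quot V U\<^esub> \<oplus>\<^bsub>quot V U\<^esub> X = X"
      using quot_add[of "\<zero>\<^bsub>V\<^esub>" x] x M.a_coset_add_zero[OF a_subset] by (simp add: quot_zero)
  qed (auto simp: quot_carrier quot_add M.a_ac)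
  moreover have "left_module_axioms R (quot V U)"
    by standard (auto simp: quot_carrier quot_add quot_smult smult_closed smult_l_distr smult_r_distr
        smult_assoc smult_one)
  ultimately show ?thesis by (simp add: left_module_def R.ring_axioms)
qed

end

lemma quotient_moduleI: "left_module R V \<Longrightarrow> submodule U R V \<Longrightarrow> quotient_module R V U"
  by (simp add: quotient_module_def)

lemma submodule_submodule_span:
  assumes "left_module R V" "S \<subseteq> carrier V"
  shows "submodule (submodule_span R V S) R V" "S \<subseteq> submodule_span R V S"
    "submodule U R V \<Longrightarrow> S \<subseteq> U \<Longrightarrow> submodule_span R V S \<subseteq> U"
proof -
  interpret left_module R V by fact
  have "submodule (carrier V) R V" by (rule submodule_criterion) (auto simp: smult_closed)
  then have "submodule_span R V S \<subseteq> carrier V" using assms by (auto simp: submodule_span_def)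
  then show "submodule (submodule_span R V S) R V"
    by (rule submodule_criterion) (auto simp: submodule_span_def submoduleD)
qed (auto simp: submodule_span_def)

section \<open>Maps out of free modules\<close>

text \<open>The linear extension of v from the basis S. Values outside S are replaced by 0, because
  \<open>lincomb\<close> takes its vectors indexed by the whole type.\<close>

definition free_lift ::
  "('r, 'x) ring_scheme \<Rightarrow> ('r, 'v, 'y) module_scheme \<Rightarrow> 's set \<Rightarrow> ('s \<Rightarrow> 'v) \<Rightarrow> ('s \<Rightarrow> 'r) \<Rightarrow> 'v"
  where "free_lift R V S v z = lincomb R V z (\<lambda>s. if s \<in> S then v s else \<zero>\<^bsub>V\<^esub>)"

context left_module
begin

lemma free_module_fin_coeff: "z \<in> carrier (free_module R S) \<Longrightarrow> fin_coeff R z"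
  by (simp add: free_module_simps fin_coeff_def)

lemma free_lift_hom:
  assumes "\<And>s. s \<in> S \<Longrightarrow> v s \<in> carrier M"
  shows "free_lift R M S v \<in> mod_hom R (free_module R S) M"
  using assms free_module_fin_coeff unfolding mod_hom_def free_lift_def free_module_simps(2,3)
  by (auto intro!: lincomb_closed lincomb_add lincomb_smult)

lemma free_lift_basis_elem:
  assumes v: "\<And>s. s \<in> S \<Longrightarrow> v s \<in> carrier M" and s: "s \<in> S"
  shows "free_lift R M S v (basis_elem R s) = v s"
proof -
  have "free_lift R M S v (basis_elem R s) =
      (\<Oplus>\<^bsub>M\<^esub>t\<in>{s}. basis_elem R s t \<odot>\<^bsub>M\<^esub> (if t \<in> S then v t else \<zero>\<^bsub>M\<^esub>))"
    unfolding free_lift_def using v free_module_fin_coeff[OF R.basis_elem_closed[OF s]]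
    by (intro lincomb_eq) (auto simp: basis_elem_def)
  then show ?thesis using v s by (simp add: basis_elem_def smult_one)
qed

end

lemma (in ring) free_module_lincomb:
  assumes z: "z \<in> carrier (free_module R S)"
  shows "z = free_lift R (free_module R S) S (basis_elem R) z"
proof -
  let ?F = "free_module R S"
  interpret F: left_module R ?F by (rule left_module_free)
  have b: "basis_elem R s \<in> carrier ?F" if "s \<in> S" for s by (rule basis_elem_closed[OF that])
  have *: "finsum ?F (\<lambda>s. z s \<odot>\<^bsub>?F\<^esub> (if s \<in> S then basis_elem R s else \<zero>\<^bsub>?F\<^esub>)) A =
      (\<lambda>s. if s \<in> A then z s else \<zero>)" if "finite A" for A
    using that
  proof (induction A)
    case (insert t A)
    have "z t \<odot>\<^bsub>?F\<^esub> (if t \<in> S then basis_elem R t else \<zero>\<^bsub>?F\<^esub>) = (\<lambda>s. if s = t then z t else \<zero>)"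
      using z by (auto simp: free_module_simps basis_elem_def)
    moreover have "z s \<odot>\<^bsub>?F\<^esub> (if s \<in> S then basis_elem R s else \<zero>\<^bsub>?F\<^esub>) \<in> carrier ?F" for s
      using b z by (intro F.smult_closed) (simp_all add: free_module_simps(1,4))
    ultimately show ?case
      using insert z by (subst F.M.finsum_insert) (auto simp: free_module_simps(1,2))
  qed (auto simp: free_module_simps)
  show ?thesis
    unfolding free_lift_def lincomb_def using z by (subst *) (auto simp: free_module_simps)
qed

lemma free_module_hom_eq:
  assumes "left_module R V" and f: "f \<in> mod_hom R (free_module R S) V" and g: "g \<in> mod_hom R (free_module R S) V"
    and fg: "\<And>s. s \<in> S \<Longrightarrow> f (basis_elem R s) = g (basis_elem R s)"
    and z: "z \<in> carrier (free_module R S)"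
  shows "f z = g z"
proof -
  interpret V: left_module R V by fact
  have F: "left_module R (free_module R S)" by (rule V.R.left_module_free)
  interpret F: left_module R "free_module R S" by (rule F)
  let ?e = "\<lambda>s. if s \<in> S then basis_elem R s else \<zero>\<^bsub>free_module R S\<^esub>"
  have e: "?e s \<in> carrier (free_module R S)" for s by (simp add: V.R.basis_elem_closed)
  have z': "z = lincomb R (free_module R S) z ?e"
    using V.R.free_module_lincomb[OF z] by (simp add: free_lift_def)
  have *: "f z = lincomb R V z (\<lambda>s. f (?e s))" if "f \<in> mod_hom R (free_module R S) V" for f
  proof -
    interpret relhom_setup "{\<zero>\<^bsub>R\<^esub>}" R "free_module R S" V f
      using mod_hom_relhom[OF F assms(1) V.R.zeroideal that] by (intro relhom_setupI F assms(1) V.R.zeroideal)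
    show ?thesis
      using lincomb[OF V.free_module_fin_coeff[OF z], of ?e] e
      by (simp add: V.mcong_zero flip: z')
  qed
  have "f (?e s) = g (?e s)" for s
  proof (cases "s \<in> S")
    case False
    have 0: "f \<zero>\<^bsub>free_module R S\<^esub> = \<zero>\<^bsub>V\<^esub>" if f: "f \<in> mod_hom R (free_module R S) V" for f
      using mod_homD(3)[OF f, of "\<zero>\<^bsub>R\<^esub>" "\<zero>\<^bsub>free_module R S\<^esub>"] mod_homD(1)[OF f, of "\<zero>\<^bsub>free_module R S\<^esub>"]
      by (simp add: F.smult_l_zero V.smult_l_zero)
    then show ?thesis using False 0[OF f] 0[OF g] by simp
  qed (simp add: fg)
  then show ?thesis using *[OF f] *[OF g] by simp
qed

section \<open>Restriction of scalars\<close>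

definition restrict_scalars :: "('b \<Rightarrow> 'c) \<Rightarrow> ('c, 'm) module \<Rightarrow> ('b, 'm) module"
  where "restrict_scalars \<pi> M = \<lparr>carrier = carrier M, mult = undefined, one = undefined, zero = \<zero>\<^bsub>M\<^esub>,
    add = add M, smult = (\<lambda>b x. \<pi> b \<odot>\<^bsub>M\<^esub> x)\<rparr>"

lemma restrict_scalars_simps [simp]:
  "carrier (restrict_scalars \<pi> M) = carrier M" "\<zero>\<^bsub>restrict_scalars \<pi> M\<^esub> = \<zero>\<^bsub>M\<^esub>"
  "x \<oplus>\<^bsub>restrict_scalars \<pi> M\<^esub> y = x \<oplus>\<^bsub>M\<^esub> y" "b \<odot>\<^bsub>restrict_scalars \<pi> M\<^esub> x = \<pi> b \<odot>\<^bsub>M\<^esub> x"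
  by (simp_all add: restrict_scalars_def)

lemma restrict_scalars_minus: "x \<ominus>\<^bsub>restrict_scalars \<pi> M\<^esub> y = x \<ominus>\<^bsub>M\<^esub> y"
  by (simp add: a_minus_def a_inv_def m_inv_def restrict_scalars_def)

lemma finsum_restrict_scalars: "finsum (restrict_scalars \<pi> M) v F = finsum M v F"
  by (simp add: finsum_def finprod_def restrict_scalars_def)

text \<open>Two instances matter: the kernel of \<pi> spans zero on a pulled back module, so
  congruence modulo it is equality there; and the augmentation ideal of B spans the same as that of
  the quotient ring.\<close>

lemma ispan_restrict_scalars: "ispan J (restrict_scalars \<pi> M) = ispan (\<pi> ` J) M"
proof (intro antisym subsetI)
  fix x assume "x \<in> ispan J (restrict_scalars \<pi> M)"
  then show "x \<in> ispan (\<pi> ` J) M"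
    by (induction rule: ispan.induct) (auto intro: ispan.intros)
next
  fix x assume "x \<in> ispan (\<pi> ` J) M"
  then show "x \<in> ispan J (restrict_scalars \<pi> M)"
  proof (induction rule: ispan.induct)
    case zero
    then show ?case using ispan.zero[of "restrict_scalars \<pi> M" J] by simp
  next
    case (step a y x)
    then obtain b where "b \<in> J" "a = \<pi> b" by blast
    then show ?case using ispan.step[of b J y "restrict_scalars \<pi> M" x] step by simp
  qed
qed

lemma left_module_restrict_scalars:
  assumes \<pi>: "ring_hom_ring B B' \<pi>" and M: "left_module B' M"
  shows "left_module B (restrict_scalars \<pi> M)"
proof -
  interpret \<pi>: ring_hom_ring B B' \<pi> by fact
  interpret M: left_module B' M by fact
  have "abelian_group (restrict_scalars \<pi> M)"
  proof (rule abelian_groupI)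
    fix x assume "x \<in> carrier (restrict_scalars \<pi> M)"
    then show "\<exists>y\<in>carrier (restrict_scalars \<pi> M). y \<oplus>\<^bsub>restrict_scalars \<pi> M\<^esub> x = \<zero>\<^bsub>restrict_scalars \<pi> M\<^esub>"
      using M.M.l_neg[of x] M.M.a_inv_closed[of x] by auto
  qed (auto simp: M.M.a_ac)
  moreover have "left_module_axioms B (restrict_scalars \<pi> M)"
    by standard (auto simp: M.smult_closed M.smult_l_distr M.smult_r_distr M.smult_assoc M.smult_one)
  ultimately show ?thesis by (simp add: left_module_def \<pi>.R.ring_axioms)
qed

lemma mod_hom_restrict_scalars:
  assumes "ring_hom_ring B B' \<pi>" "f \<in> mod_hom B' M N"
  shows "f \<in> mod_hom B (restrict_scalars \<pi> M) (restrict_scalars \<pi> N)"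
proof -
  interpret \<pi>: ring_hom_ring B B' \<pi> by fact
  show ?thesis using assms(2) by (auto simp: mod_hom_def)
qed

section \<open>Tor with trivial coefficients\<close>

text \<open>N is the base ring R with B acting through the character \<chi>, and the same record
  serves as left and as right module. Additivity and multiplicativity of \<chi> follow from the
  module laws at the element 1 of R, so only closure and the values on scalars are listed.\<close>

locale trivial_coefficients = R: cring R + N: left_module B N
  for R :: "'r ring" and B :: "('r, 'b) module" and N :: "('b, 'r) module" +
  fixes \<chi> :: "'b \<Rightarrow> 'r"
  assumes unit_hom: "(\<lambda>r. r \<odot>\<^bsub>B\<^esub> \<one>\<^bsub>B\<^esub>) \<in> ring_hom R B"
    and unit_central: "\<lbrakk>r \<in> carrier R; b \<in> carrier B\<rbrakk> \<Longrightarrow>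
      (r \<odot>\<^bsub>B\<^esub> \<one>\<^bsub>B\<^esub>) \<otimes>\<^bsub>B\<^esub> b = b \<otimes>\<^bsub>B\<^esub> (r \<odot>\<^bsub>B\<^esub> \<one>\<^bsub>B\<^esub>)"
    and N_carrier: "carrier N = carrier R"
    and N_zero: "\<zero>\<^bsub>N\<^esub> = \<zero>\<^bsub>R\<^esub>"
    and N_add: "x \<oplus>\<^bsub>N\<^esub> y = x \<oplus>\<^bsub>R\<^esub> y"
    and N_smult: "\<lbrakk>b \<in> carrier B; s \<in> carrier R\<rbrakk> \<Longrightarrow> b \<odot>\<^bsub>N\<^esub> s = \<chi> b \<otimes>\<^bsub>R\<^esub> s"
    and \<chi>_closed: "b \<in> carrier B \<Longrightarrow> \<chi> b \<in> carrier R"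
    and \<chi>_unit: "r \<in> carrier R \<Longrightarrow> \<chi> (r \<odot>\<^bsub>B\<^esub> \<one>\<^bsub>B\<^esub>) = r"
begin

abbreviation unit :: "'r \<Rightarrow> 'b" where "unit r \<equiv> r \<odot>\<^bsub>B\<^esub> \<one>\<^bsub>B\<^esub>"

lemma unit_ring_hom: "ring_hom_ring R B unit"
  by (intro ring_hom_ringI2 unit_hom R.ring_axioms N.R.ring_axioms)

lemmas unit_closed = ring_hom_closed[OF unit_hom]
  and unit_mult = ring_hom_mult[OF unit_hom]
  and unit_add = ring_hom_add[OF unit_hom]
  and unit_one = ring_hom_one[OF unit_hom]

definition aug :: "'b set"
  where "aug = {b \<in> carrier B. \<chi> b = \<zero>\<^bsub>R\<^esub>}"

lemma \<chi>_add: "\<lbrakk>b \<in> carrier B; c \<in> carrier B\<rbrakk> \<Longrightarrow> \<chi> (b \<oplus>\<^bsub>B\<^esub> c) = \<chi> b \<oplus>\<^bsub>R\<^esub> \<chi> c"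
  using N.smult_l_distr[of b c "\<one>\<^bsub>R\<^esub>"] by (simp add: N_carrier N_add N_smult \<chi>_closed)

lemma \<chi>_mult: "\<lbrakk>b \<in> carrier B; c \<in> carrier B\<rbrakk> \<Longrightarrow> \<chi> (b \<otimes>\<^bsub>B\<^esub> c) = \<chi> b \<otimes>\<^bsub>R\<^esub> \<chi> c"
  using N.smult_assoc[of b c "\<one>\<^bsub>R\<^esub>"] by (simp add: N_carrier N_smult \<chi>_closed)

lemma \<chi>_ring_hom: "ring_hom_ring B R \<chi>"
proof (rule ring_hom_ringI2)
  have "\<chi> \<one>\<^bsub>B\<^esub> = \<one>\<^bsub>R\<^esub>" using \<chi>_unit[of "\<one>\<^bsub>R\<^esub>"] by (simp add: unit_one)
  then show "\<chi> \<in> ring_hom B R"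
    by (auto simp: ring_hom_def \<chi>_closed \<chi>_add \<chi>_mult)
qed (rule N.R.ring_axioms R.ring_axioms)+

lemma aug_ideal: "ideal aug B"
  using ring_hom_ring.kernel_is_ideal[OF \<chi>_ring_hom]
  by (simp add: aug_def a_kernel_def')

abbreviation scalar_mod :: "('b, 'p) module \<Rightarrow> ('r, 'p) module"
  where "scalar_mod \<equiv> restrict_scalars unit"

end

section \<open>The tensor product with the trivial module as the quotient by the augmentation
  ideal\<close>

locale trivial_tensor = trivial_coefficients R B N \<chi> + P: left_module B P
  for R :: "'r ring" and B :: "('r, 'b) module" and N :: "('b, 'r) module" and \<chi>
    and P :: "('b, 'p) module"
begin

abbreviation F where "F \<equiv> free_module R (carrier N \<times> carrier P)"
abbreviation K where "K \<equiv> tensor_kernel R B N P"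
abbreviation T where "T \<equiv> tensor R B N P"
abbreviation e where "e \<equiv> basis_elem R"

definition pure :: "'r \<Rightarrow> 'p \<Rightarrow> ('r \<times> 'p \<Rightarrow> 'r) set"
  where "pure s y = K +>\<^bsub>F\<^esub> e (s, y)"

definition \<iota> :: "'p \<Rightarrow> ('r \<times> 'p \<Rightarrow> 'r) set"
  where "\<iota> y = pure \<one>\<^bsub>R\<^esub> y"

text \<open>The inverse direction of \<iota>: the generator (s, y) goes to s y. It is defined on the
  free module, and it respects the tensor relations only modulo \<open>aug\<close> P.\<close>

definition \<theta> :: "('r \<times> 'p \<Rightarrow> 'r) \<Rightarrow> 'p"
  where "\<theta> = free_lift R (scalar_mod P) (carrier N \<times> carrier P) (\<lambda>(s, y). unit s \<odot>\<^bsub>P\<^esub> y)"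

sublocale F: left_module R F
  by (rule R.left_module_free)

sublocale S: left_module R "scalar_mod P"
  by (rule left_module_restrict_scalars[OF unit_ring_hom P.left_module_axioms])

lemma e_closed: "\<lbrakk>s \<in> carrier R; y \<in> carrier P\<rbrakk> \<Longrightarrow> e (s, y) \<in> carrier F"
  by (rule R.basis_elem_closed) (simp add: N_carrier)

lemma relators_closed: "tensor_relators R B N P \<subseteq> carrier F"
  unfolding tensor_relators_def Let_def
  by (auto intro!: F.M.minus_closed F.M.a_closed F.smult_closed P.smult_closed N.smult_closed
      R.basis_elem_closed unit_closed)

sublocale Q: quotient_module R F K
  unfolding tensor_kernel_def
  by (intro quotient_moduleI F.left_module_axioms submodule_submodule_span relators_closed)

sublocale T: left_module R T
  unfolding tensor_def by (rule Q.left_module_quot)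

lemma T_eq: "T = quot F K"
  by (simp add: tensor_def)

lemma relator_mem: "z \<in> tensor_relators R B N P \<Longrightarrow> z \<in> K"
  using submodule_submodule_span(2)[OF F.left_module_axioms relators_closed]
  by (auto simp: tensor_kernel_def)

lemma pure_closed: "\<lbrakk>s \<in> carrier R; y \<in> carrier P\<rbrakk> \<Longrightarrow> pure s y \<in> carrier T"
  unfolding pure_def T_eq by (simp add: Q.quot_carrier e_closed)

lemma pure_add_right:
  assumes "s \<in> carrier R" "y \<in> carrier P" "y' \<in> carrier P"
  shows "pure s (y \<oplus>\<^bsub>P\<^esub> y') = pure s y \<oplus>\<^bsub>T\<^esub> pure s y'"
proof -
  have "e (s, y \<oplus>\<^bsub>P\<^esub> y') \<ominus>\<^bsub>F\<^esub> (e (s, y) \<oplus>\<^bsub>F\<^esub> e (s, y')) \<in> K"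
    using assms
    by (intro relator_mem) (unfold tensor_relators_def Let_def N_carrier, blast)
  then show ?thesis
    unfolding pure_def T_eq using assms by (simp add: Q.quot_add e_closed Q.coset_eq_diff)
qed

lemma pure_balanced:
  assumes "s \<in> carrier R" "b \<in> carrier B" "y \<in> carrier P"
  shows "pure (\<chi> b \<otimes>\<^bsub>R\<^esub> s) y = pure s (b \<odot>\<^bsub>P\<^esub> y)"
proof -
  have "e (b \<odot>\<^bsub>N\<^esub> s, y) \<ominus>\<^bsub>F\<^esub> e (s, b \<odot>\<^bsub>P\<^esub> y) \<in> K"
    using assms
    by (intro relator_mem) (unfold tensor_relators_def Let_def N_carrier, blast)
  then show ?thesis
    unfolding pure_def using assms by (simp add: e_closed Q.coset_eq_diff N_smult \<chi>_closed P.smult_closed)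
qed

lemma pure_smult:
  assumes "s \<in> carrier R" "r \<in> carrier R" "y \<in> carrier P"
  shows "r \<odot>\<^bsub>T\<^esub> pure s y = pure (r \<otimes>\<^bsub>R\<^esub> s) y"
proof -
  have "(r \<odot>\<^bsub>F\<^esub> e (s, y)) \<ominus>\<^bsub>F\<^esub> e (unit r \<odot>\<^bsub>N\<^esub> s, y) \<in> K"
    using assms
    by (intro relator_mem) (unfold tensor_relators_def Let_def N_carrier, blast)
  then show ?thesis
    unfolding pure_def T_eq using assms
    by (simp add: e_closed Q.coset_eq_diff N_smult \<chi>_closed Q.quot_smult F.smult_closed \<chi>_unit unit_closed)
qed

lemma pure_eq_\<iota>:
  assumes "s \<in> carrier R" "y \<in> carrier P"
  shows "pure s y = \<iota> (unit s \<odot>\<^bsub>P\<^esub> y)"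
  using pure_balanced[of "\<one>\<^bsub>R\<^esub>" "unit s" y] assms by (simp add: \<iota>_def \<chi>_unit unit_closed)

lemma \<iota>_hom: "\<iota> \<in> mod_hom R (scalar_mod P) T"
  by (auto simp: mod_hom_def \<iota>_def pure_closed pure_add_right pure_smult pure_eq_\<iota>[unfolded \<iota>_def, symmetric])

lemma \<theta>_hom: "\<theta> \<in> mod_hom R F (scalar_mod P)"
  unfolding \<theta>_def by (rule S.free_lift_hom) (auto simp: N_carrier P.smult_closed unit_closed)

lemma \<theta>_basis_elem:
  "\<lbrakk>s \<in> carrier R; y \<in> carrier P\<rbrakk> \<Longrightarrow> \<theta> (e (s, y)) = unit s \<odot>\<^bsub>P\<^esub> y"
  unfolding \<theta>_def by (subst S.free_lift_basis_elem) (auto simp: N_carrier P.smult_closed unit_closed)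

lemma mod_hom_compose:
  "\<lbrakk>f \<in> mod_hom A L M; g \<in> mod_hom A M M'\<rbrakk> \<Longrightarrow> (\<lambda>x. g (f x)) \<in> mod_hom A L M'"
  by (auto simp: mod_hom_def Pi_iff)

text \<open>Both sides are R-linear in z, so it suffices to compare generators, where s tensor y
  equals 1 tensor s y. Thus every tensor is of the form \<iota> y.\<close>

lemma coset_eq_\<iota>:
  assumes "z \<in> carrier F" shows "K +>\<^bsub>F\<^esub> z = \<iota> (\<theta> z)"
proof (rule free_module_hom_eq[OF T.left_module_axioms _ _ _ assms])
  show "(\<lambda>z. K +>\<^bsub>F\<^esub> z) \<in> mod_hom R F T"
    by (auto simp: mod_hom_def T_eq Q.quot_carrier Q.quot_add Q.quot_smult)
  show "(\<lambda>z. \<iota> (\<theta> z)) \<in> mod_hom R F T"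
    by (rule mod_hom_compose[OF \<theta>_hom \<iota>_hom])
  show "K +>\<^bsub>F\<^esub> e p = \<iota> (\<theta> (e p))" if "p \<in> carrier N \<times> carrier P" for p
    using that pure_eq_\<iota> by (auto simp: N_carrier \<theta>_basis_elem pure_def)
qed

end

lemma mod_hom_diff:
  assumes "left_module B M" "left_module B N" "f \<in> mod_hom B M N" "x \<in> carrier M" "y \<in> carrier M"
  shows "f (x \<ominus>\<^bsub>M\<^esub> y) = f x \<ominus>\<^bsub>N\<^esub> f y"
proof -
  interpret M: left_module B M by fact
  interpret N: left_module B N by fact
  interpret relhom_setup "{\<zero>\<^bsub>B\<^esub>}" B M N f
    using mod_hom_relhom[OF assms(1,2) M.R.zeroideal assms(3)] assms(1,2)
    by (intro relhom_setupI M.R.zeroideal)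
  show ?thesis using diff[OF assms(4,5)] by (simp add: N.mcong_zero)
qed

lemma mod_hom_zero:
  assumes "left_module B M" "left_module B N" "f \<in> mod_hom B M N"
  shows "f \<zero>\<^bsub>M\<^esub> = \<zero>\<^bsub>N\<^esub>"
proof -
  interpret M: left_module B M by fact
  interpret N: left_module B N by fact
  show ?thesis
    using mod_homD(1)[OF assms(3), of "\<zero>\<^bsub>M\<^esub>"] mod_homD(3)[OF assms(3), of "\<zero>\<^bsub>B\<^esub>" "\<zero>\<^bsub>M\<^esub>"]
    by (simp add: M.smult_l_zero N.smult_l_zero)
qed

context trivial_tensor
begin

sublocale A: mod_ideal aug B P
  by (intro mod_idealI P.left_module_axioms aug_ideal)

text \<open>The relations for additivity and for scalars map to 0 exactly; only the balancing
  relation leaves a remainder, and that lies in \<open>aug\<close> P.\<close>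

lemma \<theta>_relator:
  assumes "z \<in> tensor_relators R B N P"
  shows "\<theta> z \<in> ispan aug P"
proof -
  have *: "\<theta> (z \<ominus>\<^bsub>F\<^esub> z') \<in> ispan aug P"
    if "z \<in> carrier F" "z' \<in> carrier F" "mcong aug P (\<theta> z) (\<theta> z')" for z z'
    using that mod_hom_diff[OF F.left_module_axioms S.left_module_axioms \<theta>_hom that(1,2)]
    by (simp add: mcong_def restrict_scalars_minus)
  note \<theta> = mod_homD[OF \<theta>_hom, simplified]
  have central: "unit s \<odot>\<^bsub>P\<^esub> (b \<odot>\<^bsub>P\<^esub> y) = b \<odot>\<^bsub>P\<^esub> (unit s \<odot>\<^bsub>P\<^esub> y)"
    if "s \<in> carrier R" "b \<in> carrier B" "y \<in> carrier P" for s b y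
    using that by (simp add: unit_central unit_closed flip: P.smult_assoc)
  \<comment> \<open>The remainder is \<chi> b - b, read in B through \<open>unit\<close>, acting on
    s y. Its value under \<chi> is 0. Centrality of scalars moves s past b.\<close>
  have bal: "mcong aug P (unit (\<chi> b \<otimes>\<^bsub>R\<^esub> s) \<odot>\<^bsub>P\<^esub> y) (unit s \<odot>\<^bsub>P\<^esub> (b \<odot>\<^bsub>P\<^esub> y))"
    if "s \<in> carrier R" "b \<in> carrier B" "y \<in> carrier P" for s b y
  proof -
    interpret \<chi>: ring_hom_ring B R \<chi> by (rule \<chi>_ring_hom)
    have "\<chi> (unit (\<chi> b) \<ominus>\<^bsub>B\<^esub> b) = \<zero>\<^bsub>R\<^esub>"
      using that by (simp add: a_minus_def \<chi>_add unit_closed \<chi>_closed \<chi>_unit R.r_neg)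
    then have "unit (\<chi> b) \<ominus>\<^bsub>B\<^esub> b \<in> aug"
      unfolding aug_def using that by (simp add: unit_closed \<chi>_closed)
    then have "mcong aug P (unit (\<chi> b) \<odot>\<^bsub>P\<^esub> (unit s \<odot>\<^bsub>P\<^esub> y))
        (b \<odot>\<^bsub>P\<^esub> (unit s \<odot>\<^bsub>P\<^esub> y))"
      using that by (intro A.mcong_smult_left) (simp_all add: unit_closed \<chi>_closed P.smult_closed)
    then show ?thesis
      unfolding central[OF that] using that
      by (simp add: unit_mult unit_closed \<chi>_closed P.smult_assoc)
  qed
  from assms consider
      (1) x x' y where "x \<in> carrier R" "x' \<in> carrier R" "y \<in> carrier P"
        "z = e (x \<oplus>\<^bsub>R\<^esub> x', y) \<ominus>\<^bsub>F\<^esub> (e (x, y) \<oplus>\<^bsub>F\<^esub> e (x', y))"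
    | (2) x y y' where "x \<in> carrier R" "y \<in> carrier P" "y' \<in> carrier P"
        "z = e (x, y \<oplus>\<^bsub>P\<^esub> y') \<ominus>\<^bsub>F\<^esub> (e (x, y) \<oplus>\<^bsub>F\<^esub> e (x, y'))"
    | (3) b x y where "b \<in> carrier B" "x \<in> carrier R" "y \<in> carrier P"
        "z = e (\<chi> b \<otimes>\<^bsub>R\<^esub> x, y) \<ominus>\<^bsub>F\<^esub> e (x, b \<odot>\<^bsub>P\<^esub> y)"
    | (4) r x y where "r \<in> carrier R" "x \<in> carrier R" "y \<in> carrier P"
        "z = (r \<odot>\<^bsub>F\<^esub> e (x, y)) \<ominus>\<^bsub>F\<^esub> e (r \<otimes>\<^bsub>R\<^esub> x, y)"
    unfolding tensor_relators_def Let_def N_carrier Un_iff mem_Collect_eq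
    by (elim disjE exE conjE) (simp_all add: N_add N_smult unit_closed \<chi>_unit)
  then show ?thesis
  proof cases
    case 1
    then show ?thesis
      by (auto intro!: * A.mcong_refl simp: e_closed \<theta> \<theta>_basis_elem unit_add unit_closed
          P.smult_l_distr P.smult_closed)
  next
    case 2
    then show ?thesis
      by (auto intro!: * A.mcong_refl simp: e_closed \<theta> \<theta>_basis_elem unit_closed
          P.smult_r_distr P.smult_closed)
  next
    case 3
    then show ?thesis
      by (auto intro!: * bal simp: e_closed \<theta>_basis_elem unit_closed P.smult_closed \<chi>_closed)
  next
    case 4
    then show ?thesis
      by (auto intro!: * A.mcong_refl simp: e_closed \<theta> \<theta>_basis_elem unit_closed unit_mult
          P.smult_assoc P.smult_closed F.smult_closed)
  qed
qed

lemma \<theta>_kernel: "z \<in> K \<Longrightarrow> \<theta> z \<in> ispan aug P"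
proof -
  note \<theta> = mod_homD[OF \<theta>_hom, simplified]
  have "submodule {z \<in> carrier F. \<theta> z \<in> ispan aug P} R F"
    by (rule F.submodule_criterion)
      (auto simp: \<theta> mod_hom_zero[OF F.left_module_axioms S.left_module_axioms \<theta>_hom, simplified]
        ispan.zero A.ispan_add A.ispan_smult unit_closed F.smult_closed)
  then have "K \<subseteq> {z \<in> carrier F. \<theta> z \<in> ispan aug P}"
    unfolding tensor_kernel_def using relators_closed \<theta>_relator
    by (intro submodule_submodule_span(3)[OF F.left_module_axioms relators_closed]) auto
  then show "z \<in> K \<Longrightarrow> \<theta> z \<in> ispan aug P" by auto
qed

text \<open>For b in the augmentation ideal, 1 tensor b y equals \<chi> b tensor y, that is 0 tensor
  y, which is the scalar 0 times a pure tensor.\<close>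

lemma \<iota>_ispan:
  assumes "x \<in> ispan aug P" shows "\<iota> x = \<zero>\<^bsub>T\<^esub>"
  using assms
proof (induction rule: ispan.induct)
  case zero
  then show ?case
    using mod_hom_zero[OF S.left_module_axioms T.left_module_axioms \<iota>_hom] by simp
next
  case (step b y x)
  have b: "b \<in> carrier B" "\<chi> b = \<zero>\<^bsub>R\<^esub>" using step(1) unfolding aug_def by simp_all
  have "pure \<zero>\<^bsub>R\<^esub> y = \<zero>\<^bsub>T\<^esub>"
    using pure_smult[of "\<one>\<^bsub>R\<^esub>" "\<zero>\<^bsub>R\<^esub>" y] step(2) by (simp add: T.smult_l_zero pure_closed)
  then have "\<iota> (b \<odot>\<^bsub>P\<^esub> y) = \<zero>\<^bsub>T\<^esub>"
    using pure_balanced[of "\<one>\<^bsub>R\<^esub>" b y] step(2) b by (simp add: \<iota>_def)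
  then show ?case
    using mod_homD(2)[OF \<iota>_hom, of "b \<odot>\<^bsub>P\<^esub> y" x] step b A.ispan_carrier by (simp add: P.smult_closed)
qed

text \<open>Together with surjectivity of \<iota> this identifies the tensor product with P /
  \<open>aug\<close> P. From here on Tor is computed in P itself.\<close>

lemma \<iota>_eq_iff:
  assumes y: "y \<in> carrier P" "y' \<in> carrier P"
  shows "\<iota> y = \<iota> y' \<longleftrightarrow> mcong aug P y y'"
proof
  assume "\<iota> y = \<iota> y'"
  then have "e (\<one>\<^bsub>R\<^esub>, y) \<ominus>\<^bsub>F\<^esub> e (\<one>\<^bsub>R\<^esub>, y') \<in> K"
    using y by (simp add: \<iota>_def pure_def Q.coset_eq_diff e_closed)
  from \<theta>_kernel[OF this] show "mcong aug P y y'"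
    using y mod_hom_diff[OF F.left_module_axioms S.left_module_axioms \<theta>_hom, of "e (\<one>\<^bsub>R\<^esub>, y)" "e (\<one>\<^bsub>R\<^esub>, y')"]
    by (simp add: \<theta>_basis_elem e_closed unit_one P.smult_one mcong_def restrict_scalars_minus)
next
  assume "mcong aug P y y'"
  then have "\<iota> (y \<ominus>\<^bsub>P\<^esub> y') = \<zero>\<^bsub>T\<^esub>" unfolding mcong_def by (intro \<iota>_ispan) simp
  moreover have "\<iota> (y \<ominus>\<^bsub>P\<^esub> y') = \<iota> y \<ominus>\<^bsub>T\<^esub> \<iota> y'"
    using mod_hom_diff[OF S.left_module_axioms T.left_module_axioms \<iota>_hom, of y y'] y
    by (simp only: restrict_scalars_minus restrict_scalars_simps)
  moreover have "\<iota> y \<in> carrier T" "\<iota> y' \<in> carrier T"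
    using mod_homD(1)[OF \<iota>_hom] y by (simp_all only: restrict_scalars_simps)
  ultimately show "\<iota> y = \<iota> y'"
    using T.M.diff_eq_zero_iff[of "\<iota> y" "\<iota> y'"] by (simp only:)
qed

lemma T_carrier: "carrier T = \<iota> ` carrier P"
  unfolding T_eq Q.quot_carrier
proof (intro antisym subsetI; elim imageE)
  fix X z assume "X = K +>\<^bsub>F\<^esub> z" "z \<in> carrier F"
  then show "X \<in> \<iota> ` carrier P"
    using coset_eq_\<iota> mod_homD(1)[OF \<theta>_hom] by auto
next
  fix X y assume "X = \<iota> y" "y \<in> carrier P"
  then show "X \<in> (\<lambda>z. K +>\<^bsub>F\<^esub> z) ` carrier F"
    by (auto simp: \<iota>_def pure_def e_closed)
qed

end

section \<open>Functoriality of the tensor product\<close>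

lemma free_moduleD:
  assumes "z \<in> carrier (free_module R S)"
  shows "z s \<in> carrier R" "s \<notin> S \<Longrightarrow> z s = \<zero>\<^bsub>R\<^esub>" "finite {s. z s \<noteq> \<zero>\<^bsub>R\<^esub>}"
  using assms unfolding free_module_simps(1) by blast+

context cring
begin

text \<open>The sum over the support in a fibre of f may be taken over any finite part of the fibre
  containing it. This gives two vectors a common index set when their images are added.\<close>

lemma push_snd_eq:
  assumes z: "\<And>p. z p \<in> carrier R" and G: "finite G" "{y. z (x, y) \<noteq> \<zero> \<and> f y = y'} \<subseteq> G" "\<And>y. y \<in> G \<Longrightarrow> f y = y'"
  shows "push_snd R f z (x, y') = (\<Oplus>y\<in>G. z (x, y))"
  unfolding push_snd_def prod.case
proof (rule add.finprod_mono_neutral_cong_left)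
  show "z (x, y) = \<zero>" if "y \<in> G - {y. z (x, y) \<noteq> \<zero> \<and> f y = y'}" for y
    using that G(3) by blast
qed (use G z in \<open>simp_all add: Pi_iff\<close>)

lemma push_snd_hom:
  fixes f :: "'y \<Rightarrow> 'z" and X :: "'w set"
  assumes f: "f \<in> Y \<rightarrow> Y'"
  shows "push_snd R f \<in> mod_hom R (free_module R (X \<times> Y)) (free_module R (X \<times> Y'))"
proof -
  let ?F = "free_module R (X \<times> Y)" and ?F' = "free_module R (X \<times> Y')"
  have fin: "finite {y. z (x, y) \<noteq> \<zero> \<and> f y = y'}" if "finite {p. z p \<noteq> \<zero>}" for z :: "'w \<times> 'y \<Rightarrow> 'a" and x y'
    by (rule finite_subset[of _ "snd ` {p. z p \<noteq> \<zero>}"]) (use that in force)+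
  have "push_snd R f z \<in> carrier ?F'" if z: "z \<in> carrier ?F" for z
  proof -
    have zc: "z p \<in> carrier R" "p \<notin> X \<times> Y \<Longrightarrow> z p = \<zero>" and zf: "finite {p. z p \<noteq> \<zero>}" for p
      using free_moduleD[OF z] by blast+
    have empty: "push_snd R f z (x, y') = \<zero>" if "{y. z (x, y) \<noteq> \<zero> \<and> f y = y'} = {}" for x y'
      unfolding push_snd_def prod.case that by simp
    have "push_snd R f z p = \<zero>" if "p \<notin> (\<lambda>(x, y). (x, f y)) ` {p. z p \<noteq> \<zero>}" for p
    proof -
      obtain x y' where p: "p = (x, y')" by (cases p)
      have "{y. z (x, y) \<noteq> \<zero> \<and> f y = y'} = {}" using that by (force simp: p)
      then show ?thesis using empty p by simp
    qed
    \<comment> \<open>A nonzero coefficient needs a nonempty fibre, so the support of the image lies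
      in the image of the support, which is finite.\<close>
    then have "{p. push_snd R f z p \<noteq> \<zero>} \<subseteq> (\<lambda>(x, y). (x, f y)) ` {p. z p \<noteq> \<zero>}"
      by auto
    moreover have "(\<lambda>(x, y). (x, f y)) ` {p. z p \<noteq> \<zero>} \<subseteq> X \<times> Y'"
    proof (intro subsetI, elim imageE)
      fix q p assume q: "q = (case p of (x, y) \<Rightarrow> (x, f y))" and "p \<in> {p. z p \<noteq> \<zero>}"
      then have "p \<in> X \<times> Y" using zc(2) by blast
      then show "q \<in> X \<times> Y'" using f q by auto
    qed
    moreover have "push_snd R f z p \<in> carrier R" for p
      unfolding push_snd_def by (cases p) (simp add: finsum_closed Pi_iff zc(1))
    ultimately show ?thesis
      unfolding free_module_simps(1) using zf by (meson finite_imageI finite_subset mem_Collect_eq subsetD)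
  qed
  moreover have "push_snd R f (\<lambda>p. z p \<oplus> z' p) p = push_snd R f z p \<oplus> push_snd R f z' p"
    if "z \<in> carrier ?F" "z' \<in> carrier ?F" for z z' p
  proof -
    obtain x y' where p: "p = (x, y')" by (cases p)
    let ?G = "{y. z (x, y) \<noteq> \<zero> \<and> f y = y'} \<union> {y. z' (x, y) \<noteq> \<zero> \<and> f y = y'}"
    have c: "\<And>p. z p \<in> carrier R" "\<And>p. z' p \<in> carrier R" and G: "finite ?G"
      using fin[OF free_moduleD(3)[OF that(1)]] fin[OF free_moduleD(3)[OF that(2)]]
        free_moduleD(1)[OF that(1)] free_moduleD(1)[OF that(2)] by blast+
    have "push_snd R f (\<lambda>p. z p \<oplus> z' p) (x, y') = (\<Oplus>y\<in>?G. z (x, y) \<oplus> z' (x, y))"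
      using c G by (intro push_snd_eq) auto
    also have "\<dots> = (\<Oplus>y\<in>?G. z (x, y)) \<oplus> (\<Oplus>y\<in>?G. z' (x, y))"
      using c by (intro finsum_addf) auto
    also have "(\<Oplus>y\<in>?G. z (x, y)) = push_snd R f z (x, y')"
      using c G by (intro push_snd_eq[symmetric]) auto
    also have "(\<Oplus>y\<in>?G. z' (x, y)) = push_snd R f z' (x, y')"
      using c G by (intro push_snd_eq[symmetric]) auto
    finally show ?thesis by (simp add: p)
  qed
  moreover have "push_snd R f (\<lambda>p. r \<otimes> z p) p = r \<otimes> push_snd R f z p"
    if "z \<in> carrier ?F" "r \<in> carrier R" for z r p
  proof -
    obtain x y' where p: "p = (x, y')" by (cases p)
    let ?G = "{y. z (x, y) \<noteq> \<zero> \<and> f y = y'}"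
    have c: "\<And>p. z p \<in> carrier R" and G: "finite ?G"
      using fin[OF free_moduleD(3)[OF that(1)]] free_moduleD(1)[OF that(1)] by blast+
    have "push_snd R f (\<lambda>p. r \<otimes> z p) (x, y') = (\<Oplus>y\<in>?G. r \<otimes> z (x, y))"
      using c G that by (intro push_snd_eq) auto
    also have "\<dots> = r \<otimes> push_snd R f z (x, y')"
      unfolding push_snd_def prod.case using c G that by (intro finsum_rdistr[symmetric]) auto
    finally show ?thesis by (simp add: p)
  qed
  ultimately show ?thesis
    unfolding mod_hom_def free_module_simps(2,3) by blast
qed

lemma push_snd_basis_elem:
  fixes f :: "'y \<Rightarrow> 'z" and s :: 'w
  shows "push_snd R f (basis_elem R (s, y)) = basis_elem R (s, f y)"
proof
  fix p :: "'w \<times> 'z"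
  obtain x y' where p: "p = (x, y')" by (cases p)
  have "push_snd R f (basis_elem R (s, y)) (x, y') =
      (\<Oplus>t\<in>(if f y = y' then {y} else {}). basis_elem R (s, y) (x, t))"
    by (rule push_snd_eq) (auto simp: basis_elem_def split: if_splits)
  then show "push_snd R f (basis_elem R (s, y)) p = basis_elem R (s, f y) p"
    by (auto simp: p basis_elem_def)
qed

end

text \<open>Under the identification with the quotients by \<open>aug\<close>, the map induced by f
  on tensor products is the reduction of f.\<close>

lemma (in trivial_coefficients) tensor_map_\<iota>:
  assumes P: "left_module B P" "left_module B P'" and f: "f \<in> mod_hom B P P'" and y: "y \<in> carrier P"
  shows "tensor_map R B N P' f (trivial_tensor.\<iota> R B N P y) = trivial_tensor.\<iota> R B N P' (f y)"
proof -
  interpret P: trivial_tensor R B N \<chi> P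
    by (simp add: trivial_tensor_def trivial_coefficients_axioms P)
  interpret P': trivial_tensor R B N \<chi> P'
    by (simp add: trivial_tensor_def trivial_coefficients_axioms P)
  have push: "push_snd R f \<in> mod_hom R P.F P'.F"
    using mod_homD(1)[OF f] by (intro R.push_snd_hom) auto
  have fS: "f \<in> mod_hom R (scalar_mod P) (scalar_mod P')"
    using f unit_closed by (auto simp: mod_hom_def)
  have \<theta>: "P'.\<theta> (push_snd R f z) = f (P.\<theta> z)" if "z \<in> carrier P.F" for z
  proof (rule free_module_hom_eq[OF P'.S.left_module_axioms _ _ _ that])
    show "(\<lambda>z. P'.\<theta> (push_snd R f z)) \<in> mod_hom R P.F (scalar_mod P')"
      by (rule P.mod_hom_compose[OF push P'.\<theta>_hom])
    show "(\<lambda>z. f (P.\<theta> z)) \<in> mod_hom R P.F (scalar_mod P')"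
      by (rule P.mod_hom_compose[OF P.\<theta>_hom fS])
    show "P'.\<theta> (push_snd R f (basis_elem R p)) = f (P.\<theta> (basis_elem R p))" if "p \<in> carrier N \<times> carrier P" for p
      using that mod_homD[OF f]
      by (auto simp: N_carrier R.push_snd_basis_elem P.\<theta>_basis_elem P'.\<theta>_basis_elem unit_closed)
  qed
  interpret f: relhom_setup aug B P P' f
    by (intro relhom_setupI P aug_ideal mod_hom_relhom f)
  have Xy: "P.\<iota> y = P.K +>\<^bsub>P.F\<^esub> P.e (\<one>\<^bsub>R\<^esub>, y)"
    by (simp add: P.\<iota>_def P.pure_def)
  have e: "P.e (\<one>\<^bsub>R\<^esub>, y) \<in> carrier P.F" using y by (simp add: P.e_closed)
  \<comment> \<open>The definition takes the union over all representatives z of the tensor. Such a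
    z satisfies that \<theta> z is congruent to y modulo \<open>aug\<close> P, a congruence that f
    preserves; hence all contribute the same coset.\<close>
  have "P'.K +>\<^bsub>P'.F\<^esub> push_snd R f z = P'.\<iota> (f y)" if z: "z \<in> P.\<iota> y" for z
  proof -
    have zF: "z \<in> carrier P.F"
      using z e P.Q.a_Hcarr unfolding Xy P.Q.coset_mem by auto
    have \<theta>z: "P.\<theta> z \<in> carrier P" using mod_homD(1)[OF P.\<theta>_hom zF] by simp
    have "P.\<iota> y = P.K +>\<^bsub>P.F\<^esub> z"
      using z unfolding Xy by (rule P.Q.a_repr_independence'[OF _ e])
    also have "\<dots> = P.\<iota> (P.\<theta> z)"
      by (rule P.coset_eq_\<iota>[OF zF])
    finally have "mcong aug P y (P.\<theta> z)"
      using P.\<iota>_eq_iff[OF y \<theta>z] by simp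
    then have "mcong aug P' (f y) (f (P.\<theta> z))" by (rule f.cong)
    then have "P'.\<iota> (f y) = P'.\<iota> (f (P.\<theta> z))"
      using P'.\<iota>_eq_iff y \<theta>z f.closed by simp
    then show ?thesis
      using P'.coset_eq_\<iota>[OF mod_homD(1)[OF push zF]] \<theta>[OF zF] by simp
  qed
  moreover have "P.e (\<one>\<^bsub>R\<^esub>, y) \<in> P.\<iota> y"
    unfolding Xy by (rule P.Q.a_rcos_self[OF e])
  ultimately show ?thesis
    unfolding tensor_map_def by blast
qed

section \<open>Tor as cycles modulo boundaries of the reduced complex\<close>

lemma submodule_hcycles:
  assumes J: "ideal J B" and P: "\<And>k. left_module B (P k)" and d: "\<And>k. d k \<in> mod_hom B (P (Suc k)) (P k)"
  shows "submodule (hcycles J P d k) B (P k)"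
proof -
  interpret M: mod_ideal J B "P i" for i by (intro mod_idealI P J)
  have "d j x \<in> ispan J (P j)" if "x \<in> hcycles J P d k" "k = Suc j" for x j
    using that by (simp add: hcycles_def)
  then show ?thesis
    using mod_homD(2,3)[OF d] mod_hom_zero[OF P P d]
    by (intro left_module.submodule_criterion[OF P])
      (auto simp: hcycles_def M.ispan_add M.ispan_smult ispan.zero M.smult_closed)
qed

text \<open>The map \<kappa> sends a cycle to its homology class. Its properties describe Tor by
  elements of P alone, so that neither tensors nor cosets of cosets occur in the comparison.\<close>

lemma (in trivial_coefficients) Tor_classes:
  assumes P: "\<And>k. left_module B (P k)" and d: "\<And>k. d k \<in> mod_hom B (P (Suc k)) (P k)"
    and dd: "\<And>k x. x \<in> carrier (P (Suc (Suc k))) \<Longrightarrow> d k (d (Suc k) x) = \<zero>\<^bsub>P k\<^esub>"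
  obtains \<kappa> where
    "carrier (Tor R B N P d k) = \<kappa> ` hcycles aug P d k"
    "\<And>x y. \<lbrakk>x \<in> hcycles aug P d k; y \<in> hcycles aug P d k\<rbrakk> \<Longrightarrow>
      \<kappa> (x \<oplus>\<^bsub>P k\<^esub> y) = \<kappa> x \<oplus>\<^bsub>Tor R B N P d k\<^esub> \<kappa> y"
    "\<And>r x. \<lbrakk>r \<in> carrier R; x \<in> hcycles aug P d k\<rbrakk> \<Longrightarrow>
      \<kappa> (unit r \<odot>\<^bsub>P k\<^esub> x) = r \<odot>\<^bsub>Tor R B N P d k\<^esub> \<kappa> x"
    "\<And>x y. \<lbrakk>x \<in> hcycles aug P d k; y \<in> hcycles aug P d k\<rbrakk> \<Longrightarrow>
      \<kappa> x = \<kappa> y \<longleftrightarrow> x \<ominus>\<^bsub>P k\<^esub> y \<in> hbounds aug P d k"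
proof -
  interpret t: trivial_tensor R B N \<chi> "P i" for i
    by (simp add: trivial_tensor_def trivial_coefficients_axioms P)
  interpret d: relhom_setup aug B "P (Suc i)" "P i" "d i" for i
    by (intro relhom_setupI P aug_ideal mod_hom_relhom d)
  define C where "C = (\<lambda>k. tensor R B N (P k))"
  define D where "D = (\<lambda>k. tensor_map R B N (P k) (d k))"
  define \<iota> where "\<iota> = (\<lambda>k. trivial_tensor.\<iota> R B N (P k))"
  have C: "left_module R (C i)" for i unfolding C_def by (rule t.T.left_module_axioms)
  have C_carrier: "carrier (C i) = \<iota> i ` carrier (P i)" for i
    unfolding C_def \<iota>_def by (rule t.T_carrier)
  have D: "D i (\<iota> (Suc i) x) = \<iota> i (d i x)" if "x \<in> carrier (P (Suc i))" for i x
    unfolding D_def \<iota>_def by (rule tensor_map_\<iota>[OF P P d that])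
  have \<iota>: "\<iota> i \<in> mod_hom R (scalar_mod (P i)) (C i)" for i
    unfolding \<iota>_def C_def by (rule t.\<iota>_hom)
  note \<iota>_closed = mod_homD(1)[OF \<iota>, simplified] and \<iota>_add = mod_homD(2)[OF \<iota>, simplified]
    and \<iota>_smult = mod_homD(3)[OF \<iota>, simplified]
  have \<iota>_zero: "\<iota> i \<zero>\<^bsub>P i\<^esub> = \<zero>\<^bsub>C i\<^esub>" for i
    using mod_hom_zero[OF t.S.left_module_axioms C \<iota>] by simp
  have \<iota>_eq: "\<iota> i x = \<iota> i y \<longleftrightarrow> mcong aug (P i) x y" if "x \<in> carrier (P i)" "y \<in> carrier (P i)" for i x y
    unfolding \<iota>_def by (rule t.\<iota>_eq_iff[OF that])
  have hc: "x \<in> carrier (P k)" if "x \<in> hcycles aug P d k" for x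
    using hcyclesD(1)[OF that] .
  let ?Z = "\<iota> k ` hcycles aug P d k" and ?U = "D k ` carrier (C (Suc k))"
  have cycles: "cycles C D k = ?Z"
  proof (cases k)
    case 0
    then show ?thesis by (simp add: C_carrier hcycles_def)
  next
    case (Suc j)
    have "D j (\<iota> (Suc j) x) = \<zero>\<^bsub>C j\<^esub> \<longleftrightarrow> d j x \<in> ispan aug (P j)" if "x \<in> carrier (P (Suc j))" for x
      using that \<iota>_eq[of "d j x" j "\<zero>\<^bsub>P j\<^esub>"]
      by (simp add: D \<iota>_zero t.A.mcong_zero_iff d.closed)
    then show ?thesis
      unfolding Suc cycles.simps C_carrier hcycles_def by auto
  qed
  have U: "?U = (\<lambda>w. \<iota> k (d k w)) ` carrier (P (Suc k))"
    using D by (auto simp: C_carrier image_image)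
  note sub = submoduleD[OF submodule_hcycles[where P = P and d = d and k = k, OF aug_ideal P d]]
  have scaled: "unit r \<odot>\<^bsub>P k\<^esub> x \<in> hcycles aug P d k" if "r \<in> carrier R" "x \<in> hcycles aug P d k" for r x
    using that by (intro sub unit_closed)
  have summed: "x \<oplus>\<^bsub>P k\<^esub> y \<in> hcycles aug P d k" if "x \<in> hcycles aug P d k" "y \<in> hcycles aug P d k" for x y
    using that by (intro sub)
  have zero: "\<zero>\<^bsub>P k\<^esub> \<in> hcycles aug P d k"
    by (rule sub)
  have bound: "d k w \<in> hcycles aug P d k" if "w \<in> carrier (P (Suc k))" for w
  proof -
    have "d j (d (Suc j) w) \<in> ispan aug (P j)" if "k = Suc j" for j
      using \<open>w \<in> _\<close> that by (simp add: dd ispan.zero)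
    then show ?thesis using d.closed[OF that] by (auto simp: hcycles_def)
  qed
  have Z: "submodule ?Z R (C k)"
  proof (rule left_module.submodule_criterion[OF C])
    show "?Z \<subseteq> carrier (C k)" using hc C_carrier by auto
    show "\<zero>\<^bsub>C k\<^esub> \<in> ?Z" using zero \<iota>_zero by force
    show "X \<oplus>\<^bsub>C k\<^esub> Y \<in> ?Z" if "X \<in> ?Z" "Y \<in> ?Z" for X Y
      using that summed hc \<iota>_add by (auto simp flip: \<iota>_add)
    show "r \<odot>\<^bsub>C k\<^esub> X \<in> ?Z" if "r \<in> carrier R" "X \<in> ?Z" for r X
      using that scaled hc by (auto simp flip: \<iota>_smult)
  qed
  let ?V = "(C k)\<lparr>carrier := ?Z\<rparr>"
  have V: "left_module R ?V" by (rule left_module_restrict[OF C Z])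
  have "submodule ?U R ?V"
  proof (rule left_module.submodule_criterion[OF V])
    show "?U \<subseteq> carrier ?V" using bound by (auto simp: U)
    show "\<zero>\<^bsub>?V\<^esub> \<in> ?U"
      using \<iota>_zero mod_hom_zero[OF P P d] t.P.M.zero_closed by (auto simp: U intro!: image_eqI[of _ _ "\<zero>\<^bsub>P (Suc k)\<^esub>"])
    show "X \<oplus>\<^bsub>?V\<^esub> Y \<in> ?U" if "X \<in> ?U" "Y \<in> ?U" for X Y
    proof -
      obtain w w' where w: "w \<in> carrier (P (Suc k))" "X = \<iota> k (d k w)"
        "w' \<in> carrier (P (Suc k))" "Y = \<iota> k (d k w')"
        using \<open>X \<in> ?U\<close> \<open>Y \<in> ?U\<close> unfolding U by blast
      then have "X \<oplus>\<^bsub>?V\<^esub> Y = \<iota> k (d k (w \<oplus>\<^bsub>P (Suc k)\<^esub> w'))"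
        using mod_homD(2)[OF d, of w k w'] \<iota>_add[of "d k w" k "d k w'"] d.closed by simp
      then show ?thesis using w unfolding U by (auto intro!: imageI)
    qed
    show "r \<odot>\<^bsub>?V\<^esub> X \<in> ?U" if "r \<in> carrier R" "X \<in> ?U" for r X
    proof -
      obtain w where w: "w \<in> carrier (P (Suc k))" "X = \<iota> k (d k w)"
        using \<open>X \<in> ?U\<close> unfolding U by blast
      then have "r \<odot>\<^bsub>?V\<^esub> X = \<iota> k (d k (unit r \<odot>\<^bsub>P (Suc k)\<^esub> w))"
        using that(1) mod_homD(3)[OF d, of "unit r" w k] \<iota>_smult[of r "d k w" k] d.closed unit_closed
        by simp
      then show ?thesis
        using w that(1) unfolding U by (auto intro!: imageI t.P.smult_closed unit_closed)
    qed
  qed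
  then interpret H: quotient_module R ?V ?U
    by (intro quotient_moduleI V)
  have Tor: "Tor R B N P d k = quot ?V ?U"
    by (simp add: Tor_def homology_def C_def D_def flip: cycles)
  define \<kappa> where "\<kappa> = (\<lambda>x. ?U +>\<^bsub>?V\<^esub> \<iota> k x)"
  show ?thesis
  proof (rule that[of \<kappa>])
    show "carrier (Tor R B N P d k) = \<kappa> ` hcycles aug P d k"
      unfolding Tor H.quot_carrier by (auto simp: \<kappa>_def)
    show "\<kappa> (x \<oplus>\<^bsub>P k\<^esub> y) = \<kappa> x \<oplus>\<^bsub>Tor R B N P d k\<^esub> \<kappa> y"
      if "x \<in> hcycles aug P d k" "y \<in> hcycles aug P d k" for x y
      unfolding Tor \<kappa>_def using that H.quot_add[of "\<iota> k x" "\<iota> k y"] hc by (simp add: \<iota>_add)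
    show "\<kappa> (unit r \<odot>\<^bsub>P k\<^esub> x) = r \<odot>\<^bsub>Tor R B N P d k\<^esub> \<kappa> x"
      if "r \<in> carrier R" "x \<in> hcycles aug P d k" for r x
      unfolding Tor \<kappa>_def using that H.quot_smult[of r "\<iota> k x"] hc by (simp add: \<iota>_smult)
    show "\<kappa> x = \<kappa> y \<longleftrightarrow> x \<ominus>\<^bsub>P k\<^esub> y \<in> hbounds aug P d k"
      if "x \<in> hcycles aug P d k" "y \<in> hcycles aug P d k" for x y
    proof -
      have xy: "x \<in> carrier (P k)" "y \<in> carrier (P k)" using that hc by auto
      have "\<kappa> x = \<kappa> y \<longleftrightarrow> (\<exists>w\<in>carrier (P (Suc k)). \<iota> k x = \<iota> k (d k w \<oplus>\<^bsub>P k\<^esub> y))"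
        unfolding \<kappa>_def using that H.coset_eq_iff[of "\<iota> k x" "\<iota> k y"] xy
        by (simp add: U \<iota>_add d.closed)
      also have "\<dots> \<longleftrightarrow> (\<exists>w\<in>carrier (P (Suc k)). mcong aug (P k) (d k w) (x \<ominus>\<^bsub>P k\<^esub> y))"
      proof (intro bex_cong refl)
        fix w assume w: "w \<in> carrier (P (Suc k))"
        have "\<iota> k x = \<iota> k (d k w \<oplus>\<^bsub>P k\<^esub> y) \<longleftrightarrow> mcong aug (P k) x (d k w \<oplus>\<^bsub>P k\<^esub> y)"
          using xy d.closed[OF w] by (intro \<iota>_eq) simp_all
        also have "\<dots> \<longleftrightarrow> mcong aug (P k) (d k w) (x \<ominus>\<^bsub>P k\<^esub> y)"
        proof
          assume *: "mcong aug (P k) x (d k w \<oplus>\<^bsub>P k\<^esub> y)"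
          have "mcong aug (P k) (x \<ominus>\<^bsub>P k\<^esub> y) ((d k w \<oplus>\<^bsub>P k\<^esub> y) \<ominus>\<^bsub>P k\<^esub> y)"
            by (intro t.A.mcong_diff * t.A.mcong_refl xy)
          moreover have "(d k w \<oplus>\<^bsub>P k\<^esub> y) \<ominus>\<^bsub>P k\<^esub> y = d k w"
            using xy d.closed[OF w] by (simp add: a_minus_def t.P.M.a_assoc t.P.M.r_neg)
          ultimately show "mcong aug (P k) (d k w) (x \<ominus>\<^bsub>P k\<^esub> y)"
            by (simp add: t.A.mcong_sym)
        next
          assume *: "mcong aug (P k) (d k w) (x \<ominus>\<^bsub>P k\<^esub> y)"
          have "mcong aug (P k) (d k w \<oplus>\<^bsub>P k\<^esub> y) ((x \<ominus>\<^bsub>P k\<^esub> y) \<oplus>\<^bsub>P k\<^esub> y)"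
            by (intro t.A.mcong_add * t.A.mcong_refl xy)
          then show "mcong aug (P k) x (d k w \<oplus>\<^bsub>P k\<^esub> y)"
            unfolding t.P.M.diff_add_cancel[OF xy] by (rule t.A.mcong_sym)
        qed
        finally show "\<iota> k x = \<iota> k (d k w \<oplus>\<^bsub>P k\<^esub> y) \<longleftrightarrow> mcong aug (P k) (d k w) (x \<ominus>\<^bsub>P k\<^esub> y)" .
      qed
      finally show ?thesis by (simp add: hbounds_def)
    qed
  qed
qed

text \<open>Two surjections from Z with the same fibres identify their targets. Sums and scalar
  multiples need only be witnessed by some element of Z, so Z carries no module structure of its
  own.\<close>

lemma mod_isomorphic_of_surjections:
  assumes T: "carrier T = \<kappa> ` Z" and T': "carrier T' = \<phi> ` Z"
    and eq: "\<And>x y. \<lbrakk>x \<in> Z; y \<in> Z\<rbrakk> \<Longrightarrow> \<kappa> x = \<kappa> y \<longleftrightarrow> \<phi> x = \<phi> y"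
    and add: "\<And>x y. \<lbrakk>x \<in> Z; y \<in> Z\<rbrakk> \<Longrightarrow>
      \<exists>z\<in>Z. \<kappa> z = \<kappa> x \<oplus>\<^bsub>T\<^esub> \<kappa> y \<and> \<phi> z = \<phi> x \<oplus>\<^bsub>T'\<^esub> \<phi> y"
    and smult: "\<And>r x. \<lbrakk>r \<in> carrier R; x \<in> Z\<rbrakk> \<Longrightarrow>
      \<exists>z\<in>Z. \<kappa> z = r \<odot>\<^bsub>T\<^esub> \<kappa> x \<and> \<phi> z = r \<odot>\<^bsub>T'\<^esub> \<phi> x"
  shows "mod_isomorphic R T T'"
proof -
  define F where "F X = \<phi> (SOME x. x \<in> Z \<and> \<kappa> x = X)" for X
  have F: "F (\<kappa> x) = \<phi> x" if "x \<in> Z" for x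
  proof -
    have "(SOME y. y \<in> Z \<and> \<kappa> y = \<kappa> x) \<in> Z \<and> \<kappa> (SOME y. y \<in> Z \<and> \<kappa> y = \<kappa> x) = \<kappa> x"
      by (rule someI[of _ x]) (use that in simp)
    then show ?thesis unfolding F_def using eq that by blast
  qed
  have "F \<in> mod_hom R T T'"
    unfolding mod_hom_def
  proof (intro CollectI conjI ballI funcsetI)
    show "F X \<in> carrier T'" if "X \<in> carrier T" for X
      using that F by (auto simp: T T')
    show "F (X \<oplus>\<^bsub>T\<^esub> Y) = F X \<oplus>\<^bsub>T'\<^esub> F Y" if "X \<in> carrier T" "Y \<in> carrier T" for X Y
    proof -
      obtain x y where "x \<in> Z" "X = \<kappa> x" "y \<in> Z" "Y = \<kappa> y"
        using \<open>X \<in> carrier T\<close> \<open>Y \<in> carrier T\<close> unfolding T by blast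
      moreover from this obtain z where "z \<in> Z" "\<kappa> z = X \<oplus>\<^bsub>T\<^esub> Y" "\<phi> z = \<phi> x \<oplus>\<^bsub>T'\<^esub> \<phi> y"
        using add by blast
      ultimately show ?thesis using F by metis
    qed
    show "F (r \<odot>\<^bsub>T\<^esub> X) = r \<odot>\<^bsub>T'\<^esub> F X" if "r \<in> carrier R" "X \<in> carrier T" for r X
    proof -
      obtain x where "x \<in> Z" "X = \<kappa> x" using \<open>X \<in> carrier T\<close> unfolding T by blast
      moreover from this obtain z where "z \<in> Z" "\<kappa> z = r \<odot>\<^bsub>T\<^esub> X" "\<phi> z = r \<odot>\<^bsub>T'\<^esub> \<phi> x"
        using smult \<open>r \<in> carrier R\<close> by blast
      ultimately show ?thesis using F by metis
    qed
  qed
  moreover have "bij_betw F (carrier T) (carrier T')"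
    using F eq by (force simp: bij_betw_def inj_on_def T T' image_image)
  ultimately show ?thesis by (auto simp: mod_isomorphic_def)
qed

section \<open>Comparison over a quotient by an idempotent ideal\<close>

text \<open>The coordinates in B' are lifted to B through a set-theoretic section of \<pi>. Such a
  section is additive and multiplicative only modulo the kernel, and so are the lifted coordinates;
  the generators and the expansion stay as they were, since B acts through \<pi>.\<close>

lemma dual_basis_restrict_scalars:
  assumes \<pi>: "ring_hom_ring B B' \<pi>" and surj: "\<pi> ` carrier B = carrier B'" and M: "left_module B' M"
    and db: "dual_basis B' {\<zero>\<^bsub>B'\<^esub>} M u h"
  obtains h' where "dual_basis B {b \<in> carrier B. \<pi> b = \<zero>\<^bsub>B'\<^esub>} (restrict_scalars \<pi> M) u h'"
proof -
  interpret \<pi>: ring_hom_ring B B' \<pi> by fact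
  interpret M: left_module B' M by fact
  note db = dual_basisD[OF db]
  \<comment> \<open>The section must send 0 to 0, for otherwise the lifted coordinates could lose
    their finite support.\<close>
  have "\<exists>b. b \<in> carrier B \<and> \<pi> b = b' \<and> (b' = \<zero>\<^bsub>B'\<^esub> \<longrightarrow> b = \<zero>\<^bsub>B\<^esub>)" if b': "b' \<in> carrier B'" for b'
  proof (cases "b' = \<zero>\<^bsub>B'\<^esub>")
    case False
    have "b' \<in> \<pi> ` carrier B" using b' surj by simp
    then obtain b where "b \<in> carrier B" "b' = \<pi> b" by (rule imageE)
    then show ?thesis using False by (intro exI[of _ b]) simp
  next
    case True
    then show ?thesis by (intro exI[of _ "\<zero>\<^bsub>B\<^esub>"]) simp
  qed
  then have "\<forall>b'\<in>carrier B'. \<exists>b. b \<in> carrier B \<and> \<pi> b = b' \<and> (b' = \<zero>\<^bsub>B'\<^esub> \<longrightarrow> b = \<zero>\<^bsub>B\<^esub>)"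
    by (intro ballI)
  from bchoice[OF this] obtain s where
    s': "\<forall>b'\<in>carrier B'. s b' \<in> carrier B \<and> \<pi> (s b') = b' \<and> (b' = \<zero>\<^bsub>B'\<^esub> \<longrightarrow> s b' = \<zero>\<^bsub>B\<^esub>)" by (rule exE)
  have s: "s b' \<in> carrier B" "\<pi> (s b') = b'" if "b' \<in> carrier B'" for b'
    using bspec[OF s' that] by blast+
  have s0: "s \<zero>\<^bsub>B'\<^esub> = \<zero>\<^bsub>B\<^esub>"
    using bspec[OF s' \<pi>.S.zero_closed] by simp
  define h' where "h' = (\<lambda>y j. s (h y j))"
  have hc: "h y j \<in> carrier B'" if "y \<in> carrier M" for y j
    using db(2)[OF that] by (simp add: fin_coeff_def)
  have supp: "{j. h' y j \<noteq> \<zero>\<^bsub>B\<^esub>} = {j. h y j \<noteq> \<zero>\<^bsub>B'\<^esub>}" if "y \<in> carrier M" for y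
  proof (intro Collect_cong arg_cong[of _ _ Not] iffI)
    show "h y j = \<zero>\<^bsub>B'\<^esub>" if 0: "h' y j = \<zero>\<^bsub>B\<^esub>" for j
      using s(2)[OF hc[OF \<open>y \<in> carrier M\<close>], of j] unfolding 0[unfolded h'_def] \<pi>.hom_zero by (rule sym)
    show "h' y j = \<zero>\<^bsub>B\<^esub>" if 0: "h y j = \<zero>\<^bsub>B'\<^esub>" for j
      unfolding h'_def 0 by (rule s0)
  qed
  have fin: "fin_coeff B (h' y)" if "y \<in> carrier M" for y
    using db(2)[OF that] s(1)[OF hc[OF that]] unfolding fin_coeff_def supp[OF that] by (simp add: h'_def)
  have "lincomb B (restrict_scalars \<pi> M) (h' y) u = y" if "y \<in> carrier M" for y
  proof -
    have "\<pi> (h' y j) = h y j" for j unfolding h'_def by (rule s(2)[OF hc[OF that]])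
    then show ?thesis
      using db(3)[OF that] by (simp add: lincomb_def finsum_restrict_scalars supp[OF that])
  qed
  moreover have "h' (y \<oplus>\<^bsub>M\<^esub> z) j \<ominus>\<^bsub>B\<^esub> (h' y j \<oplus>\<^bsub>B\<^esub> h' z j) \<in> {b \<in> carrier B. \<pi> b = \<zero>\<^bsub>B'\<^esub>}"
    if "y \<in> carrier M" "z \<in> carrier M" for y z j
  proof -
    note c = hc[OF that(1), of j] hc[OF that(2), of j] hc[OF M.M.a_closed[OF that], of j]
    show ?thesis
      using db(4)[OF that, of j] by (simp add: h'_def a_minus_def s c)
  qed
  moreover have "h' (\<pi> b \<odot>\<^bsub>M\<^esub> y) j \<ominus>\<^bsub>B\<^esub> (b \<otimes>\<^bsub>B\<^esub> h' y j) \<in> {b \<in> carrier B. \<pi> b = \<zero>\<^bsub>B'\<^esub>}"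
    if "b \<in> carrier B" "y \<in> carrier M" for b y j
  proof -
    note b = \<pi>.hom_closed[OF that(1)]
    note c = hc[OF that(2), of j] hc[OF M.smult_closed[OF b that(2)], of j]
    show ?thesis
      using db(5)[OF b that(2), of j] that(1) by (simp add: h'_def a_minus_def s c)
  qed
  ultimately have "dual_basis B {b \<in> carrier B. \<pi> b = \<zero>\<^bsub>B'\<^esub>} (restrict_scalars \<pi> M) u h'"
    using fin db(1) unfolding dual_basis_def by simp
  then show ?thesis by (rule that)
qed

text \<open>Exactness of P / I P: if d x lies in I P, exactness of I P provides y in I P with d y =
  d x. Then x - y is a cycle of P and therefore a boundary, and it is congruent to x.\<close>

lemma (in reduction) rel_resolution: "rel_resolution I B N P d \<eta> u h"
proof (rule rel_resolution.intro; (rule is_ideal)?; rule rel_resolution_axioms.intro;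
    (rule N P d \<eta> \<eta>_surj dd \<eta>d; assumption?)?)
  interpret M: mod_ideal I B "P i" for i by (rule mod_idealI[OF P is_ideal])
  show "dual_basis B I (P k) (u k) (h k)" for k
    using db by (rule dual_basis_mono) simp
  have "s = \<zero>\<^bsub>N\<^esub>" if "s \<in> ispan I N" for s
    using that
  proof (induction rule: ispan.induct)
    case (step a y x)
    interpret N: left_module B N by (rule N)
    show ?case using step by (simp add: I_N)
  qed simp
  then show "\<exists>w\<in>carrier (P 1). mcong I (P 0) (d 0 w) x" if "x \<in> carrier (P 0)" "\<eta> x \<in> ispan I N" for x
    using that exact0[of x] M.mcong_refl by metis
  show "\<exists>w\<in>carrier (P (Suc (Suc k))). mcong I (P (Suc k)) (d (Suc k) w) x"
    if x: "x \<in> carrier (P (Suc k))" "d k x \<in> ispan I (P k)" for x k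
  proof -
    \<comment> \<open>In degree 0 every element of I P bounds; in higher degrees d (d x) = 0 makes d
      x a cycle of I P.\<close>
    obtain y where y: "y \<in> ispan I (P (Suc k))" "d k y = d k x"
    proof (cases k)
      case 0
      then show ?thesis using span_exact0[of "d k x"] x that by auto
    next
      case (Suc j)
      then show ?thesis using span_exactS[of "d k x" j] dd[of x j] x that by auto
    qed
    have yc: "y \<in> carrier (P (Suc k))" using y(1) by (rule M.ispan_carrier)
    have dx: "d k x \<in> carrier (P k)" by (rule mod_homD(1)[OF d x(1)])
    have "d k (x \<ominus>\<^bsub>P (Suc k)\<^esub> y) = \<zero>\<^bsub>P k\<^esub>"
      using mod_hom_diff[OF P P d x(1) yc] y(2) M.M.diff_self[OF dx] by simp
    then obtain w where w: "w \<in> carrier (P (Suc (Suc k)))" "d (Suc k) w = x \<ominus>\<^bsub>P (Suc k)\<^esub> y"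
      using exactS[of "x \<ominus>\<^bsub>P (Suc k)\<^esub> y" k] x(1) yc by auto
    have "mcong I (P (Suc k)) (x \<ominus>\<^bsub>P (Suc k)\<^esub> y) (x \<ominus>\<^bsub>P (Suc k)\<^esub> \<zero>\<^bsub>P (Suc k)\<^esub>)"
      using y(1) x(1) by (intro M.mcong_diff M.mcong_refl M.mcong_zero_iff[THEN iffD2])
    then show ?thesis using w x(1) by (intro bexI[of _ w]) (simp_all add: M.M.diff_zero)
  qed
qed

locale idempotent_quotient =
  B: trivial_coefficients R B N \<chi> + B': trivial_coefficients R B' N \<chi>' + \<pi>: ring_hom_ring B B' \<pi> +
  I: idempotent_ideal I B T e \<sigma>
  for R :: "'r ring" and B B' :: "('r, 'b) module" and N :: "('b, 'r) module" and \<chi> \<chi>' \<pi>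
    and I :: "'b set" and T :: "'t set" and e \<sigma> +
  assumes I_eq: "I = {b \<in> carrier B. \<pi> b = \<zero>\<^bsub>B'\<^esub>}"
    and \<pi>_surj: "\<pi> ` carrier B = carrier B'"
    and \<pi>_unit: "r \<in> carrier R \<Longrightarrow> \<pi> (r \<odot>\<^bsub>B\<^esub> \<one>\<^bsub>B\<^esub>) = r \<odot>\<^bsub>B'\<^esub> \<one>\<^bsub>B'\<^esub>"
    and \<pi>_N: "\<lbrakk>b \<in> carrier B; s \<in> carrier N\<rbrakk> \<Longrightarrow> \<pi> b \<odot>\<^bsub>N\<^esub> s = b \<odot>\<^bsub>N\<^esub> s"
begin

lemma I_memD: "b \<in> I \<Longrightarrow> b \<in> carrier B" "b \<in> I \<Longrightarrow> \<pi> b = \<zero>\<^bsub>B'\<^esub>"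
  using I_eq by blast+

lemma \<chi>_\<pi>: "b \<in> carrier B \<Longrightarrow> \<chi>' (\<pi> b) = \<chi> b"
  using \<pi>_N[of b "\<one>\<^bsub>R\<^esub>"] by (simp add: B.N_carrier B.N_smult B'.N_smult B.\<chi>_closed B'.\<chi>_closed)

text \<open>I maps to 0 in \<open>B'\<close>, so \<chi> vanishes on it. Hence P / \<open>aug\<close>
  P depends only on P / I P, and a comparison modulo I suffices for Tor.\<close>

lemma I_aug: "I \<subseteq> B.aug"
proof
  fix b assume b: "b \<in> I"
  have "\<chi>' \<zero>\<^bsub>B'\<^esub> = \<zero>\<^bsub>R\<^esub>"
  proof -
    interpret \<chi>': ring_hom_ring B' R \<chi>' by (rule B'.\<chi>_ring_hom)
    show ?thesis by (rule \<chi>'.hom_zero)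
  qed
  then show "b \<in> B.aug" unfolding B.aug_def using I_memD[OF b] \<chi>_\<pi>[of b] by simp
qed

lemma \<pi>_aug: "\<pi> ` B.aug = B'.aug"
proof (intro antisym subsetI)
  fix c assume c: "c \<in> B'.aug"
  then have "c \<in> \<pi> ` carrier B" using \<pi>_surj unfolding B'.aug_def by blast
  then obtain b where b: "b \<in> carrier B" "c = \<pi> b" by (rule imageE)
  then have "b \<in> B.aug" using c \<chi>_\<pi>[OF b(1)] unfolding B.aug_def B'.aug_def by simp
  then show "c \<in> \<pi> ` B.aug" using b(2) by blast
next
  fix c assume "c \<in> \<pi> ` B.aug"
  then obtain b where b: "b \<in> B.aug" "c = \<pi> b" by (rule imageE)
  then show "c \<in> B'.aug" using \<chi>_\<pi>[of b] \<pi>.hom_closed[of b] unfolding B.aug_def B'.aug_def by simp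
qed

lemma I_N: "\<lbrakk>b \<in> I; s \<in> carrier N\<rbrakk> \<Longrightarrow> b \<odot>\<^bsub>N\<^esub> s = \<zero>\<^bsub>N\<^esub>"
  using \<pi>_N[of b s] B'.N.smult_l_zero[of s] I_memD[of b] by simp

lemma ispan_I_N: "ispan I N = {\<zero>\<^bsub>N\<^esub>}"
proof -
  have "s = \<zero>\<^bsub>N\<^esub>" if "s \<in> ispan I N" for s
    using that by (induction rule: ispan.induct) (use I_N in auto)
  then show ?thesis by (auto intro: ispan.zero)
qed

lemma ispan_I_restrict:
  assumes "left_module B' M"
  shows "ispan I (restrict_scalars \<pi> M) = {\<zero>\<^bsub>M\<^esub>}"
proof -
  interpret left_module B' M by fact
  have "\<pi> ` I = {\<zero>\<^bsub>B'\<^esub>}"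
    using I_memD(2) \<pi>.hom_zero[symmetric] additive_subgroup.zero_closed[OF I.additive_subgroup_axioms] by blast
  then show ?thesis by (simp only: ispan_restrict_scalars ispan_zero)
qed

lemma resolution_rel_resolution:
  fixes P :: "nat \<Rightarrow> ('b, 'p) module"
  assumes "projective_resolution B N P d \<eta>"
  shows "\<exists>(u :: nat \<Rightarrow> 'p \<Rightarrow> 'p) h. rel_resolution I B N P d \<eta> u h"
proof -
  have "\<forall>k. \<exists>(u :: 'p \<Rightarrow> 'p) h. dual_basis B {\<zero>\<^bsub>B\<^esub>} (P k) u h"
  proof
    fix k
    have "projective B (P k)" using assms by (simp add: projective_resolution_def)
    then obtain u :: "'p \<Rightarrow> 'p" and h where "dual_basis B {\<zero>\<^bsub>B\<^esub>} (P k) u h"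
      by (rule projective_dual_basis)
    then show "\<exists>(u :: 'p \<Rightarrow> 'p) h. dual_basis B {\<zero>\<^bsub>B\<^esub>} (P k) u h" by blast
  qed
  then obtain u :: "nat \<Rightarrow> 'p \<Rightarrow> 'p" and h where uh: "\<And>k. dual_basis B {\<zero>\<^bsub>B\<^esub>} (P k) (u k) (h k)"
    by metis
  have "reduction I B T e \<sigma> N P d \<eta> u h"
    using uh I_N
    by (intro reduction.intro I.idempotent_ideal_axioms projective_resolution_resolution[OF assms]
        reduction_axioms.intro)
  then show ?thesis using reduction.rel_resolution by blast
qed

text \<open>I acts as zero on the pulled back modules, so exactness modulo I is ordinary exactness
  of Q; the dual bases over \<open>B'\<close> lift to B modulo I.\<close>

lemma restricted_rel_resolution:
  fixes Q :: "nat \<Rightarrow> ('b, 'q) module"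
  assumes "projective_resolution B' N Q d \<eta>"
  shows "\<exists>(u :: nat \<Rightarrow> 'q \<Rightarrow> 'q) h. rel_resolution I B N (\<lambda>k. restrict_scalars \<pi> (Q k)) d \<eta> u h"
proof -
  interpret Q: resolution B' N Q d \<eta> by (rule projective_resolution_resolution[OF assms])
  let ?Q = "\<lambda>k. restrict_scalars \<pi> (Q k)"
  have "\<forall>k. \<exists>(u :: 'q \<Rightarrow> 'q) h. dual_basis B' {\<zero>\<^bsub>B'\<^esub>} (Q k) u h"
  proof
    fix k
    have "projective B' (Q k)" using assms by (simp add: projective_resolution_def)
    then obtain u :: "'q \<Rightarrow> 'q" and h where "dual_basis B' {\<zero>\<^bsub>B'\<^esub>} (Q k) u h"
      by (rule projective_dual_basis)
    then show "\<exists>(u :: 'q \<Rightarrow> 'q) h. dual_basis B' {\<zero>\<^bsub>B'\<^esub>} (Q k) u h" by blast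
  qed
  then obtain u :: "nat \<Rightarrow> 'q \<Rightarrow> 'q" and h' where uh': "\<And>k. dual_basis B' {\<zero>\<^bsub>B'\<^esub>} (Q k) (u k) (h' k)"
    by metis
  have "\<forall>k. \<exists>h. dual_basis B I (?Q k) (u k) h"
  proof
    fix k
    show "\<exists>h. dual_basis B I (?Q k) (u k) h"
      by (rule dual_basis_restrict_scalars[OF \<pi>.ring_hom_ring_axioms \<pi>_surj Q.P uh'[of k]])
        (unfold I_eq, rule exI)
  qed
  from choice[OF this] obtain h where uh: "\<And>k. dual_basis B I (?Q k) (u k) (h k)" by blast
  have Q: "left_module B (?Q k)" for k
    by (rule left_module_restrict_scalars[OF \<pi>.ring_hom_ring_axioms Q.P])
  interpret M: mod_ideal I B "?Q i" for i by (rule mod_idealI[OF Q I.is_ideal])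
  have "rel_resolution I B N ?Q d \<eta> u h"
  proof (rule rel_resolution.intro[OF I.is_ideal rel_resolution_axioms.intro])
    show "left_module B N" by (rule B.N.left_module_axioms)
    show "left_module B (?Q k)" for k by (rule Q)
    show "d k \<in> mod_hom B (?Q (Suc k)) (?Q k)" for k
      by (rule mod_hom_restrict_scalars[OF \<pi>.ring_hom_ring_axioms Q.d])
    show "\<eta> \<in> mod_hom B (?Q 0) N"
      using Q.\<eta> by (auto simp: mod_hom_def \<pi>_N Pi_iff)
    show "dual_basis B I (?Q k) (u k) (h k)" for k by (rule uh)
    show "\<exists>x\<in>carrier (?Q 0). \<eta> x = s" if "s \<in> carrier N" for s
      using Q.\<eta>_surj[OF that] by simp
    show "d k (d (Suc k) x) = \<zero>\<^bsub>?Q k\<^esub>" if "x \<in> carrier (?Q (Suc (Suc k)))" for x k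
      using Q.dd[of x k] that by simp
    show "\<eta> (d 0 x) = \<zero>\<^bsub>N\<^esub>" if "x \<in> carrier (?Q 1)" for x
      using Q.\<eta>d[of x] that by simp
    show "\<exists>w\<in>carrier (?Q 1). mcong I (?Q 0) (d 0 w) x"
      if x: "x \<in> carrier (?Q 0)" "\<eta> x \<in> ispan I N" for x
    proof -
      obtain w where "w \<in> carrier (Q 1)" "d 0 w = x"
        using x Q.exact0[of x] unfolding ispan_I_N by auto
      then show ?thesis using M.mcong_refl[of x 0] x(1) by (intro bexI[of _ w]) simp_all
    qed
    show "\<exists>w\<in>carrier (?Q (Suc (Suc k))). mcong I (?Q (Suc k)) (d (Suc k) w) x"
      if x: "x \<in> carrier (?Q (Suc k))" "d k x \<in> ispan I (?Q k)" for x k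
    proof -
      obtain w where "w \<in> carrier (Q (Suc (Suc k)))" "d (Suc k) w = x"
        using x Q.exactS[of x k] unfolding ispan_I_restrict[OF Q.P] by auto
      then show ?thesis using M.mcong_refl[of x "Suc k"] x(1) by (intro bexI[of _ w]) simp_all
    qed
  qed
  then show ?thesis by blast
qed

text \<open>Over B both complexes are resolutions modulo I, and Tor on either side is the homology
  of the reduction modulo the augmentation ideal. The comparison map f and the two class maps
  \<kappa> and \<open>\<kappa>'\<close> combine to surjections from the cycles of P with equal
  fibres.\<close>

theorem Tor_isomorphic:
  fixes P :: "nat \<Rightarrow> ('b, 'p) module" and Q :: "nat \<Rightarrow> ('b, 'q) module"
  assumes P: "projective_resolution B N P d \<eta>" and Q: "projective_resolution B' N Q d' \<eta>'"
  shows "mod_isomorphic R (Tor R B N P d k) (Tor R B' N Q d' k)"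
proof -
  let ?Q = "\<lambda>k. restrict_scalars \<pi> (Q k)"
  obtain u :: "nat \<Rightarrow> 'p \<Rightarrow> 'p" and h where "rel_resolution I B N P d \<eta> u h"
    using resolution_rel_resolution[OF P] by blast
  moreover obtain u' :: "nat \<Rightarrow> 'q \<Rightarrow> 'q" and h' where "rel_resolution I B N ?Q d' \<eta>' u' h'"
    using restricted_rel_resolution[OF Q] by blast
  ultimately interpret PQ: rel_resolution_pair I B N P d \<eta> u h ?Q d' \<eta>' u' h'
    by (simp add: rel_resolution_pair_def)
  interpret Qr: resolution B' N Q d' \<eta>' by (rule projective_resolution_resolution[OF Q])
  let ?J = "B.aug" and ?J' = "B'.aug" and ?T = "Tor R B N P d k" and ?T' = "Tor R B' N Q d' k"
  let ?Z = "hcycles ?J P d k" and ?Z' = "hcycles ?J' Q d' k"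
    and ?D = "hbounds ?J P d k" and ?D' = "hbounds ?J' Q d' k"
  \<comment> \<open>The projection maps the augmentation ideal of B onto that of \<open>B'\<close>,
    so reducing Q over B or over \<open>B'\<close> gives the same submodules.\<close>
  have span: "ispan ?J (?Q i) = ispan ?J' (Q i)" for i
    by (simp add: ispan_restrict_scalars \<pi>_aug)
  have mc: "mcong ?J (?Q i) x y \<longleftrightarrow> mcong ?J' (Q i) x y" for i x y
    by (simp add: mcong_def span restrict_scalars_minus)
  have hc: "hcycles ?J ?Q d' k = ?Z'"
    by (simp add: hcycles_def span)
  have hb: "hbounds ?J ?Q d' k = ?D'"
    by (simp add: hbounds_def mc)
  obtain f where f: "f \<in> relhom B ?J (P k) (?Q k)"
    and fc: "\<And>x. x \<in> ?Z \<Longrightarrow> f x \<in> ?Z'"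
    and fb: "\<And>x. x \<in> ?Z \<Longrightarrow> f x \<in> ?D' \<longleftrightarrow> x \<in> ?D"
    and fs: "\<And>y. y \<in> ?Z' \<Longrightarrow> \<exists>x\<in>?Z. y \<ominus>\<^bsub>Q k\<^esub> f x \<in> ?D'"
    using PQ.hcycles_comparison[OF B.aug_ideal I_aug, of k] unfolding hc hb restrict_scalars_minus by blast
  interpret f: relhom_setup ?J B "P k" "?Q k" f
    by (intro relhom_setupI PQ.P.P PQ.Q.P B.aug_ideal f)
  interpret Qk: mod_ideal ?J' B' "Q k" by (intro mod_idealI Qr.P B'.aug_ideal)
  note Psub = submoduleD[OF submodule_hcycles[where P = P and d = d and k = k, OF B.aug_ideal PQ.P.P PQ.P.d]]
  note Qsub = submoduleD[OF submodule_hcycles[where P = Q and d = d' and k = k, OF B'.aug_ideal Qr.P Qr.d]]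
  obtain \<kappa> where \<kappa>: "carrier (?T) = \<kappa> ` ?Z"
    "\<And>x y. \<lbrakk>x \<in> ?Z; y \<in> ?Z\<rbrakk> \<Longrightarrow>
      \<kappa> (x \<oplus>\<^bsub>P k\<^esub> y) = \<kappa> x \<oplus>\<^bsub>?T\<^esub> \<kappa> y"
    "\<And>r x. \<lbrakk>r \<in> carrier R; x \<in> ?Z\<rbrakk> \<Longrightarrow>
      \<kappa> (B.unit r \<odot>\<^bsub>P k\<^esub> x) = r \<odot>\<^bsub>?T\<^esub> \<kappa> x"
    "\<And>x y. \<lbrakk>x \<in> ?Z; y \<in> ?Z\<rbrakk> \<Longrightarrow>
      \<kappa> x = \<kappa> y \<longleftrightarrow> x \<ominus>\<^bsub>P k\<^esub> y \<in> ?D"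
    using B.Tor_classes[of P d, OF PQ.P.P PQ.P.d PQ.P.dd] by blast
  obtain \<kappa>' where \<kappa>': "carrier (?T') = \<kappa>' ` ?Z'"
    "\<And>x y. \<lbrakk>x \<in> ?Z'; y \<in> ?Z'\<rbrakk> \<Longrightarrow>
      \<kappa>' (x \<oplus>\<^bsub>Q k\<^esub> y) = \<kappa>' x \<oplus>\<^bsub>?T'\<^esub> \<kappa>' y"
    "\<And>r x. \<lbrakk>r \<in> carrier R; x \<in> ?Z'\<rbrakk> \<Longrightarrow>
      \<kappa>' (B'.unit r \<odot>\<^bsub>Q k\<^esub> x) = r \<odot>\<^bsub>?T'\<^esub> \<kappa>' x"
    "\<And>x y. \<lbrakk>x \<in> ?Z'; y \<in> ?Z'\<rbrakk> \<Longrightarrow>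
      \<kappa>' x = \<kappa>' y \<longleftrightarrow> x \<ominus>\<^bsub>Q k\<^esub> y \<in> ?D'"
    using B'.Tor_classes[of Q d', OF Qr.P Qr.d Qr.dd] by blast
  \<comment> \<open>A difference lying in \<open>aug\<close> times Q counts as a boundary, bounded
    by 0. This absorbs that f is linear only modulo the augmentation ideal.\<close>
  have \<kappa>'_cong: "\<kappa>' x = \<kappa>' y"
    if "x \<in> ?Z'" "y \<in> ?Z'" "mcong ?J' (Q k) x y" for x y
  proof -
    interpret Q1: left_module B' "Q (Suc k)" by (rule Qr.P)
    have "mcong ?J' (Q k) (x \<ominus>\<^bsub>Q k\<^esub> y) \<zero>\<^bsub>Q k\<^esub>"
      using that(3) by (intro Qk.mcong_zero_iff[THEN iffD2]) (simp add: mcong_def)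
    then have "mcong ?J' (Q k) (d' k \<zero>\<^bsub>Q (Suc k)\<^esub>) (x \<ominus>\<^bsub>Q k\<^esub> y)"
      unfolding mod_hom_zero[OF Qr.P Qr.P Qr.d] by (rule Qk.mcong_sym)
    then have "x \<ominus>\<^bsub>Q k\<^esub> y \<in> ?D'"
      unfolding hbounds_def using Q1.M.zero_closed by blast
    then show ?thesis using \<kappa>'(4) that by blast
  qed
  show ?thesis
  proof (rule mod_isomorphic_of_surjections[where \<kappa> = \<kappa> and \<phi> = "\<lambda>x. \<kappa>' (f x)"])
    show "carrier (?T) = \<kappa> ` ?Z" by (rule \<kappa>(1))
    have "\<kappa>' y \<in> (\<lambda>x. \<kappa>' (f x)) ` ?Z" if y: "y \<in> ?Z'" for y
      using fs[OF y] \<kappa>'(4)[OF y fc] by blast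
    then show "carrier (?T') = (\<lambda>x. \<kappa>' (f x)) ` ?Z"
      unfolding \<kappa>'(1) using fc by blast
    show "\<kappa> x = \<kappa> y \<longleftrightarrow> \<kappa>' (f x) = \<kappa>' (f y)"
      if x: "x \<in> ?Z" and y: "y \<in> ?Z" for x y
    proof -
      have xy: "x \<ominus>\<^bsub>P k\<^esub> y \<in> ?Z"
        unfolding a_minus_def by (intro Psub x y)
      have c: "mcong ?J' (Q k) (f (x \<ominus>\<^bsub>P k\<^esub> y)) (f x \<ominus>\<^bsub>Q k\<^esub> f y)"
        using f.diff[OF hcyclesD(1)[OF x] hcyclesD(1)[OF y]] unfolding mc restrict_scalars_minus .
      have "\<kappa> x = \<kappa> y \<longleftrightarrow> f (x \<ominus>\<^bsub>P k\<^esub> y) \<in> ?D'"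
        using \<kappa>(4)[OF x y] fb[OF xy] by simp
      also have "\<dots> \<longleftrightarrow> f x \<ominus>\<^bsub>Q k\<^esub> f y \<in> ?D'"
        using Qk.mcong_trans[OF _ c] Qk.mcong_trans[OF _ Qk.mcong_sym[OF c]] unfolding hbounds_def by blast
      also have "\<dots> \<longleftrightarrow> \<kappa>' (f x) = \<kappa>' (f y)"
        using \<kappa>'(4)[OF fc[OF x] fc[OF y]] by simp
      finally show ?thesis .
    qed
    show "\<exists>z\<in>?Z. \<kappa> z = \<kappa> x \<oplus>\<^bsub>?T\<^esub> \<kappa> y \<and>
        \<kappa>' (f z) = \<kappa>' (f x) \<oplus>\<^bsub>?T'\<^esub> \<kappa>' (f y)"
      if x: "x \<in> ?Z" and y: "y \<in> ?Z" for x y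
    proof (intro bexI conjI)
      show xy: "x \<oplus>\<^bsub>P k\<^esub> y \<in> ?Z" by (intro Psub x y)
      show "\<kappa> (x \<oplus>\<^bsub>P k\<^esub> y) = \<kappa> x \<oplus>\<^bsub>?T\<^esub> \<kappa> y" by (rule \<kappa>(2)[OF x y])
      have "mcong ?J' (Q k) (f (x \<oplus>\<^bsub>P k\<^esub> y)) (f x \<oplus>\<^bsub>Q k\<^esub> f y)"
        using f.add[OF hcyclesD(1)[OF x] hcyclesD(1)[OF y]] unfolding mc restrict_scalars_simps .
      then have "\<kappa>' (f (x \<oplus>\<^bsub>P k\<^esub> y)) = \<kappa>' (f x \<oplus>\<^bsub>Q k\<^esub> f y)"
        by (intro \<kappa>'_cong fc xy Qsub x y)
      then show "\<kappa>' (f (x \<oplus>\<^bsub>P k\<^esub> y)) = \<kappa>' (f x) \<oplus>\<^bsub>?T'\<^esub> \<kappa>' (f y)"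
        by (simp only: \<kappa>'(2)[OF fc[OF x] fc[OF y]])
    qed
    show "\<exists>z\<in>?Z. \<kappa> z = r \<odot>\<^bsub>?T\<^esub> \<kappa> x \<and>
        \<kappa>' (f z) = r \<odot>\<^bsub>?T'\<^esub> \<kappa>' (f x)"
      if r: "r \<in> carrier R" and x: "x \<in> ?Z" for r x
    proof (intro bexI conjI)
      let ?rx = "B.unit r \<odot>\<^bsub>P k\<^esub> x"
      show rx: "?rx \<in> ?Z" by (intro Psub x B.unit_closed r)
      show "\<kappa> ?rx = r \<odot>\<^bsub>?T\<^esub> \<kappa> x" by (rule \<kappa>(3)[OF r x])
      have "mcong ?J' (Q k) (f ?rx) (B'.unit r \<odot>\<^bsub>Q k\<^esub> f x)"
        using f.smult[OF B.unit_closed[OF r] hcyclesD(1)[OF x]]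
        unfolding mc restrict_scalars_simps \<pi>_unit[OF r] .
      then have "\<kappa>' (f ?rx) = \<kappa>' (B'.unit r \<odot>\<^bsub>Q k\<^esub> f x)"
        by (intro \<kappa>'_cong fc rx Qsub x B'.unit_closed r)
      then show "\<kappa>' (f ?rx) = r \<odot>\<^bsub>?T'\<^esub> \<kappa>' (f x)"
        by (simp only: \<kappa>'(3)[OF r fc[OF x]])
    qed
  qed
qed

end

section \<open>Quotient algebras\<close>

lemma left_module_cong:
  assumes "left_module R M" and c: "carrier M' = carrier M" "\<zero>\<^bsub>M'\<^esub> = \<zero>\<^bsub>M\<^esub>"
    "\<And>x y. x \<oplus>\<^bsub>M'\<^esub> y = x \<oplus>\<^bsub>M\<^esub> y" "\<And>r x. r \<odot>\<^bsub>M'\<^esub> x = r \<odot>\<^bsub>M\<^esub> x"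
  shows "left_module R M'"
proof -
  interpret left_module R M by fact
  have "abelian_group M'"
  proof (rule abelian_groupI)
    fix x assume "x \<in> carrier M'"
    then show "\<exists>y\<in>carrier M'. y \<oplus>\<^bsub>M'\<^esub> x = \<zero>\<^bsub>M'\<^esub>"
      using M.l_neg[of x] M.a_inv_closed[of x] unfolding c by auto
  qed (auto simp: c M.a_ac)
  moreover have "left_module_axioms R M'"
    by standard (auto simp: c smult_closed smult_l_distr smult_r_distr smult_assoc smult_one)
  ultimately show ?thesis by (simp add: left_module_def R.ring_axioms)
qed

text \<open>
  That the submodule \<open>U\<close> is an ideal is not assumed: it follows from the quotient being a ring.
\<close>

locale quotient_algebra = quotient_module R V U
  for R :: "('r, 'x) ring_scheme" and V :: "('r, 'v) module" and U +
  assumes quot_ring: "ring (quot V U)"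
    and one_closed: "\<one>\<^bsub>V\<^esub> \<in> carrier V"
    and mult_closed: "\<lbrakk>x \<in> carrier V; y \<in> carrier V\<rbrakk> \<Longrightarrow> x \<otimes>\<^bsub>V\<^esub> y \<in> carrier V"
    and mult_l_distr: "\<lbrakk>x \<in> carrier V; x' \<in> carrier V; y \<in> carrier V\<rbrakk> \<Longrightarrow>
      (x \<oplus>\<^bsub>V\<^esub> x') \<otimes>\<^bsub>V\<^esub> y = x \<otimes>\<^bsub>V\<^esub> y \<oplus>\<^bsub>V\<^esub> x' \<otimes>\<^bsub>V\<^esub> y"
    and mult_r_distr: "\<lbrakk>x \<in> carrier V; y \<in> carrier V; y' \<in> carrier V\<rbrakk> \<Longrightarrow>
      x \<otimes>\<^bsub>V\<^esub> (y \<oplus>\<^bsub>V\<^esub> y') = x \<otimes>\<^bsub>V\<^esub> y \<oplus>\<^bsub>V\<^esub> x \<otimes>\<^bsub>V\<^esub> y'"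
    and mult_smult_left: "\<lbrakk>r \<in> carrier R; x \<in> carrier V; y \<in> carrier V\<rbrakk> \<Longrightarrow>
      (r \<odot>\<^bsub>V\<^esub> x) \<otimes>\<^bsub>V\<^esub> y = r \<odot>\<^bsub>V\<^esub> (x \<otimes>\<^bsub>V\<^esub> y)"
    and mult_smult_right: "\<lbrakk>r \<in> carrier R; x \<in> carrier V; y \<in> carrier V\<rbrakk> \<Longrightarrow>
      x \<otimes>\<^bsub>V\<^esub> (r \<odot>\<^bsub>V\<^esub> y) = r \<odot>\<^bsub>V\<^esub> (x \<otimes>\<^bsub>V\<^esub> y)"
begin

abbreviation cls where "cls x \<equiv> U +>\<^bsub>V\<^esub> x"

lemma mult_zero: "y \<in> carrier V \<Longrightarrow> \<zero>\<^bsub>V\<^esub> \<otimes>\<^bsub>V\<^esub> y = \<zero>\<^bsub>V\<^esub>" "y \<in> carrier V \<Longrightarrow> y \<otimes>\<^bsub>V\<^esub> \<zero>\<^bsub>V\<^esub> = \<zero>\<^bsub>V\<^esub>"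
  using mult_smult_left[of "\<zero>\<^bsub>R\<^esub>" "\<zero>\<^bsub>V\<^esub>" y] mult_smult_right[of "\<zero>\<^bsub>R\<^esub>" y "\<zero>\<^bsub>V\<^esub>"]
  by (simp_all add: smult_l_zero mult_closed)

lemma quot_mult: "X \<otimes>\<^bsub>quot V U\<^esub> Y = (\<Union>x\<in>X. \<Union>y\<in>Y. cls (x \<otimes>\<^bsub>V\<^esub> y))"
  by (simp add: quot_def ring.defs module.defs FactRing_def rcoset_mult_def)

lemma quot_one: "\<one>\<^bsub>quot V U\<^esub> = cls \<one>\<^bsub>V\<^esub>"
  by (simp add: quot_def ring.defs module.defs FactRing_def)

lemma cls_self: "x \<in> carrier V \<Longrightarrow> x \<in> cls x"
  by (rule a_rcos_self)

lemma cls_zero: "cls \<zero>\<^bsub>V\<^esub> = U"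
  by (rule M.a_coset_add_zero[OF a_subset])

lemma coset_eq_of_zero:
  assumes "Z \<in> carrier (quot V U)" "\<zero>\<^bsub>V\<^esub> \<in> Z"
  shows "Z = U"
proof -
  obtain z where z: "z \<in> carrier V" "Z = cls z" using assms(1) unfolding quot_carrier by blast
  show ?thesis
    using a_repr_independence'[OF _ z(1), of "\<zero>\<^bsub>V\<^esub>"] assms(2) unfolding z(2) cls_zero by simp
qed

text \<open>The product of U with the coset of y is an element of the quotient ring and contains 0 y
  = 0, so it is U itself. As a union of cosets of products it also contains u y.\<close>

lemma ideal_right:
  assumes u: "u \<in> U" and y: "y \<in> carrier V"
  shows "u \<otimes>\<^bsub>V\<^esub> y \<in> U"
proof -
  interpret Q: ring "quot V U" by (rule quot_ring)
  have uy: "u \<otimes>\<^bsub>V\<^esub> y \<in> carrier V" by (intro mult_closed y a_Hcarr[OF u])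
  have "cls \<zero>\<^bsub>V\<^esub> \<otimes>\<^bsub>quot V U\<^esub> cls y \<in> carrier (quot V U)"
    by (intro Q.m_closed) (auto simp: quot_carrier y)
  moreover have sub: "cls (w \<otimes>\<^bsub>V\<^esub> y) \<subseteq> cls \<zero>\<^bsub>V\<^esub> \<otimes>\<^bsub>quot V U\<^esub> cls y" if "w \<in> U" for w
    unfolding quot_mult cls_zero using that cls_self[OF y] by blast
  moreover have "\<zero>\<^bsub>V\<^esub> \<in> cls (\<zero>\<^bsub>V\<^esub> \<otimes>\<^bsub>V\<^esub> y)"
    unfolding mult_zero(1)[OF y] by (rule cls_self) simp
  ultimately have "cls \<zero>\<^bsub>V\<^esub> \<otimes>\<^bsub>quot V U\<^esub> cls y = U"
    by (intro coset_eq_of_zero)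
      (assumption, rule subsetD[OF sub[OF additive_subgroup.zero_closed[OF additive_subgroup_axioms]]])
  then show ?thesis using sub[OF u] cls_self[OF uy] by blast
qed

lemma ideal_left:
  assumes u: "u \<in> U" and y: "y \<in> carrier V"
  shows "y \<otimes>\<^bsub>V\<^esub> u \<in> U"
proof -
  interpret Q: ring "quot V U" by (rule quot_ring)
  have uy: "y \<otimes>\<^bsub>V\<^esub> u \<in> carrier V" by (intro mult_closed y a_Hcarr[OF u])
  have "cls y \<otimes>\<^bsub>quot V U\<^esub> cls \<zero>\<^bsub>V\<^esub> \<in> carrier (quot V U)"
    by (intro Q.m_closed) (auto simp: quot_carrier y)
  moreover have sub: "cls (y \<otimes>\<^bsub>V\<^esub> w) \<subseteq> cls y \<otimes>\<^bsub>quot V U\<^esub> cls \<zero>\<^bsub>V\<^esub>" if "w \<in> U" for w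
    unfolding quot_mult cls_zero using that cls_self[OF y] by blast
  moreover have "\<zero>\<^bsub>V\<^esub> \<in> cls (y \<otimes>\<^bsub>V\<^esub> \<zero>\<^bsub>V\<^esub>)"
    unfolding mult_zero(2)[OF y] by (rule cls_self) simp
  ultimately have "cls y \<otimes>\<^bsub>quot V U\<^esub> cls \<zero>\<^bsub>V\<^esub> = U"
    by (intro coset_eq_of_zero)
      (assumption, rule subsetD[OF sub[OF additive_subgroup.zero_closed[OF additive_subgroup_axioms]]])
  then show ?thesis using sub[OF u] cls_self[OF uy] by blast
qed

text \<open>Expanding the product of u + x and v + y, all terms other than x y lie in U, so the
  union over representatives is a single coset.\<close>

lemma mult_cls:
  assumes x: "x \<in> carrier V" and y: "y \<in> carrier V"
  shows "cls x \<otimes>\<^bsub>quot V U\<^esub> cls y = cls (x \<otimes>\<^bsub>V\<^esub> y)"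
proof -
  have "cls (x' \<otimes>\<^bsub>V\<^esub> y') = cls (x \<otimes>\<^bsub>V\<^esub> y)" if "x' \<in> cls x" "y' \<in> cls y" for x' y'
  proof -
    obtain u v where uv: "u \<in> U" "x' = u \<oplus>\<^bsub>V\<^esub> x" "v \<in> U" "y' = v \<oplus>\<^bsub>V\<^esub> y"
      using \<open>x' \<in> _\<close> \<open>y' \<in> _\<close> unfolding coset_mem by blast
    have c: "u \<in> carrier V" "v \<in> carrier V" using uv a_Hcarr by auto
    have "x' \<otimes>\<^bsub>V\<^esub> y' = (u \<otimes>\<^bsub>V\<^esub> (v \<oplus>\<^bsub>V\<^esub> y) \<oplus>\<^bsub>V\<^esub> x \<otimes>\<^bsub>V\<^esub> v) \<oplus>\<^bsub>V\<^esub> x \<otimes>\<^bsub>V\<^esub> y"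
      using uv c x y by (simp add: mult_l_distr mult_r_distr mult_closed M.a_ac)
    moreover have "u \<otimes>\<^bsub>V\<^esub> (v \<oplus>\<^bsub>V\<^esub> y) \<oplus>\<^bsub>V\<^esub> x \<otimes>\<^bsub>V\<^esub> v \<in> U"
      using uv c x y by (intro a_closed ideal_right ideal_left) simp_all
    ultimately show ?thesis using coset_eqI mult_closed[OF x y] by simp
  qed
  then show ?thesis
    unfolding quot_mult using cls_self[OF x] cls_self[OF y] by blast
qed

lemma cls_closed: "x \<in> carrier V \<Longrightarrow> cls x \<in> carrier (quot V U)"
  by (auto simp: quot_carrier)

lemma unit_mult_cls:
  assumes "r \<in> carrier R" "x \<in> carrier V"
  shows "(r \<odot>\<^bsub>quot V U\<^esub> \<one>\<^bsub>quot V U\<^esub>) \<otimes>\<^bsub>quot V U\<^esub> cls x = cls (r \<odot>\<^bsub>V\<^esub> x)"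
    "cls x \<otimes>\<^bsub>quot V U\<^esub> (r \<odot>\<^bsub>quot V U\<^esub> \<one>\<^bsub>quot V U\<^esub>) = cls (r \<odot>\<^bsub>V\<^esub> x)"
proof -
  interpret Q: ring "quot V U" by (rule quot_ring)
  have 1: "cls (\<one>\<^bsub>V\<^esub> \<otimes>\<^bsub>V\<^esub> x) = cls x" "cls (x \<otimes>\<^bsub>V\<^esub> \<one>\<^bsub>V\<^esub>) = cls x"
    using Q.l_one[OF cls_closed[OF assms(2)]] Q.r_one[OF cls_closed[OF assms(2)]] assms one_closed
    by (simp_all add: quot_one mult_cls)
  have r: "r \<odot>\<^bsub>quot V U\<^esub> \<one>\<^bsub>quot V U\<^esub> = cls (r \<odot>\<^bsub>V\<^esub> \<one>\<^bsub>V\<^esub>)"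
    unfolding quot_one by (rule quot_smult[OF assms(1) one_closed])
  have "cls (r \<odot>\<^bsub>V\<^esub> (\<one>\<^bsub>V\<^esub> \<otimes>\<^bsub>V\<^esub> x)) = cls (r \<odot>\<^bsub>V\<^esub> x)" "cls (r \<odot>\<^bsub>V\<^esub> (x \<otimes>\<^bsub>V\<^esub> \<one>\<^bsub>V\<^esub>)) = cls (r \<odot>\<^bsub>V\<^esub> x)"
    using 1 assms one_closed quot_smult[of r "\<one>\<^bsub>V\<^esub> \<otimes>\<^bsub>V\<^esub> x"] quot_smult[of r "x \<otimes>\<^bsub>V\<^esub> \<one>\<^bsub>V\<^esub>"] quot_smult[of r x]
    by (simp_all add: mult_closed)
  then show "(r \<odot>\<^bsub>quot V U\<^esub> \<one>\<^bsub>quot V U\<^esub>) \<otimes>\<^bsub>quot V U\<^esub> cls x = cls (r \<odot>\<^bsub>V\<^esub> x)"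
    "cls x \<otimes>\<^bsub>quot V U\<^esub> (r \<odot>\<^bsub>quot V U\<^esub> \<one>\<^bsub>quot V U\<^esub>) = cls (r \<odot>\<^bsub>V\<^esub> x)"
    unfolding r using assms one_closed
    by (simp_all add: mult_cls smult_closed mult_smult_left mult_smult_right)
qed

end

section \<open>Diagrams and link states\<close>

lemma finite_rb_diagrams: "finite (rb_diagrams n)"
proof (rule finite_subset)
  show "rb_diagrams n \<subseteq> Pow (nodes n \<times> nodes n)" by (auto simp: rb_diagrams_def)
qed (simp add: nodes_def)

lemma rb_diagram_lr_eq:
  assumes "d \<in> rb_diagrams n" "(Lft i, Rgt j) \<in> d"
  shows "(Lft i, Rgt j') \<in> d \<Longrightarrow> j' = j" "(Lft i', Rgt j) \<in> d \<Longrightarrow> i' = i"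
proof -
  have sv: "single_valued d" and sy: "sym d" using assms(1) by (auto simp: rb_diagrams_def)
  show "j' = j" if "(Lft i, Rgt j') \<in> d"
    using single_valuedD[OF sv that assms(2)] by simp
  show "i' = i" if "(Lft i', Rgt j) \<in> d"
    using single_valuedD[OF sv symD[OF sy that] symD[OF sy assms(2)]] by simp
qed

lemma card_right_defects:
  assumes d: "d \<in> rb_diagrams n"
  shows "card (snd (right_link_state d)) = lr_connections d"
proof -
  have "snd (right_link_state d) = snd ` {(i, j). (Lft i, Rgt j) \<in> d}"
    by (force simp: right_link_state_def)
  moreover have "inj_on snd {(i, j). (Lft i, Rgt j) \<in> d}"
    using rb_diagram_lr_eq(2)[OF d] by (auto simp: inj_on_def)
  ultimately show ?thesis by (simp add: lr_connections_def card_image)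
qed

lemma right_link_state_in_link_states:
  assumes d: "d \<in> rb_diagrams n"
  shows "right_link_state d \<in> link_states n (lr_connections d)"
proof -
  have dn: "d \<subseteq> nodes n \<times> nodes n" and sym: "sym d" and irr: "irrefl d" and sv: "single_valued d"
    using d by (auto simp: rb_diagrams_def)
  let ?E = "{(i, j). (Rgt i, Rgt j) \<in> d}" and ?D = "{j. \<exists>i. (Lft i, Rgt j) \<in> d}"
  have "?E \<subseteq> {..<n} \<times> {..<n}" "?D \<subseteq> {..<n}" using dn by (auto simp: nodes_def)
  moreover have "sym ?E" "irrefl ?E"
    using sym irr by (auto simp: sym_def irrefl_def)
  moreover have "single_valued ?E"
    using single_valuedD[OF sv] by (intro single_valuedI) force
  moreover have "?D \<inter> Domain ?E = {}"
    using single_valuedD[OF sv symD[OF sym]] by force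
  moreover have "card ?D = lr_connections d"
    using card_right_defects[OF d] by (simp add: right_link_state_def)
  ultimately show ?thesis by (simp add: link_states_def right_link_state_def)
qed

text \<open>A splice removes two defects and a deletion one, so only the empty sequence keeps their
  number.\<close>

lemma splice_or_delete_card:
  assumes "splice_or_delete\<^sup>*\<^sup>* p q" "finite (snd p)"
  shows "q = p \<or> card (snd q) < card (snd p)"
proof -
  have "finite (snd q) \<and> (q = p \<or> card (snd q) < card (snd p))"
    using assms
  proof (induction rule: rtranclp_induct)
    case (step q q')
    have "finite (snd q') \<and> card (snd q') < card (snd q)"
      using step(2) step(3)[OF step(4)]
      by cases (auto simp: card_gt_0_iff intro!: diff_less)
    then show ?case using step by auto
  qed simp
  then show ?thesis by blast
qed

text \<open>The defects of a right link state count the left-to-right connections. Hence modulo the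
  diagrams with fewer than i connections, \<open>J_p\<close> is spanned by the diagrams with right
  link state p itself.\<close>

lemma link_ideal_support:
  assumes p: "p \<in> link_states n i" and x: "x \<in> link_ideal R n p" "x d \<noteq> \<zero>\<^bsub>R\<^esub>"
  shows "right_link_state d = p \<and> lr_connections d = i \<or> lr_connections d < i"
proof -
  have d: "d \<in> rb_diagrams n" "splice_or_delete\<^sup>*\<^sup>* p (right_link_state d)"
    using free_moduleD(2)[OF x(1)[unfolded link_ideal_def], of d] x(2) by auto
  have "finite (snd p)" "card (snd p) = i"
    using p by (auto simp: link_states_def dest: finite_subset)
  then show ?thesis
    using splice_or_delete_card[OF d(2)] card_right_defects[OF d(1)] by auto
qed

text \<open>Every left node has an edge and none of these edges stays on the left. Consequently the
  ideals of diagrams with fewer than n connections act as zero on the trivial module.\<close>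

lemma perm_diagram_lr_connections:
  assumes d: "d \<in> perm_diagrams n"
  shows "n \<le> lr_connections d"
proof -
  have rb: "d \<in> rb_diagrams n" and dom: "Domain d = nodes n" and no: "\<And>i j. (Lft i, Lft j) \<notin> d"
    using d by (auto simp: perm_diagrams_def)
  let ?C = "{(i, j). (Lft i, Rgt j) \<in> d}"
  have "{..<n} \<subseteq> fst ` ?C"
  proof
    fix i assume "i \<in> {..<n}"
    then have "Lft i \<in> Domain d" by (simp add: dom nodes_def)
    then obtain v where v: "(Lft i, v) \<in> d" by blast
    then obtain j where "v = Rgt j" using no by (cases v) auto
    then show "i \<in> fst ` ?C" using v by force
  qed
  moreover have "finite ?C"
  proof (rule finite_subset)
    show "?C \<subseteq> {..<n} \<times> {..<n}" using rb by (auto simp: rb_diagrams_def nodes_def)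
  qed simp
  ultimately show ?thesis
    unfolding lr_connections_def using card_mono[of "fst ` ?C" "{..<n}"] card_image_le[of ?C fst] by simp
qed

lemma perm_diagrams_subset: "perm_diagrams n \<subseteq> rb_diagrams n"
  by (auto simp: perm_diagrams_def)

section \<open>Quotients of subalgebras of the rook-Brauer algebra\<close>

locale rook_subalgebra = cring R for R :: "'r ring" (structure) and n :: nat and \<delta> \<epsilon> :: 'r and S :: "diagram set" +
  assumes \<delta>: "\<delta> \<in> carrier R" and \<epsilon>: "\<epsilon> \<in> carrier R"
    and S: "S \<subseteq> rb_diagrams n"
    and subalgebra: "subalgebra R (carrier (free_module R S)) (rook_brauer R n \<delta> \<epsilon>)"
begin

abbreviation A where "A \<equiv> carrier (free_module R S)"

definition V where "V = (rook_brauer R n \<delta> \<epsilon>)\<lparr>carrier := A\<rparr>"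

definition U :: "int \<Rightarrow> (diagram \<Rightarrow> 'r) set"
  where "U j = A \<inter> conn_ideal R n j"

lemma conn_quotient_eq: "conn_quotient R n \<delta> \<epsilon> A j = quot V (U j)"
  by (simp add: conn_quotient_def V_def U_def)

lemma V_simps:
  "carrier V = A" "\<zero>\<^bsub>V\<^esub> = (\<lambda>d. \<zero>)" "x \<oplus>\<^bsub>V\<^esub> y = (\<lambda>d. x d \<oplus> y d)" "r \<odot>\<^bsub>V\<^esub> x = (\<lambda>d. r \<otimes> x d)"
  by (simp_all add: V_def rook_brauer_def free_module_def)

definition weight :: "diagram \<Rightarrow> diagram \<Rightarrow> 'r"
  where "weight a b = \<delta> [^] loop_count n a b \<otimes> \<epsilon> [^] contractible_count n a b"

definition factors :: "diagram \<Rightarrow> (diagram \<times> diagram) set"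
  where "factors d = {(a, b). a \<in> rb_diagrams n \<and> b \<in> rb_diagrams n \<and> diagram_comp a b = d}"

lemma V_mult: "x \<otimes>\<^bsub>V\<^esub> y = (\<lambda>d. \<Oplus>p\<in>factors d. x (fst p) \<otimes> y (snd p) \<otimes> weight (fst p) (snd p))"
  unfolding V_def rook_brauer_def factors_def weight_def by (simp add: case_prod_unfold)

lemma rook_mult: "x \<otimes>\<^bsub>rook_brauer R n \<delta> \<epsilon>\<^esub> y = x \<otimes>\<^bsub>V\<^esub> y"
  by (simp add: V_def)

lemma weight_closed: "weight a b \<in> carrier R"
  by (simp add: weight_def \<delta> \<epsilon>)

lemma finite_factors: "finite (factors d)"
  by (rule finite_subset[of _ "rb_diagrams n \<times> rb_diagrams n"]) (auto simp: factors_def finite_rb_diagrams)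

text \<open>Finite support is automatic, as there are finitely many diagrams.\<close>

lemma mem_A: "x \<in> A \<longleftrightarrow> (\<forall>d. x d \<in> carrier R) \<and> (\<forall>d. d \<notin> S \<longrightarrow> x d = \<zero>)"
proof -
  have "finite {d. x d \<noteq> \<zero>}" if "\<forall>d. d \<notin> S \<longrightarrow> x d = \<zero>"
    by (rule finite_subset[of _ "rb_diagrams n"]) (use that S finite_rb_diagrams in auto)
  then show ?thesis by (auto simp: free_module_simps(1))
qed

lemma A_closed: "x \<in> A \<Longrightarrow> x d \<in> carrier R"
  by (simp add: mem_A)

lemma mem_U: "x \<in> U j \<longleftrightarrow> x \<in> A \<and> (\<forall>d. j < int (lr_connections d) \<longrightarrow> x d = \<zero>)"
proof -
  have "x \<in> conn_ideal R n j" if x: "x \<in> A" "\<forall>d. j < int (lr_connections d) \<longrightarrow> x d = \<zero>"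
    using free_moduleD[OF x(1)] x(2) S by (auto simp: conn_ideal_def free_module_simps(1))
  moreover have "x d = \<zero>" if "x \<in> conn_ideal R n j" "j < int (lr_connections d)" for d
    using free_moduleD(2)[OF that(1)[unfolded conn_ideal_def], of d] that(2) by simp
  ultimately show ?thesis by (auto simp: U_def)
qed

lemma left_module_V: "left_module R V"
  by (rule left_module_cong[OF left_module_free[of S]]) (simp_all add: V_simps free_module_simps)

sublocale V: left_module R V
  by (rule left_module_V)

lemma submodule_U: "submodule (U j) R V"
proof (rule V.submodule_criterion)
  show "U j \<subseteq> carrier V" by (auto simp: mem_U V_simps)
qed (auto simp: mem_U mem_A V_simps)

lemma V_mult_closed: "\<lbrakk>x \<in> A; y \<in> A\<rbrakk> \<Longrightarrow> x \<otimes>\<^bsub>V\<^esub> y \<in> A"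
  using subalgebra by (simp add: subalgebra_def subring_def submonoid_def flip: rook_mult)

lemma V_one_closed: "\<one>\<^bsub>V\<^esub> \<in> A"
  using subalgebra by (simp add: subalgebra_def subring_def submonoid_def V_def)

text \<open>Bilinearity is checked on coefficients of diagrams; associativity and the unit laws
  enter through the ring structure assumed for the quotient.\<close>

lemma quotient_algebra_V:
  assumes "ring (quot V (U j))"
  shows "quotient_algebra R V (U j)"
proof (intro quotient_algebra.intro quotient_module.intro V.left_module_axioms submodule_U
    quotient_algebra_axioms.intro assms; unfold V_simps(1))
  show "\<one>\<^bsub>V\<^esub> \<in> A" by (rule V_one_closed)
  fix x y assume x: "x \<in> A" and y: "y \<in> A"
  then show "x \<otimes>\<^bsub>V\<^esub> y \<in> A" by (rule V_mult_closed)
  note c = A_closed[OF x] A_closed[OF y] weight_closed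
  show "(x \<oplus>\<^bsub>V\<^esub> x') \<otimes>\<^bsub>V\<^esub> y = x \<otimes>\<^bsub>V\<^esub> y \<oplus>\<^bsub>V\<^esub> x' \<otimes>\<^bsub>V\<^esub> y" if "x' \<in> A" for x'
    unfolding V_mult V_simps using c A_closed[OF that]
    by (simp add: l_distr flip: finsum_addf)
  show "x \<otimes>\<^bsub>V\<^esub> (y \<oplus>\<^bsub>V\<^esub> y') = x \<otimes>\<^bsub>V\<^esub> y \<oplus>\<^bsub>V\<^esub> x \<otimes>\<^bsub>V\<^esub> y'" if "y' \<in> A" for y'
    unfolding V_mult V_simps using c A_closed[OF that]
    by (simp add: l_distr r_distr flip: finsum_addf)
  show "(r \<odot>\<^bsub>V\<^esub> x) \<otimes>\<^bsub>V\<^esub> y = r \<odot>\<^bsub>V\<^esub> (x \<otimes>\<^bsub>V\<^esub> y)" if "r \<in> carrier R" for r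
    unfolding V_mult V_simps using c that finite_factors
    by (simp add: finsum_rdistr m_assoc)
  show "x \<otimes>\<^bsub>V\<^esub> (r \<odot>\<^bsub>V\<^esub> y) = r \<odot>\<^bsub>V\<^esub> (x \<otimes>\<^bsub>V\<^esub> y)" if "r \<in> carrier R" for r
    unfolding V_mult V_simps using c that finite_factors
    by (simp add: finsum_rdistr m_assoc m_lcomm)
qed

section \<open>The augmentation and the trivial module over the quotients\<close>

definition augmentation :: "(diagram \<Rightarrow> 'r) \<Rightarrow> 'r"
  where "augmentation x = (\<Oplus>d\<in>perm_diagrams n. x d)"

lemma augmentation_closed: "x \<in> A \<Longrightarrow> augmentation x \<in> carrier R"
  unfolding augmentation_def using A_closed by (intro finsum_closed) auto

lemma augmentation_add:
  "\<lbrakk>x \<in> A; y \<in> A\<rbrakk> \<Longrightarrow> augmentation (x \<oplus>\<^bsub>V\<^esub> y) = augmentation x \<oplus> augmentation y"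
  unfolding augmentation_def V_simps using A_closed by (intro finsum_addf) auto

lemma augmentation_smult:
  "\<lbrakk>r \<in> carrier R; x \<in> A\<rbrakk> \<Longrightarrow> augmentation (r \<odot>\<^bsub>V\<^esub> x) = r \<otimes> augmentation x"
  unfolding augmentation_def V_simps using A_closed finite_subset[OF perm_diagrams_subset finite_rb_diagrams]
  by (intro finsum_rdistr[symmetric]) auto

lemma augmentation_U:
  assumes "u \<in> U j" "j < int n" shows "augmentation u = \<zero>"
  unfolding augmentation_def
proof (rule add.finprod_one_eqI)
  fix d assume "d \<in> perm_diagrams n"
  then have "j < int (lr_connections d)" using perm_diagram_lr_connections[of d n] assms(2) by simp
  then show "u d = \<zero>" using assms(1) by (simp add: mem_U)
qed

text \<open>All members of a coset have the same augmentation because \<open>U j\<close> contains no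
  permutation diagrams for j < n. So the image set in \<open>trivial_module\<close> is a singleton
  and \<open>the_elem\<close> is meaningful.\<close>

lemma trivial_smult:
  assumes x: "x \<in> A" and j: "j < int n"
  shows "(U j +>\<^bsub>V\<^esub> x) \<odot>\<^bsub>trivial_module R n\<^esub> s = augmentation x \<otimes> s"
proof -
  interpret Q: quotient_module R V "U j"
    by (rule quotient_moduleI[OF left_module_V submodule_U])
  have "trivial_act R n y s = augmentation x \<otimes> s" if y: "y \<in> U j +>\<^bsub>V\<^esub> x" for y
  proof -
    obtain u where u: "u \<in> U j" "y = u \<oplus>\<^bsub>V\<^esub> x" using y unfolding Q.coset_mem by blast
    have "u \<in> A" using u(1) unfolding mem_U by (rule conjunct1)
    then have y': "augmentation y = augmentation x"
      using augmentation_add[OF \<open>u \<in> A\<close> x] augmentation_closed[OF x]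
      by (simp only: u(2) augmentation_U[OF u(1) j] l_zero)
    show ?thesis
      using y' unfolding trivial_act_def augmentation_def by (simp only:)
  qed
  moreover have "x \<in> U j +>\<^bsub>V\<^esub> x" using x by (intro Q.a_rcos_self) (simp add: V_simps)
  ultimately have "(\<lambda>y. trivial_act R n y s) ` (U j +>\<^bsub>V\<^esub> x) = {augmentation x \<otimes> s}"
    by (auto simp: image_iff intro!: bexI[of _ x])
  then show ?thesis by (simp add: trivial_module_def)
qed

definition character :: "(diagram \<Rightarrow> 'r) set \<Rightarrow> 'r"
  where "character X = X \<odot>\<^bsub>trivial_module R n\<^esub> \<one>"

lemma character_cls: "\<lbrakk>x \<in> A; j < int n\<rbrakk> \<Longrightarrow> character (U j +>\<^bsub>V\<^esub> x) = augmentation x"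
  by (simp add: character_def trivial_smult augmentation_closed)

lemma trivial_coefficients_quot:
  assumes N: "left_module (quot V (U j)) (trivial_module R n)" and j: "j < int n"
  shows "trivial_coefficients R (quot V (U j)) (trivial_module R n) character"
proof -
  interpret N: left_module "quot V (U j)" "trivial_module R n" by (rule N)
  interpret Q: quotient_algebra R V "U j" by (rule quotient_algebra_V) (rule N.R.ring_axioms)
  interpret QM: left_module R "quot V (U j)" by (rule Q.left_module_quot)
  let ?B = "quot V (U j)"
  have smult: "X \<odot>\<^bsub>trivial_module R n\<^esub> s = character X \<otimes> s"
    if "X \<in> carrier (?B)" "s \<in> carrier R" for X s
    using that trivial_smult[OF _ j] character_cls[OF _ j] by (auto simp: Q.quot_carrier V_simps(1))
  have unit: "r \<odot>\<^bsub>?B\<^esub> \<one>\<^bsub>?B\<^esub> = U j +>\<^bsub>V\<^esub> (r \<odot>\<^bsub>V\<^esub> \<one>\<^bsub>V\<^esub>)" if "r \<in> carrier R" for r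
    unfolding Q.quot_one using that Q.one_closed by (rule Q.quot_smult)
  \<comment> \<open>Read off from the module law for the unit acting on the element 1 of the trivial
    module.\<close>
  have one: "augmentation \<one>\<^bsub>V\<^esub> = \<one>"
    using N.smult_one[of \<one>] trivial_smult[OF V_one_closed j, of \<one>] augmentation_closed[OF V_one_closed]
    by (simp add: Q.quot_one) (simp add: trivial_module_def)
  show ?thesis
  proof (intro trivial_coefficients.intro trivial_coefficients_axioms.intro is_cring N)
    show "carrier (trivial_module R n) = carrier R" "\<zero>\<^bsub>trivial_module R n\<^esub> = \<zero>"
      "x \<oplus>\<^bsub>trivial_module R n\<^esub> y = x \<oplus> y" for x y
      by (simp_all add: trivial_module_def)
    show "X \<odot>\<^bsub>trivial_module R n\<^esub> s = character X \<otimes> s"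
      if "X \<in> carrier (?B)" "s \<in> carrier R" for X s
      by (rule smult[OF that])
    show "character X \<in> carrier R" if "X \<in> carrier (?B)" for X
      using that augmentation_closed character_cls[OF _ j] by (auto simp: Q.quot_carrier V_simps(1))
    show "(\<lambda>r. r \<odot>\<^bsub>?B\<^esub> \<one>\<^bsub>?B\<^esub>) \<in> ring_hom R ?B"
    proof (rule ring_hom_memI)
      fix r s assume r: "r \<in> carrier R" and s: "s \<in> carrier R"
      show "r \<odot>\<^bsub>?B\<^esub> \<one>\<^bsub>?B\<^esub> \<in> carrier ?B" "(r \<oplus> s) \<odot>\<^bsub>?B\<^esub> \<one>\<^bsub>?B\<^esub> = r \<odot>\<^bsub>?B\<^esub> \<one>\<^bsub>?B\<^esub> \<oplus>\<^bsub>?B\<^esub> s \<odot>\<^bsub>?B\<^esub> \<one>\<^bsub>?B\<^esub>"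
        using r s by (simp_all add: QM.smult_closed QM.smult_l_distr)
      show "(r \<otimes> s) \<odot>\<^bsub>?B\<^esub> \<one>\<^bsub>?B\<^esub> = (r \<odot>\<^bsub>?B\<^esub> \<one>\<^bsub>?B\<^esub>) \<otimes>\<^bsub>?B\<^esub> (s \<odot>\<^bsub>?B\<^esub> \<one>\<^bsub>?B\<^esub>)"
        using r s Q.unit_mult_cls(1)[of r "s \<odot>\<^bsub>V\<^esub> \<one>\<^bsub>V\<^esub>"] Q.one_closed
        by (simp add: unit V.smult_assoc V.smult_closed)
    qed (simp add: QM.smult_one)
    show "character (r \<odot>\<^bsub>?B\<^esub> \<one>\<^bsub>?B\<^esub>) = r" if "r \<in> carrier R" for r
      using that V_one_closed V.smult_closed[of r "\<one>\<^bsub>V\<^esub>"]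
      by (simp add: unit character_cls j augmentation_smult one V_simps(1))
    show "(r \<odot>\<^bsub>?B\<^esub> \<one>\<^bsub>?B\<^esub>) \<otimes>\<^bsub>?B\<^esub> X =
        X \<otimes>\<^bsub>?B\<^esub> (r \<odot>\<^bsub>?B\<^esub> \<one>\<^bsub>?B\<^esub>)"
      if "r \<in> carrier R" and X: "X \<in> carrier (?B)" for r X
    proof -
      obtain x where x: "x \<in> carrier V" "X = U j +>\<^bsub>V\<^esub> x" using X unfolding Q.quot_carrier by blast
      show ?thesis unfolding x(2) Q.unit_mult_cls[OF \<open>r \<in> carrier R\<close> x(1)] ..
    qed
  qed
qed

end

section \<open>The step from at most i - 1 to at most i connections\<close>

locale rook_layer = rook_subalgebra R n \<delta> \<epsilon> S
  for R :: "'r ring" (structure) and n :: nat and \<delta> \<epsilon> :: 'r and S :: "diagram set" +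
  fixes i :: nat and idem :: "link_state \<Rightarrow> diagram \<Rightarrow> 'r"
  assumes i: "i < n"
    and idem_closed: "p \<in> right_link_state ` {d \<in> S. lr_connections d = i} \<Longrightarrow> idem p \<in> A"
    and idem_idem: "p \<in> right_link_state ` {d \<in> S. lr_connections d = i} \<Longrightarrow> idem p \<otimes>\<^bsub>V\<^esub> idem p = idem p"
    and idem_left_ideal: "p \<in> right_link_state ` {d \<in> S. lr_connections d = i} \<Longrightarrow>
      {a \<otimes>\<^bsub>V\<^esub> idem p | a. a \<in> A} = A \<inter> link_ideal R n p"
    and N1: "left_module (quot V (U (int i - 1))) (trivial_module R n)"
    and N2: "left_module (quot V (U (int i))) (trivial_module R n)"
begin

definition T :: "link_state set"
  where "T = right_link_state ` {d \<in> S. lr_connections d = i}"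

abbreviation U1 where "U1 \<equiv> U (int i - 1)"
abbreviation U2 where "U2 \<equiv> U (int i)"
abbreviation B1 where "B1 \<equiv> quot V U1"
abbreviation B2 where "B2 \<equiv> quot V U2"

sublocale N1: left_module B1 "trivial_module R n" by (rule N1)
sublocale N2: left_module B2 "trivial_module R n" by (rule N2)

sublocale Q1: quotient_algebra R V U1
  by (rule quotient_algebra_V) (rule N1.R.ring_axioms)

sublocale Q2: quotient_algebra R V U2
  by (rule quotient_algebra_V) (rule N2.R.ring_axioms)

sublocale L1: left_module R B1 by (rule Q1.left_module_quot)

text \<open>The part of x supported on diagrams with exactly i connections and right link state in
  F. A set F is allowed so that the decomposition over all of T can be built by induction.\<close>

definition restr :: "link_state set \<Rightarrow> (diagram \<Rightarrow> 'r) \<Rightarrow> diagram \<Rightarrow> 'r"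
  where "restr F x = (\<lambda>d. if lr_connections d = i \<and> right_link_state d \<in> F then x d else \<zero>)"

definition proj :: "(diagram \<Rightarrow> 'r) set \<Rightarrow> (diagram \<Rightarrow> 'r) set"
  where "proj X = (\<Union>x\<in>X. Q2.cls x)"

text \<open>The coordinate \<sigma> of the dual basis of the kernel. The union over representatives
  collapses because elements of \<open>U1\<close> have no terms with i connections.\<close>

definition coord :: "link_state \<Rightarrow> (diagram \<Rightarrow> 'r) set \<Rightarrow> (diagram \<Rightarrow> 'r) set"
  where "coord p X = (\<Union>x\<in>X. Q1.cls (restr {p} x))"

lemma A_add: "x \<in> A \<Longrightarrow> y \<in> A \<Longrightarrow> x \<oplus>\<^bsub>V\<^esub> y \<in> A"
  using V.M.a_closed[of x y] by (simp add: V_simps(1))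

lemma finite_T: "finite T"
  unfolding T_def using finite_subset[OF S finite_rb_diagrams] by simp

lemma U1_U2: "U1 \<subseteq> U2"
  by (auto simp: mem_U)

lemma U_A: "x \<in> U j \<Longrightarrow> x \<in> A"
  by (simp add: mem_U)

lemma restr_closed: "x \<in> A \<Longrightarrow> restr F x \<in> A"
  unfolding mem_A restr_def by simp

lemma restr_add: "restr F (x \<oplus>\<^bsub>V\<^esub> y) = restr F x \<oplus>\<^bsub>V\<^esub> restr F y"
  by (auto simp: restr_def V_simps)

lemma restr_U1: "x \<in> U1 \<Longrightarrow> restr F x = \<zero>\<^bsub>V\<^esub>"
  by (auto simp: restr_def V_simps mem_U)

lemma restr_insert:
  "x \<in> A \<Longrightarrow> p \<notin> F \<Longrightarrow> restr (insert p F) x = restr {p} x \<oplus>\<^bsub>V\<^esub> restr F x"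
  using A_closed[of x] by (auto simp: restr_def V_simps fun_eq_iff)

lemma restr_empty: "restr {} x = \<zero>\<^bsub>V\<^esub>"
  by (simp add: restr_def V_simps)

text \<open>Modulo \<open>U1\<close> only coefficients of diagrams with at least i connections are
  visible.\<close>

lemma cls1_eqI:
  assumes "x \<in> A" "y \<in> A" "\<And>d. i \<le> lr_connections d \<Longrightarrow> x d = y d"
  shows "Q1.cls x = Q1.cls y"
proof -
  have xy: "x \<in> carrier V" "y \<in> carrier V" using assms by (simp_all add: V_simps)
  have "(x \<ominus>\<^bsub>V\<^esub> y) d = x d \<ominus> y d" for d
  proof -
    have "\<ominus>\<^bsub>V\<^esub> y = (\<lambda>d. \<ominus> y d)"
      using V.smult_l_minus[of \<one> y] xy A_closed[OF assms(2)] by (simp add: V.smult_one V_simps(4) l_minus)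
    then show ?thesis by (simp add: a_minus_def V_simps)
  qed
  moreover have "x \<ominus>\<^bsub>V\<^esub> y \<in> A" using V.M.minus_closed[OF xy] by (simp add: V_simps)
  ultimately have "x \<ominus>\<^bsub>V\<^esub> y \<in> U1"
    using assms A_closed by (auto simp: mem_U diff_self)
  then show ?thesis using Q1.coset_eq_diff[OF xy] by simp
qed

lemma restr_T: "a \<in> U2 \<Longrightarrow> Q1.cls (restr T a) = Q1.cls a"
proof (rule cls1_eqI)
  assume a: "a \<in> U2"
  show aA: "a \<in> A" using a by (rule U_A)
  then show "restr T a \<in> A" by (rule restr_closed)
  fix d assume d: "i \<le> lr_connections d"
  show "restr T a d = a d"
  proof (cases "d \<in> S \<and> lr_connections d = i")
    case True
    then show ?thesis by (auto simp: restr_def T_def)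
  next
    case False
    then have "a d = \<zero>" using aA a d by (auto simp: mem_A mem_U)
    then show ?thesis by (simp add: restr_def)
  qed
qed

lemma T_link_states: "p \<in> T \<Longrightarrow> p \<in> link_states n i"
  using right_link_state_in_link_states S by (auto simp: T_def)

text \<open>A diagram with right link state p belongs to the basis of \<open>J_p\<close> by the
  empty sequence of splices and deletions.\<close>

lemma restr_link_ideal: "a \<in> A \<Longrightarrow> restr {p} a \<in> A \<inter> link_ideal R n p"
proof -
  assume a: "a \<in> A"
  have "restr {p} a d = \<zero>" if "d \<notin> {d \<in> rb_diagrams n. splice_or_delete\<^sup>*\<^sup>* p (right_link_state d)}" for d
    using that a S by (auto simp: restr_def mem_A)
  then have "restr {p} a \<in> link_ideal R n p"
    using free_moduleD(1,3)[OF restr_closed[OF a]] unfolding link_ideal_def free_module_simps(1) by blast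
  then show ?thesis using restr_closed[OF a] by blast
qed

text \<open>Modulo \<open>U1\<close> an element of \<open>J_q\<close> has only terms with right link
  state q, so its p-part is everything or nothing.\<close>

lemma link_ideal_restr:
  assumes p: "p \<in> T" and q: "q \<in> T" and x: "x \<in> A \<inter> link_ideal R n q"
  shows "Q1.cls (restr {p} x) = (if p = q then Q1.cls x else U1)"
proof -
  have supp: "right_link_state d = q \<and> lr_connections d = i \<or> lr_connections d < i" if "x d \<noteq> \<zero>" for d
    using link_ideal_support[OF T_link_states[OF q], of x R d] x that by blast
  show ?thesis
  proof (cases "p = q")
    case True
    have "Q1.cls (restr {p} x) = Q1.cls x"
    proof (rule cls1_eqI)
      show "restr {p} x d = x d" if "i \<le> lr_connections d" for d
        using supp[of d] that True by (cases "x d = \<zero>") (auto simp: restr_def)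
    qed (use x restr_closed in auto)
    then show ?thesis using True by simp
  next
    case False
    have "Q1.cls (restr {p} x) = Q1.cls \<zero>\<^bsub>V\<^esub>"
    proof (rule cls1_eqI)
      show "restr {p} x d = \<zero>\<^bsub>V\<^esub> d" if "i \<le> lr_connections d" for d
        using supp[of d] that False by (cases "x d = \<zero>") (auto simp: restr_def V_simps)
      show "\<zero>\<^bsub>V\<^esub> \<in> A" using V.M.zero_closed by (simp add: V_simps(1))
    qed (use x restr_closed in auto)
    then show ?thesis using False by (simp add: Q1.cls_zero)
  qed
qed

lemma proj_cls: "x \<in> A \<Longrightarrow> proj (Q1.cls x) = Q2.cls x"
proof -
  assume x: "x \<in> A"
  have "Q2.cls y = Q2.cls x" if y: "y \<in> Q1.cls x" for y
  proof -
    obtain w where "w \<in> U1" "y = w \<oplus>\<^bsub>V\<^esub> x" using y unfolding Q1.coset_mem by blast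
    then show ?thesis using U1_U2 x Q2.coset_eqI[of w x] by (auto simp: V_simps(1))
  qed
  moreover have "x \<in> Q1.cls x" using x by (intro Q1.cls_self) (simp add: V_simps)
  ultimately show ?thesis unfolding proj_def by blast
qed

lemma coord_cls: "x \<in> A \<Longrightarrow> coord p (Q1.cls x) = Q1.cls (restr {p} x)"
proof -
  assume x: "x \<in> A"
  have "Q1.cls (restr {p} y) = Q1.cls (restr {p} x)" if y: "y \<in> Q1.cls x" for y
  proof -
    obtain w where w: "w \<in> U1" "y = w \<oplus>\<^bsub>V\<^esub> x" using y unfolding Q1.coset_mem by blast
    have "restr {p} x \<in> carrier V" using restr_closed[OF x] by (simp add: V_simps)
    then show ?thesis using w by (simp add: restr_add restr_U1)
  qed
  moreover have "x \<in> Q1.cls x" using x by (intro Q1.cls_self) (simp add: V_simps)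
  ultimately show ?thesis unfolding coord_def by blast
qed

lemma B1_carrier: "X \<in> carrier B1 \<longleftrightarrow> (\<exists>x\<in>A. X = Q1.cls x)"
  by (auto simp: Q1.quot_carrier V_simps(1))

lemma proj_ring_hom: "ring_hom_ring B1 B2 proj"
proof (rule ring_hom_ringI2[OF N1.R.ring_axioms N2.R.ring_axioms])
  have c: "x \<in> carrier V" if "x \<in> A" for x using that by (simp add: V_simps)
  show "proj \<in> ring_hom B1 B2"
  proof (rule ring_hom_memI)
    show "proj X \<in> carrier B2" if "X \<in> carrier B1" for X
      using that c by (auto simp: B1_carrier proj_cls Q2.cls_closed)
    show "proj (X \<otimes>\<^bsub>B1\<^esub> Y) = proj X \<otimes>\<^bsub>B2\<^esub> proj Y" if "X \<in> carrier B1" "Y \<in> carrier B1" for X Y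
      using that c by (auto simp: B1_carrier proj_cls Q1.mult_cls Q2.mult_cls V_mult_closed)
    show "proj (X \<oplus>\<^bsub>B1\<^esub> Y) = proj X \<oplus>\<^bsub>B2\<^esub> proj Y" if "X \<in> carrier B1" "Y \<in> carrier B1" for X Y
      using that c by (auto simp: B1_carrier proj_cls Q1.quot_add Q2.quot_add A_add)
    show "proj \<one>\<^bsub>B1\<^esub> = \<one>\<^bsub>B2\<^esub>"
      by (simp add: Q1.quot_one Q2.quot_one proj_cls V_one_closed)
  qed
qed

definition ker :: "(diagram \<Rightarrow> 'r) set set"
  where "ker = {X \<in> carrier B1. proj X = \<zero>\<^bsub>B2\<^esub>}"

lemma mem_ker: "X \<in> ker \<longleftrightarrow> (\<exists>x\<in>U2. X = Q1.cls x)"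
proof
  assume "X \<in> ker"
  then obtain x where x: "x \<in> A" "X = Q1.cls x" "proj X = \<zero>\<^bsub>B2\<^esub>"
    unfolding ker_def B1_carrier by blast
  then have "x \<in> U2" using Q2.coset_zero_iff[of x] by (simp add: proj_cls Q2.quot_zero V_simps(1))
  then show "\<exists>x\<in>U2. X = Q1.cls x" using x by blast
next
  assume "\<exists>x\<in>U2. X = Q1.cls x"
  then obtain x where x: "x \<in> U2" "X = Q1.cls x" by blast
  then have "x \<in> A" by (simp add: U_A)
  then show "X \<in> ker"
    using x Q2.coset_zero_iff[of x] unfolding ker_def B1_carrier
    by (auto simp: proj_cls Q2.quot_zero V_simps(1))
qed

lemma idem_link_ideal: "p \<in> T \<Longrightarrow> idem p \<in> A \<inter> link_ideal R n p"
proof -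
  assume p: "p \<in> T"
  have "idem p \<in> {a \<otimes>\<^bsub>V\<^esub> idem p | a. a \<in> A}"
    using idem_idem[OF p[unfolded T_def]] idem_closed[OF p[unfolded T_def]]
    by (intro CollectI exI[of _ "idem p"]) simp
  then show ?thesis unfolding idem_left_ideal[OF p[unfolded T_def]] .
qed

lemma link_ideal_U2: "p \<in> T \<Longrightarrow> x \<in> A \<inter> link_ideal R n p \<Longrightarrow> x \<in> U2"
proof -
  assume p: "p \<in> T" and x: "x \<in> A \<inter> link_ideal R n p"
  have "x d = \<zero>" if "int i < int (lr_connections d)" for d
    using link_ideal_support[OF T_link_states[OF p], of x R d] x that by auto
  then show ?thesis using x unfolding mem_U by blast
qed

text \<open>Since x = c e for the idempotent e of p, right multiplication by e fixes x. The
  reassociation of (c e) e takes place in the quotient ring.\<close>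

lemma cls_idem:
  assumes p: "p \<in> T" and x: "x \<in> A \<inter> link_ideal R n p"
  shows "Q1.cls x \<otimes>\<^bsub>B1\<^esub> Q1.cls (idem p) = Q1.cls x"
proof -
  have e: "idem p \<in> carrier V" using idem_link_ideal[OF p] by (simp add: V_simps)
  obtain c where c: "c \<in> carrier V" "x = c \<otimes>\<^bsub>V\<^esub> idem p"
    using x idem_left_ideal[OF p[unfolded T_def]] by (auto simp: V_simps(1))
  have "Q1.cls x = Q1.cls c \<otimes>\<^bsub>B1\<^esub> Q1.cls (idem p)"
    unfolding c(2) using c(1) e by (rule Q1.mult_cls[symmetric])
  moreover have "Q1.cls (idem p) \<otimes>\<^bsub>B1\<^esub> Q1.cls (idem p) = Q1.cls (idem p)"
    using e idem_idem[OF p[unfolded T_def]] by (simp add: Q1.mult_cls)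
  ultimately show ?thesis
    using N1.R.m_assoc Q1.cls_closed[OF c(1)] Q1.cls_closed[OF e] by simp
qed

text \<open>Left multiplication does not mix right link states: the q-part of a is c e for the
  idempotent e of q, so its product with b is a multiple of e and stays in \<open>J_q\<close>. This
  is where the equality of \<open>J_q\<close> with the left ideal of e is used in both
  directions.\<close>

lemma cls_restr_mult:
  assumes p: "p \<in> T" and q: "q \<in> T" and a: "a \<in> A" and b: "b \<in> A"
  shows "Q1.cls (restr {p} (b \<otimes>\<^bsub>V\<^esub> restr {q} a)) = (if p = q then Q1.cls (b \<otimes>\<^bsub>V\<^esub> restr {p} a) else U1)"
proof -
  have e: "idem q \<in> A" using idem_link_ideal[OF q] by simp
  obtain c where c: "c \<in> A" "restr {q} a = c \<otimes>\<^bsub>V\<^esub> idem q"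
    using restr_link_ideal[OF a, of q] idem_left_ideal[OF q[unfolded T_def]] by blast
  let ?y = "(b \<otimes>\<^bsub>V\<^esub> c) \<otimes>\<^bsub>V\<^esub> idem q"
  have y: "?y \<in> A \<inter> link_ideal R n q"
    using idem_left_ideal[OF q[unfolded T_def]] V_mult_closed[OF b c(1)] by blast
  have cl: "b \<in> carrier V" "c \<in> carrier V" "idem q \<in> carrier V" "b \<otimes>\<^bsub>V\<^esub> c \<in> carrier V" "c \<otimes>\<^bsub>V\<^esub> idem q \<in> carrier V"
    using b c e by (simp_all add: V_simps(1) V_mult_closed)
  \<comment> \<open>Reassociating b (c e) into (b c) e is done between classes modulo
    \<open>U1\<close>.\<close>
  have eq: "Q1.cls (b \<otimes>\<^bsub>V\<^esub> restr {q} a) = Q1.cls ?y"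
    unfolding c(2) using cl N1.R.m_assoc[OF Q1.cls_closed[OF cl(1)] Q1.cls_closed[OF cl(2)] Q1.cls_closed[OF cl(3)]]
    by (simp add: Q1.mult_cls)
  have "Q1.cls (restr {p} (b \<otimes>\<^bsub>V\<^esub> restr {q} a)) = coord p (Q1.cls (b \<otimes>\<^bsub>V\<^esub> restr {q} a))"
    using b a restr_closed by (intro coord_cls[symmetric] V_mult_closed)
  also have "\<dots> = Q1.cls (restr {p} ?y)"
    unfolding eq using y by (intro coord_cls) simp
  also have "\<dots> = (if p = q then Q1.cls ?y else U1)"
    by (rule link_ideal_restr[OF p q y])
  finally show ?thesis using eq by (auto split: if_splits)
qed

lemma cls_restr_mult_set:
  assumes p: "p \<in> T" and a: "a \<in> A" and b: "b \<in> A" and F: "F \<subseteq> T"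
  shows "Q1.cls (restr {p} (b \<otimes>\<^bsub>V\<^esub> restr F a)) = (if p \<in> F then Q1.cls (b \<otimes>\<^bsub>V\<^esub> restr {p} a) else U1)"
  using finite_subset[OF F finite_T] F
proof (induction F rule: finite_induct)
  case empty
  then show ?case
    using b Q1.mult_zero(2)[of b] restr_U1[of "\<zero>\<^bsub>V\<^esub>" "{p}"] additive_subgroup.zero_closed[OF Q1.additive_subgroup_axioms]
    by (simp add: restr_empty V_simps(1) Q1.cls_zero)
next
  case (insert q F)
  have cl: "restr G (b \<otimes>\<^bsub>V\<^esub> restr G' a) \<in> carrier V" "b \<otimes>\<^bsub>V\<^esub> restr G' a \<in> carrier V" "restr G' a \<in> carrier V" "b \<in> carrier V" for G G'
    using a b by (simp_all add: V_simps(1) restr_closed V_mult_closed)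
  have "Q1.cls (restr {p} (b \<otimes>\<^bsub>V\<^esub> restr (insert q F) a)) =
      Q1.cls (restr {p} (b \<otimes>\<^bsub>V\<^esub> restr {q} a)) \<oplus>\<^bsub>B1\<^esub> Q1.cls (restr {p} (b \<otimes>\<^bsub>V\<^esub> restr F a))"
    unfolding restr_insert[OF a insert.hyps(2)] using cl by (simp add: restr_add Q1.mult_r_distr Q1.quot_add)
  also have "\<dots> = (if p = q then Q1.cls (b \<otimes>\<^bsub>V\<^esub> restr {p} a) else U1) \<oplus>\<^bsub>B1\<^esub>
      (if p \<in> F then Q1.cls (b \<otimes>\<^bsub>V\<^esub> restr {p} a) else U1)"
    using insert cls_restr_mult[OF p _ a b, of q] by simp
  also have "\<dots> = (if p \<in> insert q F then Q1.cls (b \<otimes>\<^bsub>V\<^esub> restr {p} a) else U1)"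
    using insert.hyps(2) N1.R.r_zero[OF Q1.cls_closed[OF cl(2)[of "{p}"]]] N1.R.l_zero[OF Q1.cls_closed[OF cl(2)[of "{p}"]]]
      N1.R.l_zero[OF N1.R.zero_closed]
    by (auto simp: Q1.quot_zero)
  finally show ?case .
qed

text \<open>Left linearity of the coordinates on the kernel. Modulo \<open>U1\<close> the element a
  is the sum of its parts over T, and multiplication by b respects each part.\<close>

lemma coord_mult:
  assumes p: "p \<in> T" and b: "b \<in> A" and a: "a \<in> U2"
  shows "coord p (Q1.cls b \<otimes>\<^bsub>B1\<^esub> Q1.cls a) = Q1.cls b \<otimes>\<^bsub>B1\<^esub> coord p (Q1.cls a)"
proof -
  have aA: "a \<in> A" using a by (rule U_A)
  have cl: "restr F a \<in> carrier V" "b \<in> carrier V" for F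
    using aA b by (simp_all add: V_simps(1) restr_closed)
  have "Q1.cls b \<otimes>\<^bsub>B1\<^esub> Q1.cls a = Q1.cls (b \<otimes>\<^bsub>V\<^esub> restr T a)"
    unfolding restr_T[OF a, symmetric] using cl by (intro Q1.mult_cls)
  then have "coord p (Q1.cls b \<otimes>\<^bsub>B1\<^esub> Q1.cls a) = Q1.cls (restr {p} (b \<otimes>\<^bsub>V\<^esub> restr T a))"
    using b aA restr_closed V_mult_closed by (simp add: coord_cls)
  also have "\<dots> = Q1.cls (b \<otimes>\<^bsub>V\<^esub> restr {p} a)"
    using cls_restr_mult_set[OF p aA b order.refl] p by simp
  also have "\<dots> = Q1.cls b \<otimes>\<^bsub>B1\<^esub> coord p (Q1.cls a)"
    using cl aA by (simp add: coord_cls Q1.mult_cls)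
  finally show ?thesis .
qed

lemma cls_restr_sum:
  assumes a: "a \<in> A" and F: "F \<subseteq> T"
  shows "Q1.cls (restr F a) = (\<Oplus>\<^bsub>B1\<^esub>p\<in>F. Q1.cls (restr {p} a))"
  using finite_subset[OF F finite_T]
proof (induction F rule: finite_induct)
  case empty
  then show ?case by (simp add: restr_empty Q1.cls_zero Q1.quot_zero)
next
  case (insert q F)
  have cl: "restr F a \<in> carrier V" for F
    using a by (simp add: V_simps(1) restr_closed)
  have "(\<Oplus>\<^bsub>B1\<^esub>p\<in>insert q F. Q1.cls (restr {p} a)) =
      Q1.cls (restr {q} a) \<oplus>\<^bsub>B1\<^esub> (\<Oplus>\<^bsub>B1\<^esub>p\<in>F. Q1.cls (restr {p} a))"
    using insert cl by (intro N1.R.finsum_insert) (auto intro: Q1.cls_closed)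
  then show ?case
    unfolding restr_insert[OF a insert.hyps(2)] using Q1.quot_add[OF cl cl, of "{q}" F] insert.IH by simp
qed

sublocale ideal: idempotent_ideal ker B1 T "\<lambda>p. Q1.cls (idem p)" coord
proof (intro idempotent_ideal.intro idempotent_ideal_axioms.intro)
  show "ideal ker B1"
    using ring_hom_ring.kernel_is_ideal[OF proj_ring_hom] by (simp add: ker_def a_kernel_def')
  show "finite T" by (rule finite_T)
  fix p assume p: "p \<in> T"
  have e: "idem p \<in> A \<inter> link_ideal R n p" by (rule idem_link_ideal[OF p])
  show "Q1.cls (idem p) \<in> ker" using link_ideal_U2[OF p e] by (auto simp: mem_ker)
  show "Q1.cls (idem p) \<otimes>\<^bsub>B1\<^esub> Q1.cls (idem p) = Q1.cls (idem p)"
    by (rule cls_idem[OF p e])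
  fix X assume "X \<in> ker"
  then obtain x where x: "x \<in> U2" "x \<in> A" "X = Q1.cls x" using U_A by (auto simp: mem_ker)
  show "coord p X \<in> carrier B1"
    using x restr_closed by (auto simp: coord_cls B1_carrier)
  show "coord p (X \<oplus>\<^bsub>B1\<^esub> Y) = coord p X \<oplus>\<^bsub>B1\<^esub> coord p Y" if "Y \<in> ker" for Y
  proof -
    obtain y where y: "y \<in> A" "Y = Q1.cls y" using \<open>Y \<in> ker\<close> U_A by (auto simp: mem_ker)
    have "x \<in> carrier V" "y \<in> carrier V" "restr {p} x \<in> carrier V" "restr {p} y \<in> carrier V"
      using x y by (simp_all add: V_simps(1) restr_closed)
    then show ?thesis
      using x y by (simp add: Q1.quot_add coord_cls A_add restr_add)
  qed
  show "coord p (Y \<otimes>\<^bsub>B1\<^esub> X) = Y \<otimes>\<^bsub>B1\<^esub> coord p X" if "Y \<in> carrier B1" for Y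
    using that coord_mult[OF p _ x(1)] x(3) by (auto simp: B1_carrier)
next
  fix X assume "X \<in> ker"
  then obtain x where x: "x \<in> U2" "x \<in> A" "X = Q1.cls x" using U_A by (auto simp: mem_ker)
  have "(\<Oplus>\<^bsub>B1\<^esub>p\<in>T. coord p X \<otimes>\<^bsub>B1\<^esub> Q1.cls (idem p)) = (\<Oplus>\<^bsub>B1\<^esub>p\<in>T. Q1.cls (restr {p} x))"
  proof (rule N1.R.finsum_cong')
    show "(\<lambda>p. Q1.cls (restr {p} x)) \<in> T \<rightarrow> carrier B1"
      using restr_closed[OF x(2)] unfolding B1_carrier Pi_iff by blast
    \<comment> \<open>The p-part of x lies in \<open>J_p\<close>, where right multiplication by the
      idempotent of p is the identity modulo \<open>U1\<close>.\<close>
    show "coord p X \<otimes>\<^bsub>B1\<^esub> Q1.cls (idem p) = Q1.cls (restr {p} x)" if "p \<in> T" for p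
      using cls_idem[OF that restr_link_ideal[OF x(2)]] x(2,3) by (simp add: coord_cls)
  qed simp
  also have "\<dots> = X"
    using cls_restr_sum[OF x(2) order.refl] restr_T[OF x(1)] x(3) by simp
  finally show "X = (\<Oplus>\<^bsub>B1\<^esub>p\<in>T. coord p X \<otimes>\<^bsub>B1\<^esub> Q1.cls (idem p))" by simp
qed

lemma idempotent_quotient:
  "idempotent_quotient R B1 B2 (trivial_module R n) character character proj ker T
    (\<lambda>p. Q1.cls (idem p)) coord"
proof (intro idempotent_quotient.intro idempotent_quotient_axioms.intro)
  show "trivial_coefficients R B1 (trivial_module R n) character"
    using i by (intro trivial_coefficients_quot N1) simp
  show "trivial_coefficients R B2 (trivial_module R n) character"
    using i by (intro trivial_coefficients_quot N2) simp
  show "ring_hom_ring B1 B2 proj" by (rule proj_ring_hom)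
  show "idempotent_ideal ker B1 T (\<lambda>p. Q1.cls (idem p)) coord" by (rule ideal.idempotent_ideal_axioms)
  show "ker = {X \<in> carrier B1. proj X = \<zero>\<^bsub>B2\<^esub>}" by (rule ker_def)
  have "Q2.cls x \<in> proj ` carrier B1" if "x \<in> A" for x
    using that proj_cls[OF that] by (intro image_eqI[of _ _ "Q1.cls x"]) (auto simp: B1_carrier)
  then show "proj ` carrier B1 = carrier B2"
    by (auto simp: B1_carrier proj_cls Q2.quot_carrier V_simps(1))
  show "proj (r \<odot>\<^bsub>B1\<^esub> \<one>\<^bsub>B1\<^esub>) = r \<odot>\<^bsub>B2\<^esub> \<one>\<^bsub>B2\<^esub>" if "r \<in> carrier R" for r
    using that V_one_closed V.smult_closed[of r "\<one>\<^bsub>V\<^esub>"]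
    by (simp add: Q1.quot_one Q2.quot_one Q1.quot_smult Q2.quot_smult V_simps(1) proj_cls)
  show "proj X \<odot>\<^bsub>trivial_module R n\<^esub> s = X \<odot>\<^bsub>trivial_module R n\<^esub> s" if "X \<in> carrier B1" for X s
    using that i by (auto simp: B1_carrier proj_cls trivial_smult)
qed

end

theorem theorem1p11:
  fixes R :: "'r ring"
    and n l m :: nat
    and \<delta> \<epsilon> :: 'r
    and A :: "(diagram \<Rightarrow> 'r) set"
  assumes "cring R"
    and "\<delta> \<in> carrier R" and "\<epsilon> \<in> carrier R"
    and "l \<le> m" and "m < n"
    and "subalgebra R A (rook_brauer R n \<delta> \<epsilon>)"
    and "\<exists>S \<subseteq> rb_diagrams n. A = carrier (free_module R S)"
    and "\<And>i p. \<lbrakk>l \<le> i; i \<le> m; p \<in> link_states n i;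
            \<exists>d\<in>rb_diagrams n. basis_elem R d \<in> A \<and> right_link_state d = p\<rbrakk> \<Longrightarrow>
          \<exists>e\<in>A. e \<otimes>\<^bsub>rook_brauer R n \<delta> \<epsilon>\<^esub> e = e \<and>
            {a \<otimes>\<^bsub>rook_brauer R n \<delta> \<epsilon>\<^esub> e | a. a \<in> A} = A \<inter> link_ideal R n p"
  shows "\<forall>i\<in>{l..m}.
    \<forall>(P :: nat \<Rightarrow> ((diagram \<Rightarrow> 'r) set, 'p) module) d \<eta>
     (P' :: nat \<Rightarrow> ((diagram \<Rightarrow> 'r) set, 'q) module) d' \<eta>'.
      projective_resolution (conn_quotient R n \<delta> \<epsilon> A (int i - 1)) (trivial_module R n) P d \<eta> \<longrightarrow>
      projective_resolution (conn_quotient R n \<delta> \<epsilon> A (int i)) (trivial_module R n) P' d' \<eta>' \<longrightarrow>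
      (\<forall>k. mod_isomorphic R
        (Tor R (conn_quotient R n \<delta> \<epsilon> A (int i - 1)) (trivial_module R n) P d k)
        (Tor R (conn_quotient R n \<delta> \<epsilon> A (int i)) (trivial_module R n) P' d' k))"
proof (intro ballI allI impI)
  fix i k and P :: "nat \<Rightarrow> ((diagram \<Rightarrow> 'r) set, 'p) module" and d \<eta>
    and P' :: "nat \<Rightarrow> ((diagram \<Rightarrow> 'r) set, 'q) module" and d' \<eta>'
  assume i: "i \<in> {l..m}"
    and res1: "projective_resolution (conn_quotient R n \<delta> \<epsilon> A (int i - 1)) (trivial_module R n) P d \<eta>"
    and res2: "projective_resolution (conn_quotient R n \<delta> \<epsilon> A (int i)) (trivial_module R n) P' d' \<eta>'"
  obtain S where S: "S \<subseteq> rb_diagrams n" and A: "A = carrier (free_module R S)"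
    using assms(7) by blast
  interpret R: rook_subalgebra R n \<delta> \<epsilon> S
    using assms(1-3,6) S unfolding A by (simp add: rook_subalgebra_def rook_subalgebra_axioms_def)
  let ?T = "right_link_state ` {d \<in> S. lr_connections d = i}"
  \<comment> \<open>Only right link states of basis diagrams with exactly i connections occur. For d
    in S the basis vector of d lies in A and is the diagram that the hypothesis on p asks
    for.\<close>
  have "\<forall>p\<in>?T. \<exists>e. e \<in> A \<and> e \<otimes>\<^bsub>R.V\<^esub> e = e \<and> {a \<otimes>\<^bsub>R.V\<^esub> e | a. a \<in> A} = A \<inter> link_ideal R n p"
  proof
    fix p assume "p \<in> ?T"
    then obtain d where d: "d \<in> S" "lr_connections d = i" "p = right_link_state d" by blast
    have "d \<in> rb_diagrams n" "basis_elem R d \<in> A"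
      using d(1) S R.basis_elem_closed[of d S] unfolding A by auto
    moreover from this have "p \<in> link_states n i"
      using right_link_state_in_link_states[of d n] d by simp
    ultimately show "\<exists>e. e \<in> A \<and> e \<otimes>\<^bsub>R.V\<^esub> e = e \<and> {a \<otimes>\<^bsub>R.V\<^esub> e | a. a \<in> A} = A \<inter> link_ideal R n p"
      using assms(8)[of i p] i d(3) unfolding R.rook_mult by auto
  qed
  from bchoice[OF this] obtain idem where idem: "\<forall>p\<in>?T. idem p \<in> A \<and> idem p \<otimes>\<^bsub>R.V\<^esub> idem p = idem p \<and>
      {a \<otimes>\<^bsub>R.V\<^esub> idem p | a. a \<in> A} = A \<inter> link_ideal R n p" by (rule exE)
  \<comment> \<open>A projective resolution includes the module laws of the resolved module, hence
    also that the quotient of A is a ring.\<close>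
  have N: "left_module (quot R.V (R.U (int i - 1))) (trivial_module R n)"
    "left_module (quot R.V (R.U (int i))) (trivial_module R n)"
    using res1 res2 unfolding A R.conn_quotient_eq projective_resolution_def by blast+
  interpret L: rook_layer R n \<delta> \<epsilon> S i idem
  proof (intro rook_layer.intro R.rook_subalgebra_axioms rook_layer_axioms.intro N)
    show "i < n" using i assms(5) by simp
    fix p assume "p \<in> ?T"
    from bspec[OF idem this] show "idem p \<in> R.A" "idem p \<otimes>\<^bsub>R.V\<^esub> idem p = idem p"
      "{a \<otimes>\<^bsub>R.V\<^esub> idem p | a. a \<in> R.A} = R.A \<inter> link_ideal R n p"
      unfolding A by blast+
  qed
  show "mod_isomorphic R
      (Tor R (conn_quotient R n \<delta> \<epsilon> A (int i - 1)) (trivial_module R n) P d k)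
      (Tor R (conn_quotient R n \<delta> \<epsilon> A (int i)) (trivial_module R n) P' d' k)"
    using idempotent_quotient.Tor_isomorphic[OF L.idempotent_quotient] res1 res2
    unfolding A R.conn_quotient_eq by blast
qed

end
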